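(* Let $A=(A,\oplus,\odot)$ be a finite skew brace such that the derived subgroup $A_{\oplus}^{\prime}$ of its additive group $A_{\oplus}=(A,\oplus)$ is cyclic. Then the multiplicative group $A_{\odot}=(A,\odot)$ is solvable.
   Context: A skew brace is a set $A$ with two binary operations $\oplus,\odot$ such that $A_{\oplus}=(A,\oplus)$ and $A_{\odot}=(A,\odot)$ are groups and $a\odot(b\oplus c)=(a\odot b)\ominus a\oplus(a\odot c)$ for all $a,b,c\in A$, where $\ominus a$ denotes the inverse of $a$ in $A_{\oplus}$. *)

theory Defs
  imports "HOL-Algebra.Algebra"
begin

definition skew_brace :: "('a, 'b) monoid_scheme \<Rightarrow> ('a, 'c) monoid_scheme \<Rightarrow> bool" where
  "skew_brace Add Mul \<longleftrightarrow>
     group Add \<and> group Mul \<and> carrier Add = carrier Mul \<and>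
     (\<forall>a \<in> carrier Add. \<forall>b \<in> carrier Add. \<forall>c \<in> carrier Add.
        a \<otimes>\<^bsub>Mul\<^esub> (b \<otimes>\<^bsub>Add\<^esub> c)
          = ((a \<otimes>\<^bsub>Mul\<^esub> b) \<otimes>\<^bsub>Add\<^esub> inv\<^bsub>Add\<^esub> a) \<otimes>\<^bsub>Add\<^esub> (a \<otimes>\<^bsub>Mul\<^esub> c))"

end

theory Submission
  imports Defs "Jordan_Normal_Form.Schur_Decomposition"
begin

text \<open>
  Let \<open>C\<close> be the cyclic derived subgroup of the additive group. The maps \<open>lam a b = -a + a b\<close> are
  additive automorphisms and preserve \<open>C\<close>. Automorphisms of a cyclic group commute, so additive
  conjugation on \<open>C\<close> is multiplicative in the acting element also for the multiplication of the
  brace. Therefore the additive centralizer \<open>K\<close> of \<open>C\<close> contains all multiplicative commutators, and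
  it is a sub skew brace whose additive group has nilpotency class at most two.

  In such a brace the elements of additive order prime to \<open>p\<close> form a left ideal of \<open>p\<close>-power index.
  If three primes divide the order, these left ideals are solvable by induction, and Wielandt's
  theorem on three solvable subgroups of coprime indices applies; otherwise the order is
  \<open>p\<^sup>a q\<^sup>b\<close> and Burnside's theorem applies.

  Burnside's theorem rests on the fact that a finite simple group has no noncentral conjugacy class
  of prime power size. It is obtained without irreducible characters: the class sum acts on the
  regular representation as a normal integer matrix, and the traces of \<open>x\<close> and of \<open>v \<mapsto> x v x\<close> on its
  eigenspaces take over the role of the characters.
\<close>

hide_const (open) Divisibility.prime Polynomial.order Polynomials.degree
  Polynomials.lead_coeff up_ring.monom up_ring.coeff

subsection \<open>Algebraic integers\<close>

text \<open>Write the eigenvalue as \<open>l = c * gamma\<close> with the class size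
  \<open>c\<close>; then \<open>x\<close> has trace \<open>tau = gamma * d\<close>. If
  \<open>p\<close> does not divide \<open>d\<close>, gamma is an integral combination of the
  algebraic integers \<open>tau\<close> and \<open>l\<close>. If \<open>p\<close> divides
  \<open>d\<close>, gamma may fail to be integral, so \<open>tau / p\<close> is out of reach. But v
  |-> x v x has trace \<open>gamma * tau\<close>, an algebraic integer, so
  \<open>tau^2 = d * gamma * tau\<close> is divisible by \<open>p\<close> and
  \<open>tau / sqrt p\<close> is integral. That weaker divisibility still gives a contradiction
  after summing over all eigenvalues. On the brace side, a left ideal need not be normal in the
  multiplicative group, so there is no quotient to induct on. What survives is its index, which is
  the same in both groups. This is why a criterion on indices is used; it needs three primes, and
  orders with fewer fall to Burnside.\<close>

lemma algebraic_int_int_eigenvalue: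
  fixes M :: "int mat" and a :: complex
  assumes M: "M \<in> carrier_mat n n" and v: "v \<in> carrier_vec n" "v \<noteq> 0\<^sub>v n"
    and ev: "map_mat of_int M *\<^sub>v v = a \<cdot>\<^sub>v v"
  shows "algebraic_int a"
proof -
  let ?C = "map_mat of_int M :: complex mat"
  have C: "?C \<in> carrier_mat n n" using M by simp
  have "eigenvalue ?C a"
    unfolding eigenvalue_def eigenvector_def using v ev C by auto
  then have "poly (char_poly ?C) a = 0" using eigenvalue_root_char_poly[OF C] by simp
  moreover have "char_poly ?C = map_poly of_int (char_poly M)"
    by (rule of_int_hom.char_poly_hom[OF M])
  moreover have "lead_coeff (char_poly M) = 1" using degree_monic_char_poly[OF M] by auto
  ultimately show ?thesis unfolding algebraic_int_altdef_ipoly by auto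
qed

lemma algebraic_int_power_reduction:
  fixes a :: complex
  assumes "algebraic_int a"
  obtains d :: nat and c :: "nat \<Rightarrow> int" where "d > 0" "a ^ d = (\<Sum>i<d. of_int (c i) * a ^ i)"
proof -
  obtain p where p: "poly (map_poly of_int p) a = 0" "lead_coeff p = (1::int)"
    using assms algebraic_int_altdef_ipoly by blast
  have d0: "degree p > 0"
  proof (rule ccontr)
    assume "\<not> degree p > 0"
    then have "p = 1" using p(2) by (metis gr0I lead_coeff_1 degree_1 degree_0_id of_int_hom.hom_one one_poly_eq_simps(1))
    then show False using p(1) by simp
  qed
  have "0 = (\<Sum>i\<le>degree p. of_int (coeff p i) * a ^ i)"
    using p(1) by (simp add: poly_altdef degree_map_poly coeff_map_poly)
  also have "\<dots> = (\<Sum>i<degree p. of_int (coeff p i) * a ^ i) + a ^ degree p"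
    using p(2) by (simp flip: lessThan_Suc_atMost)
  finally have "a ^ degree p = (\<Sum>i<degree p. of_int (- coeff p i) * a ^ i)"
    by (simp add: sum_negf eq_neg_iff_add_eq_0 add.commute)
  then show ?thesis using that[of "degree p" "\<lambda>i. - coeff p i"] d0 by blast
qed

text \<open>Multiplication by \<open>a\<close> and by \<open>b\<close> on the span of the monomials
  \<open>a ^ i * b ^ j\<close> with \<open>i < m\<close> and \<open>j < n\<close> has integer
  matrices \<open>A\<close> and \<open>B\<close>. The vector of these monomials is a common
  eigenvector, so sum and product are eigenvalues of \<open>A + B\<close> and
  \<open>A * B\<close>.\<close>

lemma algebraic_int_add_mult:
  fixes a b :: complex
  assumes "algebraic_int a" "algebraic_int b"
  shows "algebraic_int (a + b)" "algebraic_int (a * b)"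
proof -
  obtain m c where m: "m > 0" "a ^ m = (\<Sum>i<m. of_int (c i) * a ^ i)"
    using algebraic_int_power_reduction[OF assms(1)] by metis
  obtain n d where n: "n > 0" "b ^ n = (\<Sum>i<n. of_int (d i) * b ^ i)"
    using algebraic_int_power_reduction[OF assms(2)] by metis
  define N where "N = m * n"
  \<comment> \<open>Position \<open>k\<close> of the vector carries the exponents
    \<open>k div n\<close> and \<open>k mod n\<close>.\<close>
  define v where "v = vec N (\<lambda>k. a ^ (k div n) * b ^ (k mod n))"
  \<comment> \<open>Companion matrices: row \<open>i\<close> of \<open>f\<close> expresses
    \<open>a * a ^ i\<close> in the powers below \<open>m\<close>, and only the last row needs the
    reduction of \<open>a ^ m\<close>.\<close>
  define f where "f i i' = (if Suc i < m then if i' = Suc i then 1 else 0 else c i')" for i i'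
  define g where "g i i' = (if Suc i < n then if i' = Suc i then 1 else 0 else d i')" for i i'
  define A where "A = mat N N (\<lambda>(k,l). if k mod n = l mod n then f (k div n) (l div n) else 0 :: int)"
  define B where "B = mat N N (\<lambda>(k,l). if k div n = l div n then g (k mod n) (l mod n) else 0 :: int)"
  have fa: "(\<Sum>i'<m. of_int (f i i') * a ^ i') = a * a ^ i" if "i < m" for i
  proof (cases "Suc i < m")
    case True
    then have "(\<Sum>i'<m. of_int (f i i') * a ^ i') = (\<Sum>i'<m. if i' = Suc i then a ^ i' else 0)"
      by (intro sum.cong) (auto simp: f_def)
    then show ?thesis using True by simp
  next
    case False
    then have "Suc i = m" using that by simp
    then show ?thesis using m(2) by (auto simp: f_def)
  qed
  have gb: "(\<Sum>i'<n. of_int (g i i') * b ^ i') = b * b ^ i" if "i < n" for i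
  proof (cases "Suc i < n")
    case True
    then have "(\<Sum>i'<n. of_int (g i i') * b ^ i') = (\<Sum>i'<n. if i' = Suc i then b ^ i' else 0)"
      by (intro sum.cong) (auto simp: g_def)
    then show ?thesis using True by simp
  next
    case False
    then have "Suc i = n" using that by simp
    then show ?thesis using n(2) by (auto simp: g_def)
  qed
  have split: "(\<Sum>l<N. h (l div n) (l mod n)) = (\<Sum>i<m. \<Sum>j<n. h i j)" for h :: "nat \<Rightarrow> nat \<Rightarrow> complex"
  proof -
    have "(\<Sum>i<m. \<Sum>j<n. h i j) = (\<Sum>(i,j)\<in>{..<m}\<times>{..<n}. h i j)" by (simp add: sum.cartesian_product)
    also have "\<dots> = (\<Sum>l<N. h (l div n) (l mod n))"
    proof (rule sum.reindex_bij_witness[of _ "\<lambda>l. (l div n, l mod n)" "\<lambda>(i,j). i * n + j"], goal_cases)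
      case (4 b)
      then show ?case using n(1) by (auto simp: N_def less_mult_imp_div_less)
    next
      case (2 a)
      then obtain i j where ij: "a = (i,j)" "i < m" "j < n" by auto
      have "i * n + j < Suc i * n" using ij by simp
      also have "\<dots> \<le> m * n" using ij by (intro mult_right_mono) auto
      finally show ?case using ij by (simp add: N_def)
    qed (use n(1) in auto)
    finally show ?thesis by simp
  qed
  have vN: "v \<in> carrier_vec N" and AN: "A \<in> carrier_mat N N" and BN: "B \<in> carrier_mat N N"
    by (auto simp: v_def A_def B_def)
  have N0: "N > 0" using m n N_def by simp
  have v0: "v \<noteq> 0\<^sub>v N"
  proof
    assume "v = 0\<^sub>v N"
    then have "v $ 0 = 0" using N0 by simp
    then show False using N0 by (simp add: v_def)
  qed
  have dm: "k div n < m" "k mod n < n" if "k < N" for k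
    using that n(1) by (auto simp: N_def less_mult_imp_div_less)
  have Av: "map_mat of_int A *\<^sub>v v = a \<cdot>\<^sub>v v"
  proof (rule eq_vecI)
    fix k assume "k < dim_vec (a \<cdot>\<^sub>v v)"
    then have k: "k < N" using vN by auto
    have "(map_mat of_int A *\<^sub>v v) $ k = (\<Sum>l<N. (if k mod n = l mod n then of_int (f (k div n) (l div n)) else 0) * (a ^ (l div n) * b ^ (l mod n)))"
      using k by (auto simp: A_def v_def scalar_prod_def lessThan_atLeast0 intro!: sum.cong)
    also have "\<dots> = (\<Sum>i<m. \<Sum>j<n. (if k mod n = j then of_int (f (k div n) i) else 0) * (a ^ i * b ^ j))"
      by (rule split)
    also have "\<dots> = (\<Sum>i<m. \<Sum>j<n. if k mod n = j then of_int (f (k div n) i) * a ^ i * b ^ j else 0)"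
      by (intro sum.cong) auto
    also have "\<dots> = (\<Sum>i<m. of_int (f (k div n) i) * a ^ i * b ^ (k mod n))"
      using dm[OF k] by simp
    also have "\<dots> = (\<Sum>i<m. of_int (f (k div n) i) * a ^ i) * b ^ (k mod n)"
      by (simp add: sum_distrib_right)
    also have "\<dots> = (a \<cdot>\<^sub>v v) $ k" using fa[OF dm(1)[OF k]] k by (simp add: v_def)
    finally show "(map_mat of_int A *\<^sub>v v) $ k = (a \<cdot>\<^sub>v v) $ k" .
  qed (auto simp: A_def v_def)
  have Bv: "map_mat of_int B *\<^sub>v v = b \<cdot>\<^sub>v v"
  proof (rule eq_vecI)
    fix k assume "k < dim_vec (b \<cdot>\<^sub>v v)"
    then have k: "k < N" using vN by auto
    have "(map_mat of_int B *\<^sub>v v) $ k = (\<Sum>l<N. (if k div n = l div n then of_int (g (k mod n) (l mod n)) else 0) * (a ^ (l div n) * b ^ (l mod n)))"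
      using k by (auto simp: B_def v_def scalar_prod_def lessThan_atLeast0 intro!: sum.cong)
    also have "\<dots> = (\<Sum>i<m. \<Sum>j<n. (if k div n = i then of_int (g (k mod n) j) else 0) * (a ^ i * b ^ j))"
      by (rule split)
    also have "\<dots> = (\<Sum>j<n. \<Sum>i<m. if k div n = i then a ^ i * (of_int (g (k mod n) j) * b ^ j) else 0)"
      by (subst sum.swap, intro sum.cong) auto
    also have "\<dots> = (\<Sum>j<n. a ^ (k div n) * (of_int (g (k mod n) j) * b ^ j))"
      using dm[OF k] by simp
    also have "\<dots> = a ^ (k div n) * (\<Sum>j<n. of_int (g (k mod n) j) * b ^ j)"
      by (simp add: sum_distrib_left)
    also have "\<dots> = (b \<cdot>\<^sub>v v) $ k" using gb[OF dm(2)[OF k]] k by (simp add: v_def)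
    finally show "(map_mat of_int B *\<^sub>v v) $ k = (b \<cdot>\<^sub>v v) $ k" .
  qed (auto simp: B_def v_def)
  let ?A = "map_mat of_int A :: complex mat" and ?B = "map_mat of_int B :: complex mat"
  have AC: "?A \<in> carrier_mat N N" and BC: "?B \<in> carrier_mat N N" using AN BN by auto
  have "map_mat of_int (A + B) = ?A + ?B" using AN BN by (intro eq_matI) auto
  then have "map_mat of_int (A + B) *\<^sub>v v = (a + b) \<cdot>\<^sub>v v"
    using add_mult_distrib_mat_vec[OF AC BC vN] Av Bv by (simp add: add_smult_distrib_vec)
  then show "algebraic_int (a + b)"
    by (intro algebraic_int_int_eigenvalue[OF _ vN v0]) (use AN BN in auto)
  have "map_mat of_int (A * B) = ?A * ?B" by (rule of_int_hom.mat_hom_mult[OF AN BN])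
  then have "map_mat of_int (A * B) *\<^sub>v v = ?A *\<^sub>v (?B *\<^sub>v v)"
    using assoc_mult_mat_vec[OF AC BC vN] by simp
  also have "\<dots> = (a * b) \<cdot>\<^sub>v v" using mult_mat_vec[OF AC vN] Av Bv by (simp add: smult_smult_assoc mult.commute)
  finally show "algebraic_int (a * b)"
    by (intro algebraic_int_int_eigenvalue[OF _ vN v0]) (use AN BN in auto)
qed

lemma algebraic_int_sum:
  "(\<And>i. i \<in> S \<Longrightarrow> algebraic_int (f i :: complex)) \<Longrightarrow> algebraic_int (sum f S)"
  by (induction S rule: infinite_finite_induct) (auto intro: algebraic_int_add_mult)

lemma algebraic_int_power: "algebraic_int (a :: complex) \<Longrightarrow> algebraic_int (a ^ n)"
  by (induction n) (auto intro: algebraic_int_add_mult)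

lemma algebraic_int_of_power:
  fixes z :: complex
  assumes "algebraic_int (z ^ k)" "k > 0"
  shows "algebraic_int z"
  using assms algebraic_int_root[of "z ^ k" "monom 1 k" z] by (auto simp: poly_monom degree_monom_eq)

lemma algebraic_int_of_int: "algebraic_int (of_int k :: complex)"
  by (rule int_imp_algebraic_int) simp

lemma algebraic_int_of_nat: "algebraic_int (of_nat k :: complex)"
  by (rule int_imp_algebraic_int) simp

text \<open>Kronecker's argument: the minimal polynomial divides both an integral one and one with all
  roots in the unit disc, so its constant term is a nonzero integer of absolute value at most 1.\<close>
lemma algebraic_int_norm_eq_1:
  fixes a :: complex
  assumes a: "algebraic_int a" "a \<noteq> 0"
    and q: "q \<noteq> 0" "poly (map_poly of_rat q) a = 0"
    and disc: "\<And>z. poly (map_poly of_rat q) z = (0::complex) \<Longrightarrow> cmod z \<le> 1"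
  shows "cmod a = 1"
proof -
  interpret mp: map_poly_comm_ring_hom "of_rat :: rat \<Rightarrow> complex" ..
  let ?P = "\<lambda>r. r \<noteq> 0 \<and> poly (map_poly of_rat r) a = (0::complex)"
  obtain g0 where g0: "?P g0" and g0min: "\<And>r. ?P r \<Longrightarrow> degree g0 \<le> degree r"
    using ex_has_least_nat[of ?P q degree] q by auto
  \<comment> \<open>Monic scaling makes the constant term equal to the product of the negated
    roots.\<close>
  define g where "g = smult (inverse (lead_coeff g0)) g0"
  have g: "g \<noteq> 0" "poly (map_poly of_rat g) a = (0::complex)" "lead_coeff g = 1" "degree g = degree g0"
    using g0 by (auto simp: g_def map_poly_smult of_rat_hom.hom_mult)
  have gdvd: "g dvd r" if "poly (map_poly of_rat r) a = (0::complex)" for r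
  proof (rule ccontr)
    assume "\<not> g dvd r"
    then have nz: "r mod g \<noteq> 0" by (simp add: mod_eq_0_iff_dvd)
    have "r = g * (r div g) + r mod g" by simp
    then have "poly (map_poly of_rat r) a = poly (map_poly of_rat (g * (r div g) + r mod g)) a" by simp
    then have "poly (map_poly of_rat (r mod g)) a = (0::complex)"
      using that g(2) by (simp only: mp.hom_add mp.hom_mult poly_add poly_mult) simp
    then have "degree g \<le> degree (r mod g)" using g0min nz g(4) by simp
    moreover have "degree (r mod g) < degree g" using degree_mod_less[OF g(1), of r] nz by simp
    ultimately show False by simp
  qed
  obtain p where p: "poly (map_poly of_int p) a = 0" "lead_coeff p = (1::int)"
    using a(1) algebraic_int_altdef_ipoly by blast
  have "map_poly of_rat (map_poly of_int p :: rat poly) = (map_poly of_int p :: complex poly)"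
    by (intro poly_eqI) (simp add: coeff_map_poly)
  then have gp: "g dvd map_poly of_int p" and gq: "g dvd q"
    using p(1) q(2) gdvd by auto
  let ?g = "map_poly of_rat g :: complex poly"
  have roots_int: "algebraic_int z" if "poly ?g z = 0" for z
  proof -
    obtain k where "map_poly of_int p = g * k" using gp by (auto elim: dvdE)
    then have "map_poly of_rat (map_poly of_int p :: rat poly) = ?g * map_poly of_rat k"
      by (simp add: mp.hom_mult)
    then have "poly (map_poly of_int p) z = 0"
      using that \<open>map_poly of_rat (map_poly of_int p :: rat poly) = (map_poly of_int p :: complex poly)\<close> by simp
    then show ?thesis using p(2) algebraic_int_altdef_ipoly by blast
  qed
  have roots_disc: "cmod z \<le> 1" if "poly ?g z = 0" for z
  proof -
    obtain k where "q = g * k" using gq by (auto elim: dvdE)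
    then have "map_poly of_rat q = ?g * map_poly of_rat k" by (simp add: mp.hom_mult)
    then show ?thesis using disc that by simp
  qed
  obtain zs where zs: "?g = (\<Prod>z\<leftarrow>zs. [:- z, 1:])"
    using fundamental_theorem_algebra_factorized[of ?g] g(3)
    by (metis (no_types, lifting) of_rat_hom.degree_map_poly_hom of_rat_hom.coeff_map_poly_hom of_rat_hom.hom_one smult_1_left)
  have zs_root: "poly ?g z = 0 \<longleftrightarrow> z \<in> set zs" for z
    unfolding zs by (induction zs) (auto simp: add_eq_0_iff)
  have const: "poly ?g 0 = (\<Prod>z\<leftarrow>zs. - z)"
    unfolding zs by (induction zs) auto
  have "algebraic_int (\<Prod>z\<leftarrow>ws. - z)" if "set ws \<subseteq> set zs" for ws
    using that roots_int zs_root by (induction ws) (auto intro!: algebraic_int_add_mult)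
  then have "algebraic_int (poly ?g 0)" using const by simp
  moreover have "poly ?g 0 = of_rat (coeff g 0)" by (simp add: poly_0_coeff_0 coeff_map_poly)
  ultimately have int: "poly ?g 0 \<in> \<int>" using rational_algebraic_int_is_int[of "poly ?g 0"] by auto
  \<comment> \<open>If 0 were a root, cancelling the factor X would leave a smaller polynomial that
    kills the nonzero number \<open>a\<close>.\<close>
  have nz: "poly ?g 0 \<noteq> 0"
  proof
    assume "poly ?g 0 = 0"
    then have "[:0,1:] dvd g" by (simp add: poly_0_coeff_0 coeff_map_poly flip: poly_eq_0_iff_dvd[of _ 0, simplified])
    then obtain k where k: "g = [:0,1:] * k" by (auto elim: dvdE)
    then have k0: "k \<noteq> 0" using g(1) by auto
    have "map_poly of_rat g = [:0,1:] * (map_poly of_rat k :: complex poly)"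
      unfolding k by (simp add: of_rat_hom.map_poly_pCons_hom)
    then have "poly (map_poly of_rat k) a = (0::complex)" using g(2) a(2) by simp
    then have "degree g \<le> degree k" using g0min k0 g(4) by simp
    then show False using k k0 by simp
  qed
  obtain m where m: "poly ?g 0 = of_int m" using int by (rule Ints_cases)
  then have "m \<noteq> 0" using nz by auto
  then have "cmod (poly ?g 0) \<ge> 1" unfolding m by (simp add: norm_of_int)
  moreover have "cmod (\<Prod>z\<leftarrow>ws. - z) \<le> 1" if "set ws \<subseteq> set zs" for ws
    using that roots_disc zs_root by (induction ws) (auto simp: norm_mult intro!: mult_le_one)
  moreover have "a \<in> set zs" using zs_root g(2) by blast
  then obtain us vs where uv: "zs = us @ a # vs" by (meson split_list)
  have "cmod (poly ?g 0) = cmod (\<Prod>z\<leftarrow>us @ vs. - z) * cmod a"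
    unfolding const uv by (simp add: norm_mult)
  moreover have "set (us @ vs) \<subseteq> set zs" unfolding uv by auto
  ultimately have "1 \<le> cmod a"
    by (metis mult_left_le_one_le norm_ge_zero order_trans)
  moreover have "cmod a \<le> 1" using roots_disc g(2) by blast
  ultimately show ?thesis by simp
qed

subsection \<open>Traces and eigenprojections of complex matrices\<close>

lemma nonzero_vec_index:
  assumes "v \<in> carrier_vec n" "v \<noteq> 0\<^sub>v n"
  obtains i where "i < n" "v $ i \<noteq> 0"
proof -
  have "\<exists>i<n. v $ i \<noteq> 0"
  proof (rule ccontr)
    assume "\<not> (\<exists>i<n. v $ i \<noteq> 0)"
    then have "v = 0\<^sub>v n" using assms(1) by (intro eq_vecI) auto
    then show False using assms(2) by simp
  qed
  then show ?thesis using that by blast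
qed

definition mtrace :: "complex mat \<Rightarrow> complex" where
  "mtrace M = (\<Sum>i<dim_row M. M $$ (i, i))"

lemma mtrace_mult_comm:
  assumes "A \<in> carrier_mat n m" "B \<in> carrier_mat m n"
  shows "mtrace (A * B) = mtrace (B * A)"
proof -
  have "mtrace (A * B) = (\<Sum>i<n. \<Sum>j<m. A $$ (i,j) * B $$ (j,i))"
    using assms by (auto simp: mtrace_def scalar_prod_def lessThan_atLeast0 intro!: sum.cong)
  also have "\<dots> = (\<Sum>j<m. \<Sum>i<n. B $$ (j,i) * A $$ (i,j))"
    by (subst sum.swap) (simp add: mult.commute)
  also have "\<dots> = mtrace (B * A)"
    using assms by (auto simp: mtrace_def scalar_prod_def lessThan_atLeast0 intro!: sum.cong)
  finally show ?thesis .
qed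

lemma mtrace_mult_sum:
  assumes "M \<in> carrier_mat n n" "N \<in> carrier_mat n n"
  shows "mtrace (M * N) = (\<Sum>i<n. \<Sum>j<n. M $$ (i,j) * N $$ (j,i))"
  using assms by (auto simp: mtrace_def scalar_prod_def lessThan_atLeast0 intro!: sum.cong)

text \<open>\<open>M\<close> commutes with \<open>P\<close>, so the conjugation can be pulled around
  the whole product, where cyclic invariance of the trace removes it. This makes the traces below
  constant on conjugacy classes.\<close>

lemma mtrace_conj:
  assumes M: "M \<in> carrier_mat n n" and P: "P \<in> carrier_mat n n" "Q \<in> carrier_mat n n" "Q * P = 1\<^sub>m n"
    and Z: "Z \<in> carrier_mat n n" and PM: "M * P = P * M"
  shows "mtrace (M * (P * Z * Q)) = mtrace (M * Z)"
proof -
  have "M * (P * Z * Q) = P * (M * Z * Q)"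
    using M P Z PM
    by (simp flip: assoc_mult_mat[of M n n P n "Z * Q" n] add: assoc_mult_mat[of P n n Z n Q n] assoc_mult_mat[of M n n Z n Q n] assoc_mult_mat[of P n n M n "Z * Q" n])
  then have "mtrace (M * (P * Z * Q)) = mtrace (M * Z * Q * P)"
    using mtrace_mult_comm[OF P(1), of "M * Z * Q"] M P Z by simp
  also have "M * Z * Q * P = M * Z * (Q * P)" using M P Z by (intro assoc_mult_mat[of _ n n _ n _ n]) auto
  also have "\<dots> = M * Z" using P(3) M Z by simp
  finally show ?thesis .
qed

lemma mtrace_smult: "mtrace (c \<cdot>\<^sub>m M) = c * mtrace M" if "M \<in> carrier_mat n n"
  using that by (auto simp: mtrace_def sum_distrib_left)

text \<open>By Schur triangularization the trace is the sum of the eigenvalues, each of which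
  inherits the relation from \<open>M\<close>. Periodicity replaces finite order because the maps in
  question vanish outside one eigenspace.\<close>

lemma mtrace_periodic:
  assumes M: "M \<in> carrier_mat n n" and per: "M ^\<^sub>m Suc k = M"
  shows "\<exists>es. mtrace M = sum_list es \<and> (\<forall>e\<in>set es. e ^ Suc k = e)"
proof -
  obtain es where es: "char_poly M = (\<Prod>a\<leftarrow>es. [:- a, 1:])" "length es = n"
    using char_poly_factorized[OF M] by blast
  obtain B P Q where BPQ: "schur_decomposition M es = (B, P, Q)" by (cases "schur_decomposition M es") auto
  have sim: "similar_mat_wit M B P Q" and diag: "diag_mat B = es"
    using schur_decomposition[OF M es(1) BPQ] by auto
  note w = similar_mat_witD2[OF M sim]
  have "mtrace M = mtrace (P * (B * Q))" using w by (simp add: assoc_mult_mat[of P n n B n Q n])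
  also have "\<dots> = mtrace ((B * Q) * P)" using w by (intro mtrace_mult_comm[of _ n n]) auto
  also have "\<dots> = mtrace B" using w by (simp add: assoc_mult_mat[of B n n Q n P n])
  also have "\<dots> = sum_list es" using w
    by (simp flip: diag add: diag_mat_def mtrace_def sum_list_sum_nth lessThan_atLeast0)
  finally have tr: "mtrace M = sum_list es" .
  have "e ^ Suc k = e" if e: "e \<in> set es" for e
  proof -
    have "poly (char_poly M) e = 0" unfolding es(1) using e by (auto simp: poly_prod_list prod_list_zero_iff)
    then have "eigenvalue M e" using eigenvalue_root_char_poly[OF M] by simp
    then obtain v where v: "eigenvector M v e" by (auto simp: eigenvalue_def)
    then have vn: "v \<in> carrier_vec n" "v \<noteq> 0\<^sub>v n" "M *\<^sub>v v = e \<cdot>\<^sub>v v" using M by (auto simp: eigenvector_def)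
    have "e \<cdot>\<^sub>v v = e ^ Suc k \<cdot>\<^sub>v v" using eigenvector_pow[OF M v, of "Suc k"] per vn(3) by simp
    obtain i where i: "i < n" "v $ i \<noteq> 0" using nonzero_vec_index[OF vn(1,2)] by blast
    have "(e \<cdot>\<^sub>v v) $ i = (e ^ Suc k \<cdot>\<^sub>v v) $ i" using \<open>e \<cdot>\<^sub>v v = e ^ Suc k \<cdot>\<^sub>v v\<close> by simp
    then show ?thesis using i vn(1) by simp
  qed
  then show ?thesis using tr by blast
qed

lemma algebraic_int_root_of_unity_or_0:
  fixes e :: complex
  assumes "e ^ Suc k = e" "k > 0"
  shows "algebraic_int e"
proof (cases "e = 0")
  case False
  then have "e ^ k = 1" using assms(1) by simp
  then show ?thesis using assms(2) algebraic_int_of_power[of e k] by simp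
qed simp

lemma algebraic_int_mtrace_periodic:
  assumes "M \<in> carrier_mat n n" "M ^\<^sub>m Suc k = M" "k > 0"
  shows "algebraic_int (mtrace M)"
proof -
  obtain es where es: "mtrace M = sum_list es" "\<forall>e\<in>set es. e ^ Suc k = e"
    using mtrace_periodic[OF assms(1,2)] by blast
  have "\<forall>e\<in>set es. algebraic_int e" using es(2) assms(3) algebraic_int_root_of_unity_or_0 by blast
  then have "algebraic_int (sum_list es)" by (induction es) (auto intro: algebraic_int_add_mult)
  then show ?thesis using es(1) by simp
qed

text \<open>The eigenvalues are 0 and 1, so \<open>d\<close> is the rank; for an eigenprojection it
  is the dimension of the eigenspace.\<close>

lemma mtrace_idempotent:
  assumes M: "M \<in> carrier_mat n n" and "M * M = M"
  shows "\<exists>d::nat. mtrace M = of_nat d"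
proof -
  have "M ^\<^sub>m Suc 1 = M" using assms by simp
  then obtain es where es: "mtrace M = sum_list es" "\<forall>e\<in>set es. e ^ Suc 1 = e"
    using mtrace_periodic[OF M] by blast
  have "\<forall>e\<in>set es. e = 0 \<or> e = 1" using es(2) by (auto simp: power2_eq_square)
  then have "\<exists>d::nat. sum_list es = of_nat d"
  proof (induction es)
    case (Cons a es)
    then obtain d where d: "sum_list es = of_nat d" by auto
    have "a = of_nat 0 \<or> a = of_nat 1" using Cons.prems by auto
    then show ?case using d by (metis of_nat_add sum_list.Cons)
  qed (auto intro: exI[of _ 0])
  then show ?thesis using es(1) by simp
qed

section \<open>Adjoints and kernels of normal matrices\<close>

definition hermitian_conj :: "complex mat \<Rightarrow> complex mat" where
  "hermitian_conj M = mat (dim_col M) (dim_row M) (\<lambda>(i,j). cnj (M $$ (j,i)))"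

lemma hermitian_conj_carrier [simp]:
  "M \<in> carrier_mat n m \<Longrightarrow> hermitian_conj M \<in> carrier_mat m n"
  by (auto simp: hermitian_conj_def)

lemma hermitian_conj_mult:
  assumes "A \<in> carrier_mat n m" "B \<in> carrier_mat m l"
  shows "hermitian_conj (A * B) = hermitian_conj B * hermitian_conj A"
  using assms by (intro eq_matI) (auto simp: hermitian_conj_def scalar_prod_def mult.commute intro!: sum.cong)

lemma hermitian_conj_hermitian_conj [simp]: "hermitian_conj (hermitian_conj M) = M"
  by (intro eq_matI) (auto simp: hermitian_conj_def)

text \<open>The diagonal entries of the product are the squared norms of the columns of
  \<open>Y\<close>.\<close>

lemma hermitian_conj_mult_self_eq_0:
  assumes Y: "Y \<in> carrier_mat n m" and 0: "hermitian_conj Y * Y = 0\<^sub>m m m"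
  shows "Y = 0\<^sub>m n m"
proof (rule eq_matI)
  fix i j assume ij: "i < dim_row (0\<^sub>m n m :: complex mat)" "j < dim_col (0\<^sub>m n m :: complex mat)"
  have "(hermitian_conj Y * Y) $$ (j,j) = 0" using 0 ij by simp
  then have "(\<Sum>k<n. cnj (Y $$ (k,j)) * Y $$ (k,j)) = 0"
    using Y ij by (simp add: hermitian_conj_def scalar_prod_def lessThan_atLeast0)
  then have "(\<Sum>k<n. complex_of_real ((cmod (Y $$ (k,j)))\<^sup>2)) = 0"
    by (simp only: complex_norm_square mult.commute)
  then have "(\<Sum>k<n. (cmod (Y $$ (k,j)))\<^sup>2) = 0"
    by (simp only: of_real_sum[symmetric] of_real_eq_0_iff)
  then have "\<forall>k<n. (cmod (Y $$ (k,j)))\<^sup>2 = 0" by (simp add: sum_nonneg_eq_0_iff)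
  then show "Y $$ (i,j) = 0\<^sub>m n m $$ (i,j)" using ij by simp
qed (use Y in auto)

text \<open>A normal matrix and its adjoint have the same kernel: \<open>N * Y = 0\<close> for
  \<open>Y = N * M\<close> makes the adjoint of \<open>N\<close> kill \<open>Y\<close>, and then the
  adjoint of \<open>Y\<close> times \<open>Y\<close> vanishes. The columns of \<open>M\<close> play
  the role of vectors.\<close>

lemma normal_mat_square_kernel:
  assumes N: "N \<in> carrier_mat n n" and M: "M \<in> carrier_mat n n"
    and comm: "N * hermitian_conj N = hermitian_conj N * N"
    and 0: "N * (N * M) = 0\<^sub>m n n"
  shows "N * M = 0\<^sub>m n n"
proof -
  let ?H = "hermitian_conj N"
  have H: "?H \<in> carrier_mat n n" using N by simp
  define Y where "Y = N * M"
  have Y: "Y \<in> carrier_mat n n" using N M by (simp add: Y_def)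
  have HY: "hermitian_conj Y \<in> carrier_mat n n" using Y by simp
  have "hermitian_conj (?H * Y) * (?H * Y) = hermitian_conj Y * N * (?H * Y)"
    using hermitian_conj_mult[OF H Y] by simp
  also have "\<dots> = hermitian_conj Y * (N * (?H * Y))" 
    by (rule assoc_mult_mat[OF HY N mult_carrier_mat[OF H Y]])
  also have "N * (?H * Y) = (N * ?H) * Y" using N H Y by (simp add: assoc_mult_mat[of N n n ?H n Y n])
  also have "\<dots> = ?H * (N * Y)" unfolding comm using N H Y by (intro assoc_mult_mat[of _ n n _ n _ n]) auto
  also have "\<dots> = 0\<^sub>m n n" using 0 H by (simp add: Y_def)
  finally have "hermitian_conj (?H * Y) * (?H * Y) = 0\<^sub>m n n" using HY by simp
  then have HY0: "?H * Y = 0\<^sub>m n n" using hermitian_conj_mult_self_eq_0[of "?H * Y" n n] H Y by simp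
  have MH: "hermitian_conj M \<in> carrier_mat n n" using M by simp
  have "hermitian_conj Y * Y = hermitian_conj M * ?H * Y" using hermitian_conj_mult[OF N M] by (simp add: Y_def)
  also have "\<dots> = hermitian_conj M * (?H * Y)" using MH H Y by (intro assoc_mult_mat[of _ n n _ n _ n]) auto
  also have "\<dots> = 0\<^sub>m n n" using HY0 MH by simp
  finally show ?thesis using hermitian_conj_mult_self_eq_0[OF Y] by (simp add: Y_def)
qed

section \<open>Polynomials in a matrix, given by their lists of roots\<close>

definition linear_factor_prod :: "complex mat \<Rightarrow> complex list \<Rightarrow> complex mat" where
  "linear_factor_prod A ls = foldr (\<lambda>l M. char_matrix A l * M) ls (1\<^sub>m (dim_row A))"

text \<open>Stands in for being a polynomial in \<open>A\<close>: it is stable under the operations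
  that build the eigenprojections, and it hands them every commutation that \<open>A\<close> has
  with the group translations.\<close>

definition in_bicommutant :: "complex mat \<Rightarrow> complex mat \<Rightarrow> bool" where
  "in_bicommutant A E \<longleftrightarrow> E \<in> carrier_mat (dim_row A) (dim_row A) \<and>
     (\<forall>W \<in> carrier_mat (dim_row A) (dim_row A). A * W = W * A \<longrightarrow> E * W = W * E)"

context
  fixes n :: nat and A :: "complex mat"
  assumes A: "A \<in> carrier_mat n n"
begin

lemma linear_factor_prod_simps:
  "linear_factor_prod A [] = 1\<^sub>m n"
  "linear_factor_prod A (l # ls) = char_matrix A l * linear_factor_prod A ls"
  using A by (auto simp: linear_factor_prod_def)

lemma linear_factor_prod_carrier: "linear_factor_prod A ls \<in> carrier_mat n n"
  using A by (induction ls) (auto simp: linear_factor_prod_simps intro!: mult_carrier_mat[of _ n n _ n])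

lemma linear_factor_prod_append:
  "linear_factor_prod A (ls @ ms) = linear_factor_prod A ls * linear_factor_prod A ms"
proof (induction ls)
  case (Cons l ls)
  then show ?case using A linear_factor_prod_carrier
    by (simp add: linear_factor_prod_simps assoc_mult_mat[of _ n n _ n _ n])
qed (use linear_factor_prod_carrier left_mult_one_mat in \<open>force simp: linear_factor_prod_simps\<close>)

lemma char_matrix_mult:
  assumes W: "W \<in> carrier_mat n m"
  shows "char_matrix A l * W = A * W + (- l) \<cdot>\<^sub>m W"
proof -
  have "char_matrix A l * W = A * W + ((- l) \<cdot>\<^sub>m 1\<^sub>m n) * W"
    unfolding char_matrix_def using A W by (simp add: add_mult_distrib_mat[of A n n _ W m])
  also have "((- l) \<cdot>\<^sub>m 1\<^sub>m n) * W = (- l) \<cdot>\<^sub>m W"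
    using W mult_smult_assoc_mat[of "1\<^sub>m n" n n W m "- l"] by simp
  finally show ?thesis .
qed

lemma mult_char_matrix:
  assumes W: "W \<in> carrier_mat m n"
  shows "W * char_matrix A l = W * A + (- l) \<cdot>\<^sub>m W"
proof -
  have "W * char_matrix A l = W * A + W * ((- l) \<cdot>\<^sub>m 1\<^sub>m n)"
    unfolding char_matrix_def using A W by (simp add: mult_add_distrib_mat[of W m n A n])
  also have "W * ((- l) \<cdot>\<^sub>m 1\<^sub>m n) = (- l) \<cdot>\<^sub>m W"
    using W mult_smult_distrib[of W m n "1\<^sub>m n" n "- l"] by simp
  finally show ?thesis .
qed

lemma char_matrix_mult_eigen:
  assumes Y: "Y \<in> carrier_mat n m" and AY: "A * Y = l \<cdot>\<^sub>m Y"
  shows "char_matrix A \<mu> * Y = (l - \<mu>) \<cdot>\<^sub>m Y"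
  unfolding char_matrix_mult[OF Y] AY using Y by (intro eq_matI) (auto simp: algebra_simps)

lemma char_matrix_mult_eq_0:
  assumes Y: "Y \<in> carrier_mat n m" and 0: "char_matrix A l * Y = 0\<^sub>m n m"
  shows "A * Y = l \<cdot>\<^sub>m Y"
proof (rule eq_matI)
  fix i j assume "i < dim_row (l \<cdot>\<^sub>m Y)" "j < dim_col (l \<cdot>\<^sub>m Y)"
  then have ij: "i < n" "j < m" using Y by auto
  have "(A * Y + (- l) \<cdot>\<^sub>m Y) $$ (i,j) = 0" using 0 ij unfolding char_matrix_mult[OF Y] by simp
  moreover have "(A * Y + (- l) \<cdot>\<^sub>m Y) $$ (i,j) = (A * Y) $$ (i,j) - l * Y $$ (i,j)"
    using A Y ij by (simp del: index_mult_mat(1))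
  ultimately show "(A * Y) $$ (i,j) = (l \<cdot>\<^sub>m Y) $$ (i,j)" using Y ij by (simp del: index_mult_mat(1))
qed (use A Y in auto)

lemma in_bicommutantD:
  assumes "in_bicommutant A E"
  shows "E \<in> carrier_mat n n" "\<And>W. W \<in> carrier_mat n n \<Longrightarrow> A * W = W * A \<Longrightarrow> E * W = W * E"
  using assms A by (auto simp: in_bicommutant_def)

lemma in_bicommutantI:
  assumes "E \<in> carrier_mat n n" "\<And>W. W \<in> carrier_mat n n \<Longrightarrow> A * W = W * A \<Longrightarrow> E * W = W * E"
  shows "in_bicommutant A E"
  using assms A by (auto simp: in_bicommutant_def)

lemma in_bicommutant_one: "in_bicommutant A (1\<^sub>m n)"
  by (rule in_bicommutantI) auto

lemma in_bicommutant_char_matrix: "in_bicommutant A (char_matrix A l)"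
  by (rule in_bicommutantI) (use A in \<open>auto simp: char_matrix_mult mult_char_matrix\<close>)

lemma in_bicommutant_mult:
  assumes "in_bicommutant A E" "in_bicommutant A F"
  shows "in_bicommutant A (E * F)"
proof (rule in_bicommutantI)
  note E = in_bicommutantD[OF assms(1)] and F = in_bicommutantD[OF assms(2)]
  show "E * F \<in> carrier_mat n n" using E(1) F(1) by simp
  fix W assume W: "W \<in> carrier_mat n n" "A * W = W * A"
  have "E * F * W = E * (F * W)" by (rule assoc_mult_mat[OF E(1) F(1) W(1)])
  also have "\<dots> = E * (W * F)" unfolding F(2)[OF W] ..
  also have "\<dots> = E * W * F" by (rule assoc_mult_mat[OF E(1) W(1) F(1), symmetric])
  also have "\<dots> = W * E * F" unfolding E(2)[OF W] ..
  also have "\<dots> = W * (E * F)" by (rule assoc_mult_mat[OF W(1) E(1) F(1)])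
  finally show "E * F * W = W * (E * F)" .
qed

lemma in_bicommutant_smult:
  assumes "in_bicommutant A E"
  shows "in_bicommutant A (c \<cdot>\<^sub>m E)"
proof (rule in_bicommutantI)
  note E = in_bicommutantD[OF assms(1)]
  show "c \<cdot>\<^sub>m E \<in> carrier_mat n n" using E(1) by simp
  fix W assume W: "W \<in> carrier_mat n n" "A * W = W * A"
  show "c \<cdot>\<^sub>m E * W = W * (c \<cdot>\<^sub>m E)"
    unfolding mult_smult_assoc_mat[OF E(1) W(1)] mult_smult_distrib[OF W(1) E(1)] E(2)[OF W] ..
qed

lemma in_bicommutant_minus:
  assumes "in_bicommutant A E" "in_bicommutant A F"
  shows "in_bicommutant A (E - F)"
proof (rule in_bicommutantI)
  note E = in_bicommutantD[OF assms(1)] and F = in_bicommutantD[OF assms(2)]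
  show "E - F \<in> carrier_mat n n" using E(1) F(1) by (intro minus_carrier_mat)
  fix W assume W: "W \<in> carrier_mat n n" "A * W = W * A"
  show "(E - F) * W = W * (E - F)"
    unfolding minus_mult_distrib_mat[OF E(1) F(1) W(1)] mult_minus_distrib_mat[OF W(1) E(1) F(1)]
      E(2)[OF W] F(2)[OF W] ..
qed

lemma in_bicommutant_linear_factor_prod: "in_bicommutant A (linear_factor_prod A ls)"
  by (induction ls) (auto simp: linear_factor_prod_simps
      intro: in_bicommutant_one in_bicommutant_mult in_bicommutant_char_matrix)

lemma linear_factor_prod_mult_eigen:
  assumes Y: "Y \<in> carrier_mat n n" and AY: "A * Y = l \<cdot>\<^sub>m Y"
  shows "linear_factor_prod A ls * Y = (\<Prod>\<mu>\<leftarrow>ls. l - \<mu>) \<cdot>\<^sub>m Y"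
proof (induction ls)
  case (Cons \<mu> ls)
  have "linear_factor_prod A (\<mu> # ls) * Y = char_matrix A \<mu> * (linear_factor_prod A ls * Y)"
    using A Y linear_factor_prod_carrier
    by (simp add: linear_factor_prod_simps assoc_mult_mat[of _ n n _ n _ n])
  also have "\<dots> = (\<Prod>\<mu>\<leftarrow>ls. l - \<mu>) \<cdot>\<^sub>m (char_matrix A \<mu> * Y)"
    unfolding Cons.IH using mult_smult_distrib[of _ n n Y n] A Y by simp
  also have "\<dots> = (\<Prod>\<mu>\<leftarrow>\<mu> # ls. l - \<mu>) \<cdot>\<^sub>m Y"
    unfolding char_matrix_mult_eigen[OF Y AY] using Y by (intro eq_matI) auto
  finally show ?case .
qed (use Y in \<open>auto simp: linear_factor_prod_simps\<close>)

end

section \<open>Cayley-Hamilton through the Schur form\<close>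

lemma linear_factor_prod_similar:
  assumes A: "A \<in> carrier_mat n n" and sim: "similar_mat_wit A B P Q"
  shows "linear_factor_prod A ls = P * linear_factor_prod B ls * Q"
proof -
  note w = similar_mat_witD2[OF A sim]
  note lB = linear_factor_prod_simps[OF w(5)]
  have cB: "linear_factor_prod B ls \<in> carrier_mat n n" for ls
    by (rule linear_factor_prod_carrier[OF w(5)])
  have cm: "char_matrix A l = P * char_matrix B l * Q" for l
  proof -
    have "P * char_matrix B l * Q = (P * B + P * ((- l) \<cdot>\<^sub>m 1\<^sub>m n)) * Q"
      unfolding char_matrix_def using w(1,2,5-7) by (simp add: mult_add_distrib_mat[of P n n B n])
    also have "P * ((- l) \<cdot>\<^sub>m 1\<^sub>m n) = (- l) \<cdot>\<^sub>m P"
      using w mult_smult_distrib[of P n n "1\<^sub>m n" n "- l"] by simp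
    also have "(P * B + (- l) \<cdot>\<^sub>m P) * Q = P * B * Q + (- l) \<cdot>\<^sub>m P * Q"
      using w(1,2,5-7) by (intro add_mult_distrib_mat[of _ n n]) auto
    also have "(- l) \<cdot>\<^sub>m P * Q = (- l) \<cdot>\<^sub>m 1\<^sub>m n" using w(1,2,5-7) by (simp add: mult_smult_assoc_mat[of P n n Q n])
    finally show ?thesis using w A by (simp add: char_matrix_def)
  qed
  show ?thesis
  proof (induction ls)
    case Nil
    then show ?case using w(1,2,5-7) by (simp add: lB linear_factor_prod_simps[OF A])
  next
    case (Cons l ls)
    have c: "char_matrix B l \<in> carrier_mat n n" using w(1,2,5-7) by simp
    have "linear_factor_prod A (l # ls) = (P * char_matrix B l * Q) * (P * linear_factor_prod B ls * Q)"
      by (simp add: linear_factor_prod_simps[OF A] cm Cons)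
    also have "\<dots> = P * char_matrix B l * ((Q * P) * (linear_factor_prod B ls * Q))"
      using w(5-7) c cB[of ls] by (simp add: assoc_mult_mat[of _ n n _ n _ n] mult_carrier_mat[of _ n n _ n])
    also have "\<dots> = P * linear_factor_prod B (l # ls) * Q"
      using w(1,2,5-7) c cB[of ls] by (simp add: lB assoc_mult_mat[of _ n n _ n _ n] mult_carrier_mat[of _ n n _ n])
    finally show ?case .
  qed
qed

text \<open>Each factor kills one more column. When the factor for position \<open>k\<close> is
  multiplied from the right, the columns before \<open>k\<close> of the old product are already
  zero, and the factor itself has zeros from row \<open>k\<close> on in all columns up to
  \<open>k\<close>, by triangularity and by the choice of the diagonal entry.\<close>

lemma linear_factor_prod_upper_triangular:
  assumes B: "B \<in> carrier_mat n n" and ut: "upper_triangular B"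
  shows "linear_factor_prod B (diag_mat B) = 0\<^sub>m n n"
proof -
  have "linear_factor_prod B (take k (diag_mat B)) $$ (i, j) = 0" if "k \<le> n" "i < n" "j < k" for k i j
    using that
  proof (induction k arbitrary: i j)
    case (Suc k)
    let ?P = "linear_factor_prod B (take k (diag_mat B))"
    have len: "length (diag_mat B) = n" using B by (simp add: diag_mat_def)
    have d: "diag_mat B ! k = B $$ (k,k)" using B Suc.prems by (simp add: diag_mat_def)
    have P: "?P \<in> carrier_mat n n" by (rule linear_factor_prod_carrier[OF B])
    have "linear_factor_prod B [B $$ (k,k)] = char_matrix B (B $$ (k,k))"
      using right_mult_one_mat[OF char_matrix_closed[OF B]] by (simp add: linear_factor_prod_simps[OF B])
    then have "linear_factor_prod B (take (Suc k) (diag_mat B)) = ?P * char_matrix B (B $$ (k,k))"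
      using Suc.prems len d by (simp add: take_Suc_conv_app_nth linear_factor_prod_append[OF B])
    then have "linear_factor_prod B (take (Suc k) (diag_mat B)) $$ (i,j)
        = (\<Sum>l<n. ?P $$ (i,l) * char_matrix B (B $$ (k,k)) $$ (l,j))"
      using P B Suc.prems by (simp add: scalar_prod_def lessThan_atLeast0 char_matrix_def)
    also have "\<dots> = 0"
    proof (rule sum.neutral, rule ballI)
      fix l assume l: "l \<in> {..<n}"
      show "?P $$ (i,l) * char_matrix B (B $$ (k,k)) $$ (l,j) = 0"
      proof (cases "l < k")
        case True
        then show ?thesis using Suc by simp
      next
        case False
        then have "l \<ge> j" using Suc.prems by simp
        moreover have "B $$ (l,j) = 0" if "l > j" using ut B l that by auto
        ultimately have "char_matrix B (B $$ (k,k)) $$ (l,j) = 0"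
          using B l False Suc.prems unfolding char_matrix_def by (cases "l = j") (auto simp: less_Suc_eq)
        then show ?thesis by simp
      qed
    qed
    finally show ?case .
  qed simp
  from this[of n] have "linear_factor_prod B (diag_mat B) $$ (i, j) = 0" if "i < n" "j < n" for i j
    using that B by (simp add: diag_mat_def)
  then show ?thesis using linear_factor_prod_carrier[OF B, of "diag_mat B"] by (intro eq_matI) auto
qed

lemma linear_factor_prod_annihilates:
  assumes A: "A \<in> carrier_mat n n"
  shows "\<exists>ls. linear_factor_prod A ls = 0\<^sub>m n n"
proof -
  obtain es where es: "char_poly A = (\<Prod>a\<leftarrow>es. [:- a, 1:])"
    using char_poly_factorized[OF A] by blast
  obtain B P Q where BPQ: "schur_decomposition A es = (B, P, Q)" by (cases "schur_decomposition A es") auto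
  have sim: "similar_mat_wit A B P Q" and ut: "upper_triangular B"
    using schur_decomposition[OF A es BPQ] by auto
  note w = similar_mat_witD2[OF A sim]
  have "linear_factor_prod A (diag_mat B) = P * 0\<^sub>m n n * Q"
    using linear_factor_prod_similar[OF A sim] linear_factor_prod_upper_triangular[OF w(5) ut] by simp
  also have "\<dots> = 0\<^sub>m n n" using w by simp
  finally show ?thesis by blast
qed

section \<open>Spectral projections of a normal matrix\<close>

locale normal_mat =
  fixes n :: nat and A :: "complex mat"
  assumes A: "A \<in> carrier_mat n n"
    and normal: "A * hermitian_conj A = hermitian_conj A * A"
begin

lemma char_matrix_square_kernel:
  assumes M: "M \<in> carrier_mat n n" and 0: "char_matrix A l * (char_matrix A l * M) = 0\<^sub>m n n"
  shows "char_matrix A l * M = 0\<^sub>m n n"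
proof (rule normal_mat_square_kernel[OF _ M _ 0])
  show cA: "char_matrix A l \<in> carrier_mat n n" using A by simp
  have H: "hermitian_conj A \<in> carrier_mat n n" using A by simp
  have eq: "hermitian_conj (char_matrix A l) = char_matrix (hermitian_conj A) (cnj l)"
    using A by (intro eq_matI) (auto simp: hermitian_conj_def char_matrix_def)
  have 1: "in_bicommutant A (char_matrix A l)" by (rule in_bicommutant_char_matrix[OF A])
  have "char_matrix A l * hermitian_conj A = hermitian_conj A * char_matrix A l"
    using in_bicommutantD(2)[OF A 1 H normal] .
  then show "char_matrix A l * hermitian_conj (char_matrix A l) = hermitian_conj (char_matrix A l) * char_matrix A l"
    unfolding eq using char_matrix_mult[OF H cA] mult_char_matrix[OF H cA] by simp
qed

lemma linear_factor_prod_remdups: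
  "M \<in> carrier_mat n n \<Longrightarrow> linear_factor_prod A ls * M = 0\<^sub>m n n \<Longrightarrow>
    linear_factor_prod A (remdups ls) * M = 0\<^sub>m n n"
proof (induction ls arbitrary: M)
  case (Cons l ls)
  let ?c = "char_matrix A l"
  note simps = linear_factor_prod_simps[OF A] and cl = linear_factor_prod_carrier[OF A]
  have c: "?c \<in> carrier_mat n n" using A by simp
  have comm: "?c * linear_factor_prod A ms = linear_factor_prod A ms * ?c" for ms
    using in_bicommutantD(2)[OF A in_bicommutant_char_matrix[OF A] cl]
      in_bicommutantD(2)[OF A in_bicommutant_linear_factor_prod[OF A] A] by metis
  have shift: "linear_factor_prod A (l # ms) * M = linear_factor_prod A ms * (?c * M)" for ms
    using c cl[of ms] Cons.prems(1) by (simp add: simps comm assoc_mult_mat[of _ n n _ n _ n])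
  have cM: "?c * M \<in> carrier_mat n n" using c Cons.prems by simp
  have 0: "linear_factor_prod A (remdups ls) * (?c * M) = 0\<^sub>m n n"
    using Cons.IH[OF cM] Cons.prems shift by simp
  show ?case
  proof (cases "l \<in> set ls")
    case False
    then show ?thesis using 0 shift by simp
  next
    case True
    \<comment> \<open>A copy of the leading factor sits inside the remaining product; pulling it to
      the front exhibits the square.\<close>
    then obtain us vs where uv: "remdups ls = us @ l # vs" by (metis set_remdups split_list)
    define K where "K = linear_factor_prod A us * (linear_factor_prod A vs * M)"
    have K: "K \<in> carrier_mat n n" using cl Cons.prems by (simp add: K_def mult_carrier_mat[of _ n n])
    have cvs: "linear_factor_prod A vs * M \<in> carrier_mat n n" using cl Cons.prems by (simp add: mult_carrier_mat[of _ n n])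
    have split: "linear_factor_prod A (remdups ls) * M = ?c * K"
    proof -
      have "linear_factor_prod A (remdups ls) * M = linear_factor_prod A us * (?c * (linear_factor_prod A vs * M))"
        unfolding uv linear_factor_prod_append[OF A] simps using c cl Cons.prems(1)
        by (simp add: assoc_mult_mat[of _ n n _ n _ n] mult_carrier_mat[of _ n n])
      also have "\<dots> = (linear_factor_prod A us * ?c) * (linear_factor_prod A vs * M)"
        using c cl cvs by (simp add: assoc_mult_mat[of _ n n _ n _ n])
      also have "\<dots> = ?c * K"
        unfolding comm[symmetric] K_def using c cl cvs by (simp add: assoc_mult_mat[of _ n n _ n _ n])
      finally show ?thesis .
    qed
    have "?c * (?c * K) = ?c * (linear_factor_prod A (remdups ls) * M)" by (simp add: split)
    also have "\<dots> = linear_factor_prod A (remdups ls) * (?c * M)"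
      unfolding assoc_mult_mat[OF c cl Cons.prems(1), symmetric] comm
      by (rule assoc_mult_mat[OF cl c Cons.prems(1)])
    finally have "?c * (?c * K) = 0\<^sub>m n n" using 0 by simp
    then show ?thesis using char_matrix_square_kernel[OF K] split True by simp
  qed
qed simp

text \<open>Lagrange interpolation, one root at a time: \<open>F\<close> is the component of
  \<open>Q\<close> at \<open>l\<close>, and \<open>Q - F\<close> is annihilated by the remaining
  factors alone.\<close>

lemma eigenprojections_aux:
  "distinct ls \<Longrightarrow> in_bicommutant A Q \<Longrightarrow> linear_factor_prod A ls * Q = 0\<^sub>m n n \<Longrightarrow>
   \<exists>E. (\<forall>l\<in>set ls. in_bicommutant A (E l) \<and> A * E l = l \<cdot>\<^sub>m E l) \<and>
       (\<forall>i<n. \<forall>j<n. Q $$ (i,j) = (\<Sum>l\<in>set ls. E l $$ (i,j)))"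
proof (induction ls arbitrary: Q)
  case Nil
  then have "Q = 0\<^sub>m n n"
    using in_bicommutantD(1)[OF A Nil(2)] by (simp add: linear_factor_prod_simps[OF A])
  then show ?case by auto
next
  case (Cons l ls)
  let ?R = "linear_factor_prod A ls"
  have R: "?R \<in> carrier_mat n n" by (rule linear_factor_prod_carrier[OF A])
  have Q: "Q \<in> carrier_mat n n" using in_bicommutantD(1)[OF A Cons.prems(2)] .
  have RQ: "?R * Q \<in> carrier_mat n n" using R Q by simp
  \<comment> \<open>The value at \<open>l\<close> of the polynomial with roots \<open>ls\<close>,
    nonzero because the roots are distinct.\<close>
  define r where "r = (\<Prod>\<mu>\<leftarrow>ls. l - \<mu>)"
  have r: "r \<noteq> 0" using Cons.prems(1) by (auto simp: r_def prod_list_zero_iff)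
  define F where "F = (1 / r) \<cdot>\<^sub>m (?R * Q)"
  have F: "F \<in> carrier_mat n n" using RQ by (simp add: F_def)
  have "char_matrix A l * (?R * Q) = 0\<^sub>m n n"
    using Cons.prems(3) R Q A by (simp add: linear_factor_prod_simps[OF A] assoc_mult_mat[of _ n n _ n _ n])
  then have AR: "A * (?R * Q) = l \<cdot>\<^sub>m (?R * Q)" by (rule char_matrix_mult_eq_0[OF A RQ])
  have AF: "A * F = l \<cdot>\<^sub>m F"
    unfolding F_def mult_smult_distrib[OF A RQ] AR by (intro eq_matI) (auto simp del: index_mult_mat(1))
  have bF: "in_bicommutant A F" unfolding F_def
    by (intro in_bicommutant_smult[OF A] in_bicommutant_mult[OF A] in_bicommutant_linear_factor_prod[OF A] Cons.prems)
  have "?R * F = ?R * Q"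
    unfolding linear_factor_prod_mult_eigen[OF A F AF] r_def[symmetric] unfolding F_def
    using r by (intro eq_matI) (auto simp del: index_mult_mat(1))
  then have "?R * (Q - F) = 0\<^sub>m n n" using R Q F RQ by (simp add: mult_minus_distrib_mat[of _ n n])
  moreover have "in_bicommutant A (Q - F)" by (rule in_bicommutant_minus[OF A Cons.prems(2) bF])
  ultimately obtain E where E: "\<forall>l\<in>set ls. in_bicommutant A (E l) \<and> A * E l = l \<cdot>\<^sub>m E l"
    "\<forall>i<n. \<forall>j<n. (Q - F) $$ (i,j) = (\<Sum>l\<in>set ls. E l $$ (i,j))"
    using Cons.IH[of "Q - F"] Cons.prems(1) by auto
  have lnot: "l \<notin> set ls" using Cons.prems by simp
  have "Q $$ (i,j) = (\<Sum>l'\<in>set (l # ls). (E(l := F)) l' $$ (i,j))" if "i < n" "j < n" for i j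
  proof -
    have "(\<Sum>l'\<in>set ls. (E(l := F)) l' $$ (i,j)) = (Q - F) $$ (i,j)"
      using E(2) that lnot by (auto intro!: sum.cong)
    then show ?thesis using lnot Q F that by simp
  qed
  then show ?case using E(1) AF bF lnot by (intro exI[of _ "E(l := F)"]) auto
qed

text \<open>The matrices \<open>E l\<close> are the components of the identity. Components for
  distinct numbers multiply to zero, so multiplying the decomposition of the identity by one of them
  shows that it is idempotent.\<close>

theorem eigenprojections:
  obtains S :: "complex set" and E where "finite S"
    "\<And>l. l \<in> S \<Longrightarrow> in_bicommutant A (E l)"
    "\<And>l. l \<in> S \<Longrightarrow> A * E l = l \<cdot>\<^sub>m E l"
    "\<And>l. l \<in> S \<Longrightarrow> E l * E l = E l"
    "\<And>i j. i < n \<Longrightarrow> j < n \<Longrightarrow> (\<Sum>l\<in>S. E l $$ (i,j)) = (if i = j then 1 else 0)"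
proof -
  obtain ls where "linear_factor_prod A ls = 0\<^sub>m n n" using linear_factor_prod_annihilates[OF A] by blast
  then have "linear_factor_prod A ls * 1\<^sub>m n = 0\<^sub>m n n" by simp
  then have "linear_factor_prod A (remdups ls) * 1\<^sub>m n = 0\<^sub>m n n" by (intro linear_factor_prod_remdups) auto
  then obtain E where E: "\<And>l. l \<in> set ls \<Longrightarrow> in_bicommutant A (E l)" "\<And>l. l \<in> set ls \<Longrightarrow> A * E l = l \<cdot>\<^sub>m E l"
    and sum: "\<And>i j. i < n \<Longrightarrow> j < n \<Longrightarrow> (1\<^sub>m n) $$ (i,j) = (\<Sum>l\<in>set ls. E l $$ (i,j))"
    using eigenprojections_aux[of "remdups ls" "1\<^sub>m n"] in_bicommutant_one[OF A] by (auto simp: set_remdups)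
  have Ec: "E l \<in> carrier_mat n n" if "l \<in> set ls" for l using in_bicommutantD(1)[OF A E(1)[OF that]] .
  \<comment> \<open>Evaluating \<open>E m * A * E l\<close> from the left and from the right gives
    two different multiples of the same product.\<close>
  have orth: "E m * E l = 0\<^sub>m n n" if ml: "m \<in> set ls" "l \<in> set ls" "m \<noteq> l" for m l
  proof -
    have EA: "E m * A = m \<cdot>\<^sub>m E m" using in_bicommutantD(2)[OF A E(1)[OF ml(1)] A] E(2)[OF ml(1)] by simp
    have "m \<cdot>\<^sub>m (E m * E l) = E m * A * E l"
      unfolding EA using mult_smult_assoc_mat[OF Ec[OF ml(1)] Ec[OF ml(2)]] by simp
    also have "\<dots> = E m * (A * E l)" using A Ec ml by (intro assoc_mult_mat[of _ n n _ n _ n]) auto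
    also have "\<dots> = l \<cdot>\<^sub>m (E m * E l)" unfolding E(2)[OF ml(2)] by (rule mult_smult_distrib[OF Ec[OF ml(1)] Ec[OF ml(2)]])
    finally have eq: "m \<cdot>\<^sub>m (E m * E l) = l \<cdot>\<^sub>m (E m * E l)" .
    have c: "E m * E l \<in> carrier_mat n n" using Ec ml by (simp add: mult_carrier_mat[of _ n n])
    show ?thesis
    proof (rule eq_matI)
      fix i j assume "i < dim_row (0\<^sub>m n n :: complex mat)" "j < dim_col (0\<^sub>m n n :: complex mat)"
      then have ij: "i < n" "j < n" by auto
      have "(m \<cdot>\<^sub>m (E m * E l)) $$ (i,j) = (l \<cdot>\<^sub>m (E m * E l)) $$ (i,j)" using eq by simp
      then have "m * (E m * E l) $$ (i,j) = l * (E m * E l) $$ (i,j)"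
        using c ij by (simp only: index_smult_mat(1) carrier_matD)
      then show "(E m * E l) $$ (i,j) = 0\<^sub>m n n $$ (i,j)" using ml(3) ij by (simp del: index_mult_mat(1))
    qed (use c in auto)
  qed
  have idem: "E m * E m = E m" if m: "m \<in> set ls" for m
  proof (rule eq_matI)
    fix i j assume "i < dim_row (E m)" "j < dim_col (E m)"
    then have ij: "i < n" "j < n" using Ec[OF m] by auto
    have prod: "(E m * E l) $$ (i,j) = (\<Sum>k<n. E m $$ (i,k) * E l $$ (k,j))" if "l \<in> set ls" for l
      using Ec[OF m] Ec[OF that] ij by (simp add: scalar_prod_def lessThan_atLeast0)
    have "E m $$ (i,j) = (\<Sum>k<n. if k = j then E m $$ (i,k) else 0)" using ij by simp
    also have "\<dots> = (\<Sum>k<n. E m $$ (i,k) * (\<Sum>l\<in>set ls. E l $$ (k,j)))"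
      using sum ij by (intro sum.cong) (auto simp flip: sum)
    also have "\<dots> = (\<Sum>l\<in>set ls. \<Sum>k<n. E m $$ (i,k) * E l $$ (k,j))"
      by (simp add: sum_distrib_left, rule sum.swap)
    also have "\<dots> = (\<Sum>l\<in>set ls. (E m * E l) $$ (i,j))"
      using prod by (intro sum.cong) auto
    also have "\<dots> = (\<Sum>l\<in>set ls. if l = m then (E m * E m) $$ (i,j) else 0)"
      using orth m ij by (intro sum.cong) (auto simp del: index_mult_mat(1))
    also have "\<dots> = (E m * E m) $$ (i,j)" using m by simp
    finally show "(E m * E m) $$ (i,j) = E m $$ (i,j)" by simp
  qed (use Ec[OF m] in auto)
  show ?thesis by (rule that[of "set ls" E]) (use E idem sum in \<open>auto\<close>)
qed

end

subsection \<open>Conjugacy classes of prime power size\<close>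

text \<open>\<open>E\<close> and \<open>W\<close> commute, so a power of \<open>E * W\<close> is
  \<open>E\<close> times that power of \<open>W\<close>. The relation is stated at
  \<open>Suc k\<close> because \<open>E * W\<close> is invertible only on the image of
  \<open>E\<close>.\<close>

lemma pow_mat_idempotent_mult:
  fixes E W :: "complex mat"
  assumes E: "E \<in> carrier_mat n n" "E * E = E" and W: "W \<in> carrier_mat n n" "E * W = W * E"
    and 1: "W ^\<^sub>m k = 1\<^sub>m n"
  shows "(E * W) ^\<^sub>m Suc k = E * W"
proof -
  have EW: "E * W \<in> carrier_mat n n" using E W by simp
  have Wj: "W ^\<^sub>m j \<in> carrier_mat n n" for j using W by simp
  have "(E * W) ^\<^sub>m Suc j = E * (W ^\<^sub>m Suc j)" for j
  proof (induction j)
    case (Suc j)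
    have "(E * W) ^\<^sub>m Suc (Suc j) = (E * W ^\<^sub>m Suc j) * (W * E)" using Suc W(2) by simp
    also have "\<dots> = (E * W ^\<^sub>m Suc j * W) * E"
      by (rule assoc_mult_mat[OF mult_carrier_mat[OF E(1) Wj] W(1) E(1), symmetric])
    also have "E * W ^\<^sub>m Suc j * W = E * W ^\<^sub>m Suc (Suc j)"
      using assoc_mult_mat[OF E(1) Wj[of "Suc j"] W(1)] by simp
    also have "\<dots> * E = E * (W ^\<^sub>m Suc (Suc j) * E)" by (rule assoc_mult_mat[OF E(1) Wj E(1)])
    also have "W ^\<^sub>m Suc (Suc j) * E = E * W ^\<^sub>m Suc (Suc j)"
    proof -
      have "W ^\<^sub>m i * E = E * W ^\<^sub>m i" for i
      proof (induction i)
        case (Suc i)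
        have "W ^\<^sub>m Suc i * E = W ^\<^sub>m i * (W * E)" using assoc_mult_mat[OF Wj W(1) E(1)] by simp
        also have "\<dots> = W ^\<^sub>m i * E * W" unfolding W(2)[symmetric] by (rule assoc_mult_mat[OF Wj E(1) W(1), symmetric])
        also have "\<dots> = E * W ^\<^sub>m Suc i" unfolding Suc using assoc_mult_mat[OF E(1) Wj W(1)] by simp
        finally show ?case .
      qed (use E W in simp)
      then show ?thesis .
    qed
    also have "E * (E * W ^\<^sub>m Suc (Suc j)) = E * W ^\<^sub>m Suc (Suc j)"
      unfolding assoc_mult_mat[OF E(1) E(1) Wj, symmetric] E(2) ..
    finally show ?case .
  qed (use EW W in simp)
  then show ?thesis using 1 W by simp
qed

section \<open>The regular representation and the class sum\<close>

definition (in group) conj_class :: "'a \<Rightarrow> 'a set" where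
  "conj_class x = (\<lambda>g. g \<otimes> x \<otimes> inv g) ` carrier G"

locale conj_class_matrix = group G for G (structure) +
  fixes f :: "nat \<Rightarrow> 'a" and n :: nat and x :: 'a
  assumes bij: "bij_betw f {..<n} (carrier G)" and x: "x \<in> carrier G"
begin

abbreviation "Cl \<equiv> conj_class x"

lemma fin: "finite (carrier G)" using bij bij_betw_finite by blast

lemma order_n: "order G = n" using bij bij_betw_same_card by (fastforce simp: Coset.order_def)

lemma f_in: "i < n \<Longrightarrow> f i \<in> carrier G" using bij by (auto simp: bij_betw_def)

lemma f_eq: "i < n \<Longrightarrow> j < n \<Longrightarrow> f i = f j \<longleftrightarrow> i = j"
  using bij by (auto simp: bij_betw_def inj_on_def)

lemma f_surj: "g \<in> carrier G \<Longrightarrow> \<exists>i<n. f i = g" using bij unfolding bij_betw_def by force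

lemma sum_f: "(\<Sum>k<n. \<phi> (f k)) = (\<Sum>u\<in>carrier G. \<phi> u)"
  by (rule sum.reindex_bij_betw[OF bij])

lemma Cl_in: "y \<in> Cl \<Longrightarrow> y \<in> carrier G" using x by (auto simp: conj_class_def)

lemma fin_Cl: "finite Cl" using fin by (simp add: conj_class_def)

lemma x_Cl: "x \<in> Cl" using x by (auto simp: conj_class_def intro!: image_eqI[of _ _ \<one>])

lemma Cl_conj:
  assumes "y \<in> Cl" "g \<in> carrier G" shows "g \<otimes> y \<otimes> inv g \<in> Cl"
proof -
  obtain h where h: "h \<in> carrier G" "y = h \<otimes> x \<otimes> inv h" using assms by (auto simp: conj_class_def)
  then have "g \<otimes> y \<otimes> inv g = (g \<otimes> h) \<otimes> x \<otimes> inv (g \<otimes> h)"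
    using assms x by (simp add: inv_mult_group m_assoc)
  then show ?thesis using h assms unfolding conj_class_def by blast
qed

lemma Cl_cyc:
  assumes "a \<in> carrier G" "b \<in> carrier G"
  shows "a \<otimes> b \<in> Cl \<longleftrightarrow> b \<otimes> a \<in> Cl"
proof -
  have *: "b \<otimes> a \<in> Cl" if ab: "a \<otimes> b \<in> Cl" "a \<in> carrier G" "b \<in> carrier G" for a b
  proof -
    have "b \<otimes> (a \<otimes> b) \<otimes> inv b = b \<otimes> a" using ab by (simp add: m_assoc)
    then show ?thesis using Cl_conj[OF ab(1,3)] by simp
  qed
  then show ?thesis using assms by blast
qed

text \<open>A kernel on the group becomes a matrix, so that products and translations are computed
  with group elements instead of indices.\<close>

definition kmat :: "('a \<Rightarrow> 'a \<Rightarrow> complex) \<Rightarrow> complex mat" where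
  "kmat \<phi> = mat n n (\<lambda>(i,j). \<phi> (f i) (f j))"

lemma kmat_carrier [simp]: "kmat \<phi> \<in> carrier_mat n n" by (simp add: kmat_def)

lemma kmat_cong:
  "(\<And>a b. a \<in> carrier G \<Longrightarrow> b \<in> carrier G \<Longrightarrow> \<phi> a b = \<psi> a b) \<Longrightarrow> kmat \<phi> = kmat \<psi>"
  by (intro eq_matI) (auto simp: kmat_def f_in)

lemma kmat_mult: "kmat \<phi> * kmat \<psi> = kmat (\<lambda>a b. \<Sum>u\<in>carrier G. \<phi> a u * \<psi> u b)"
  by (intro eq_matI) (auto simp: kmat_def scalar_prod_def sum_f[symmetric] lessThan_atLeast0)

text \<open>Columns index the argument: the basis vector at \<open>b\<close> goes to the one at
  \<open>g \<otimes> b\<close> or \<open>b \<otimes> h\<close>. There is no inverse in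
  \<open>Rm\<close>, so it reverses products, and \<open>Rm x * Lm x\<close> is the map v |-> x v
  x.\<close>

definition "Lm g = kmat (\<lambda>a b. of_bool (a = g \<otimes> b))"
definition "Rm h = kmat (\<lambda>a b. of_bool (a = b \<otimes> h))"
definition "Am = kmat (\<lambda>a b. of_bool (a \<otimes> inv b \<in> Cl))"

lemma carriers [simp]:
  "Lm g \<in> carrier_mat n n" "Rm g \<in> carrier_mat n n" "Am \<in> carrier_mat n n"
  by (auto simp: Lm_def Rm_def Am_def)

lemma mult_carrier_nn [simp]:
  "M \<in> carrier_mat n n \<Longrightarrow> M' \<in> carrier_mat n n \<Longrightarrow> M * M' \<in> carrier_mat n n"
  for M M' :: "complex mat"
  by (rule mult_carrier_mat)

lemma sum_delta_l: "h \<in> carrier G \<Longrightarrow> (\<Sum>u\<in>carrier G. \<phi> u * of_bool (u = h)) = (\<phi> h :: complex)"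
  using fin by (simp add: of_bool_def if_distrib[of "\<lambda>z. _ * z"] cong: if_cong)

lemma mult_Lm: "g \<in> carrier G \<Longrightarrow> kmat \<phi> * Lm g = kmat (\<lambda>a b. \<phi> a (g \<otimes> b))"
  unfolding Lm_def kmat_mult by (intro kmat_cong sum_delta_l) auto

lemma mult_Rm: "h \<in> carrier G \<Longrightarrow> kmat \<phi> * Rm h = kmat (\<lambda>a b. \<phi> a (b \<otimes> h))"
  unfolding Rm_def kmat_mult by (intro kmat_cong sum_delta_l) auto

lemma Lm_mult: 
  assumes "g \<in> carrier G" shows "Lm g * kmat \<phi> = kmat (\<lambda>a b. \<phi> (inv g \<otimes> a) b)"
proof -
  have "(a = g \<otimes> u) = (u = inv g \<otimes> a)" if "a \<in> carrier G" "u \<in> carrier G" for a u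
    using assms that by (auto simp flip: m_assoc)
  then have "(\<Sum>u\<in>carrier G. of_bool (a = g \<otimes> u) * \<phi> u b) = \<phi> (inv g \<otimes> a) b" if "a \<in> carrier G" for a b
    using sum_delta_l[of "inv g \<otimes> a" "\<lambda>u. \<phi> u b"] that assms by (simp add: mult.commute cong: sum.cong)
  then show ?thesis unfolding Lm_def kmat_mult by (intro kmat_cong) auto
qed

lemma Rm_mult: 
  assumes "h \<in> carrier G" shows "Rm h * kmat \<phi> = kmat (\<lambda>a b. \<phi> (a \<otimes> inv h) b)"
proof -
  have "(a = u \<otimes> h) = (u = a \<otimes> inv h)" if "a \<in> carrier G" "u \<in> carrier G" for a u
    using assms that by (auto simp: m_assoc)
  then have "(\<Sum>u\<in>carrier G. of_bool (a = u \<otimes> h) * \<phi> u b) = \<phi> (a \<otimes> inv h) b" if "a \<in> carrier G" for a b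
    using sum_delta_l[of "a \<otimes> inv h" "\<lambda>u. \<phi> u b"] that assms by (simp add: mult.commute cong: sum.cong)
  then show ?thesis unfolding Rm_def kmat_mult by (intro kmat_cong) auto
qed

lemma Lm_Lm: "g \<in> carrier G \<Longrightarrow> h \<in> carrier G \<Longrightarrow> Lm g * Lm h = Lm (g \<otimes> h)"
  unfolding Lm_def[of g] mult_Lm unfolding Lm_def by (intro kmat_cong) (auto simp: m_assoc)

lemma Rm_Rm: "g \<in> carrier G \<Longrightarrow> h \<in> carrier G \<Longrightarrow> Rm g * Rm h = Rm (h \<otimes> g)"
  unfolding Rm_def[of g] mult_Rm unfolding Rm_def by (intro kmat_cong) (auto simp: m_assoc)

lemma Lm_Rm: "g \<in> carrier G \<Longrightarrow> h \<in> carrier G \<Longrightarrow> Lm g * Rm h = Rm h * Lm g"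
  unfolding Lm_def[of g] mult_Rm unfolding Lm_def[symmetric] unfolding Rm_def mult_Lm
  by (intro kmat_cong) (auto simp: m_assoc)

lemma kmat_one: "kmat (\<lambda>a b. of_bool (a = b)) = 1\<^sub>m n"
  by (intro eq_matI) (auto simp: kmat_def f_eq)

lemma Lm_one: "Lm \<one> = 1\<^sub>m n"
  unfolding Lm_def kmat_one[symmetric] by (intro kmat_cong) auto

lemma Rm_one: "Rm \<one> = 1\<^sub>m n"
  unfolding Rm_def kmat_one[symmetric] by (intro kmat_cong) auto

text \<open>Membership in the class is unchanged when two factors are exchanged,
  \<open>Cl_cyc\<close>; this is the centrality of the class sum in the group algebra.\<close>

lemma Am_Lm:
  assumes g: "g \<in> carrier G"
  shows "Am * Lm g = Lm g * Am"
proof -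
  have "a \<otimes> inv (g \<otimes> b) \<in> Cl \<longleftrightarrow> inv g \<otimes> a \<otimes> inv b \<in> Cl" if ab: "a \<in> carrier G" "b \<in> carrier G" for a b
    using Cl_cyc[of "a \<otimes> inv b" "inv g"] ab g by (simp add: inv_mult_group m_assoc)
  then show ?thesis unfolding Am_def mult_Lm[OF g] Lm_mult[OF g] by (intro kmat_cong) simp
qed

lemma Am_Rm: "g \<in> carrier G \<Longrightarrow> Am * Rm g = Rm g * Am"
  unfolding Am_def mult_Rm Rm_mult
  by (intro kmat_cong) (simp add: inv_mult_group m_assoc[symmetric])

text \<open>\<open>Am\<close> is at once a sum of left and, by \<open>Am_entry_R\<close>, of right
  translations, which gives two ways to evaluate traces against it. The entrywise form avoids sums
  of matrices.\<close>

lemma Am_entry_L: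
  assumes "i < n" "j < n"
  shows "Am $$ (i,j) = (\<Sum>y\<in>Cl. Lm y $$ (i,j))"
proof -
  have "(f i = y \<otimes> f j) = (y = f i \<otimes> inv (f j))" if "y \<in> Cl" for y
    using f_in assms Cl_in[OF that] by (auto simp: m_assoc)
  then have "(\<Sum>y\<in>Cl. Lm y $$ (i,j)) = (\<Sum>y\<in>Cl. if y = f i \<otimes> inv (f j) then 1 else 0)"
    using assms by (intro sum.cong) (auto simp: Lm_def kmat_def)
  then show ?thesis using assms fin_Cl by (simp add: Am_def kmat_def)
qed

lemma Am_entry_R:
  assumes "i < n" "j < n"
  shows "Am $$ (i,j) = (\<Sum>y\<in>Cl. Rm y $$ (i,j))"
proof -
  have "(f i = f j \<otimes> y) = (y = inv (f j) \<otimes> f i)" if "y \<in> Cl" for y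
    using f_in assms Cl_in[OF that] by (auto simp flip: m_assoc)
  then have "(\<Sum>y\<in>Cl. Rm y $$ (i,j)) = (\<Sum>y\<in>Cl. if y = inv (f j) \<otimes> f i then 1 else 0)"
    using assms by (intro sum.cong) (auto simp: Rm_def kmat_def)
  then show ?thesis using assms fin_Cl Cl_cyc[of "f i" "inv (f j)"] f_in by (simp add: Am_def kmat_def)
qed

lemma mtrace_mult_Am:
  assumes M: "M \<in> carrier_mat n n"
    and T: "\<And>y. T y \<in> carrier_mat n n" "\<And>i j. i < n \<Longrightarrow> j < n \<Longrightarrow> Am $$ (i,j) = (\<Sum>y\<in>Cl. T y $$ (i,j))"
  shows "mtrace (M * Am) = (\<Sum>y\<in>Cl. mtrace (M * T y))"
proof -
  note e = mtrace_mult_sum[OF M]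
  have "mtrace (M * Am) = (\<Sum>i<n. \<Sum>j<n. \<Sum>y\<in>Cl. M $$ (i,j) * T y $$ (j,i))"
    unfolding e[OF carriers(3)] using T(2) by (intro sum.cong) (auto simp: sum_distrib_left)
  also have "\<dots> = (\<Sum>i<n. \<Sum>y\<in>Cl. \<Sum>j<n. M $$ (i,j) * T y $$ (j,i))"
    by (intro sum.cong refl sum.swap)
  also have "\<dots> = (\<Sum>y\<in>Cl. mtrace (M * T y))"
    unfolding e[OF T(1)] by (rule sum.swap)
  finally show ?thesis .
qed

text \<open>By \<open>mtrace_conj\<close> all class elements contribute the same trace. When
  \<open>M\<close> is an eigenprojection, the left side is the eigenvalue times the dimension of the
  eigenspace.\<close>

lemma mtrace_mult_Am_L:
  assumes M: "M \<in> carrier_mat n n" and comm: "\<And>g. g \<in> carrier G \<Longrightarrow> M * Lm g = Lm g * M"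
  shows "mtrace (M * Am) = card Cl * mtrace (M * Lm x)"
proof -
  have "mtrace (M * Lm y) = mtrace (M * Lm x)" if y: "y \<in> Cl" for y
  proof -
    obtain g where g: "g \<in> carrier G" "y = g \<otimes> x \<otimes> inv g" using y by (auto simp: conj_class_def)
    have "Lm y = Lm g * Lm x * Lm (inv g)" using g x by (simp add: Lm_Lm)
    then show ?thesis using mtrace_conj[OF M _ _ _ _ comm[OF g(1)], of "Lm (inv g)" "Lm x"] g
      by (simp add: Lm_Lm Lm_one)
  qed
  moreover have "mtrace (M * Am) = (\<Sum>y\<in>Cl. mtrace (M * Lm y))"
    by (rule mtrace_mult_Am[OF M carriers(1) Am_entry_L])
  ultimately show ?thesis by simp
qed

lemma mtrace_mult_Am_R:
  assumes M: "M \<in> carrier_mat n n" and comm: "\<And>g. g \<in> carrier G \<Longrightarrow> M * Rm g = Rm g * M"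
  shows "mtrace (M * Am) = card Cl * mtrace (M * Rm x)"
proof -
  have "mtrace (M * Rm y) = mtrace (M * Rm x)" if y: "y \<in> Cl" for y
  proof -
    obtain g where g: "g \<in> carrier G" "y = g \<otimes> x \<otimes> inv g" using y by (auto simp: conj_class_def)
    \<comment> \<open>\<open>Rm\<close> reverses products, hence the inverse stands on the
      left.\<close>
    have "Rm y = Rm (inv g) * Rm x * Rm g" using g x by (simp add: Rm_Rm m_assoc)
    then show ?thesis using mtrace_conj[OF M _ _ _ _ comm[of "inv g"], of "Rm g" "Rm x"] g
      by (simp add: Rm_Rm Rm_one)
  qed
  moreover have "mtrace (M * Am) = (\<Sum>y\<in>Cl. mtrace (M * Rm y))"
    by (rule mtrace_mult_Am[OF M carriers(2) Am_entry_R])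
  ultimately show ?thesis by simp
qed

text \<open>The adjoint of a translation is the translation by the inverse, so the adjoint of
  \<open>Am\<close> is a sum of left translations, and these commute with \<open>Am\<close>.\<close>

lemma Am_normal: "Am * hermitian_conj Am = hermitian_conj Am * Am"
proof -
  have H: "hermitian_conj Am $$ (i,j) = (\<Sum>y\<in>Cl. Lm (inv y) $$ (i,j))" if "i < n" "j < n" for i j
  proof -
    have "cnj (Lm y $$ (j,i)) = Lm (inv y) $$ (i,j)" if "y \<in> Cl" for y
      using \<open>i < n\<close> \<open>j < n\<close> Cl_in[OF that] f_in[of i] f_in[of j]
      by (simp add: Lm_def kmat_def) (metis inv_closed inv_inv inv_solve_left)
    moreover have "hermitian_conj Am $$ (i,j) = cnj (Am $$ (j,i))"
      using that by (simp add: hermitian_conj_def Am_def kmat_def)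
    ultimately show ?thesis unfolding Am_entry_L[OF that(2,1)] by (simp cong: sum.cong)
  qed
  have Hc: "hermitian_conj Am \<in> carrier_mat n n" by simp
  show ?thesis
  proof (rule eq_matI)
    fix i j assume "i < dim_row (hermitian_conj Am * Am)" "j < dim_col (hermitian_conj Am * Am)"
    then have ij: "i < n" "j < n" by (auto simp: Am_def kmat_def hermitian_conj_def)
    have e: "(Z * Y) $$ (i,j) = (\<Sum>k<n. Z $$ (i,k) * Y $$ (k,j))"
      if "Z \<in> carrier_mat n n" "Y \<in> carrier_mat n n" for Z Y :: "complex mat"
      using that ij by (simp add: scalar_prod_def lessThan_atLeast0)
    have "(Am * hermitian_conj Am) $$ (i,j) = (\<Sum>k<n. \<Sum>y\<in>Cl. Am $$ (i,k) * Lm (inv y) $$ (k,j))"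
      unfolding e[OF carriers(3) Hc] using ij by (intro sum.cong refl) (simp add: H sum_distrib_left)
    also have "\<dots> = (\<Sum>y\<in>Cl. (Am * Lm (inv y)) $$ (i,j))"
      unfolding e[OF carriers(3,1)] by (rule sum.swap)
    also have "\<dots> = (\<Sum>y\<in>Cl. (Lm (inv y) * Am) $$ (i,j))"
      using Am_Lm Cl_in by (intro sum.cong) auto
    also have "\<dots> = (\<Sum>k<n. \<Sum>y\<in>Cl. Lm (inv y) $$ (i,k) * Am $$ (k,j))"
      unfolding e[OF carriers(1,3)] by (rule sum.swap)
    also have "\<dots> = (hermitian_conj Am * Am) $$ (i,j)"
      unfolding e[OF Hc carriers(3)] using ij by (intro sum.cong refl) (simp add: H sum_distrib_right)
    finally show "(Am * hermitian_conj Am) $$ (i,j) = (hermitian_conj Am * Am) $$ (i,j)" .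
  qed (auto simp: Am_def kmat_def hermitian_conj_def)
qed

sublocale A: normal_mat n Am by unfold_locales (auto simp: Am_normal)

section \<open>Eigenfunctions of the class sum on the group\<close>

lemma Am_mult_entry:
  assumes Y: "Y \<in> carrier_mat n m" "i < n" "j < m" and w: "\<And>k. k < n \<Longrightarrow> Y $$ (k,j) = w (f k)"
  shows "(Am * Y) $$ (i,j) = (\<Sum>y\<in>Cl. w (inv y \<otimes> f i))"
proof -
  have "(Am * Y) $$ (i,j) = (\<Sum>k<n. of_bool (f i \<otimes> inv (f k) \<in> Cl) * w (f k))"
    using Y w by (simp add: scalar_prod_def lessThan_atLeast0 Am_def kmat_def)
  also have "\<dots> = (\<Sum>u\<in>carrier G. of_bool (f i \<otimes> inv u \<in> Cl) * w u)" by (rule sum_f)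
  also have "\<dots> = (\<Sum>u\<in>{u\<in>carrier G. f i \<otimes> inv u \<in> Cl}. w u)"
    using fin by (intro sum.mono_neutral_cong_right) auto
  also have "\<dots> = (\<Sum>y\<in>Cl. w (inv y \<otimes> f i))"
    using f_in[OF Y(2)] Cl_in
    by (intro sum.reindex_bij_witness[of _ "\<lambda>y. inv y \<otimes> f i" "\<lambda>u. f i \<otimes> inv u"])
       (auto simp: inv_mult_group m_assoc, auto simp flip: m_assoc)
  finally show ?thesis .
qed

text \<open>If \<open>\<gamma>\<close> has modulus 1, the right-hand side vanishes and every element of the class acts on \<open>w\<close> as
  the scalar \<open>\<gamma>\<close>.\<close>
lemma eigenfunction_defect:
  assumes w: "\<And>g. g \<in> carrier G \<Longrightarrow> (\<Sum>y\<in>Cl. w (inv y \<otimes> g)) = of_nat (card Cl) * \<gamma> * w g"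
  shows "(\<Sum>y\<in>Cl. \<Sum>g\<in>carrier G. (cmod (w (inv y \<otimes> g) - \<gamma> * w g))\<^sup>2)
       = card Cl * (1 - (cmod \<gamma>)\<^sup>2) * (\<Sum>g\<in>carrier G. (cmod (w g))\<^sup>2)"
proof -
  let ?N = "\<Sum>g\<in>carrier G. (cmod (w g))\<^sup>2"
  have ex: "(cmod (a - b))\<^sup>2 = (cmod a)\<^sup>2 + (cmod b)\<^sup>2 - 2 * Re (a * cnj b)" for a b
    unfolding cmod_power2 by (simp add: power2_eq_square algebra_simps)
  have sh: "(\<Sum>g\<in>carrier G. (cmod (w (inv y \<otimes> g)))\<^sup>2) = ?N" if "y \<in> Cl" for y
    using Cl_in[OF that]
    by (intro sum.reindex_bij_witness[of _ "\<lambda>g. y \<otimes> g" "\<lambda>g. inv y \<otimes> g"]) (auto simp flip: m_assoc)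
  have "(\<Sum>y\<in>Cl. \<Sum>g\<in>carrier G. (cmod (w (inv y \<otimes> g) - \<gamma> * w g))\<^sup>2)
     = (\<Sum>y\<in>Cl. ?N + (cmod \<gamma>)\<^sup>2 * ?N) - 2 * (\<Sum>y\<in>Cl. \<Sum>g\<in>carrier G. Re (w (inv y \<otimes> g) * cnj (\<gamma> * w g)))"
    unfolding ex sum.distrib sum_subtractf
    by (simp add: sh norm_mult power_mult_distrib sum_distrib_left cong: sum.cong)
  \<comment> \<open>Summed over the class first, the cross terms are determined by the eigenvalue
    equation.\<close>
  also have "(\<Sum>y\<in>Cl. \<Sum>g\<in>carrier G. Re (w (inv y \<otimes> g) * cnj (\<gamma> * w g)))
     = (\<Sum>g\<in>carrier G. Re ((\<Sum>y\<in>Cl. w (inv y \<otimes> g)) * cnj (\<gamma> * w g)))"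
    by (subst sum.swap) (simp add: sum_distrib_right)
  also have "\<dots> = (\<Sum>g\<in>carrier G. card Cl * ((cmod \<gamma>)\<^sup>2 * (cmod (w g))\<^sup>2))"
  proof (rule sum.cong[OF refl])
    fix g assume g: "g \<in> carrier G"
    have "(\<Sum>y\<in>Cl. w (inv y \<otimes> g)) * cnj (\<gamma> * w g) = of_nat (card Cl) * ((\<gamma> * w g) * cnj (\<gamma> * w g))"
      unfolding w[OF g] by simp
    also have "(\<gamma> * w g) * cnj (\<gamma> * w g) = complex_of_real ((cmod (\<gamma> * w g))\<^sup>2)"
      by (rule complex_norm_square[symmetric])
    finally have "(\<Sum>y\<in>Cl. w (inv y \<otimes> g)) * cnj (\<gamma> * w g) = complex_of_real (card Cl * (cmod (\<gamma> * w g))\<^sup>2)"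
      by simp
    then show "Re ((\<Sum>y\<in>Cl. w (inv y \<otimes> g)) * cnj (\<gamma> * w g)) = card Cl * ((cmod \<gamma>)\<^sup>2 * (cmod (w g))\<^sup>2)"
      by (simp only: Re_complex_of_real norm_mult power_mult_distrib)
  qed
  also have "\<dots> = card Cl * (cmod \<gamma>)\<^sup>2 * ?N" by (simp add: sum_distrib_left mult.assoc)
  finally show ?thesis by (simp add: algebra_simps)
qed

text \<open>The sum of squares in \<open>eigenfunction_defect\<close> is nonnegative, and the norm
  of \<open>w\<close> is positive.\<close>

lemma eigenvalue_norm_le:
  assumes w: "\<And>g. g \<in> carrier G \<Longrightarrow> (\<Sum>y\<in>Cl. w (inv y \<otimes> g)) = of_nat (card Cl) * \<gamma> * w g"
    and nz: "g0 \<in> carrier G" "w g0 \<noteq> 0"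
  shows "cmod \<gamma> \<le> 1"
proof -
  have defect: "(\<Sum>y\<in>Cl. \<Sum>g\<in>carrier G. (cmod (w (inv y \<otimes> g) - \<gamma> * w g))\<^sup>2)
       = card Cl * (1 - (cmod \<gamma>)\<^sup>2) * (\<Sum>g\<in>carrier G. (cmod (w g))\<^sup>2)"
    by (rule eigenfunction_defect[OF w])
  have "(\<Sum>g\<in>carrier G. (cmod (w g))\<^sup>2) \<ge> (cmod (w g0))\<^sup>2" using nz fin by (intro member_le_sum) auto
  then have N: "(\<Sum>g\<in>carrier G. (cmod (w g))\<^sup>2) > 0" using nz by (smt (verit) zero_less_norm_iff zero_less_power)
  have c: "card Cl > 0" using x_Cl fin_Cl card_gt_0_iff by blast
  have "0 \<le> real (card Cl) * (1 - (cmod \<gamma>)\<^sup>2) * (\<Sum>g\<in>carrier G. (cmod (w g))\<^sup>2)"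
    unfolding defect[symmetric] by (intro sum_nonneg) auto
  then have "0 \<le> 1 - (cmod \<gamma>)\<^sup>2" using N c by (simp add: zero_le_mult_iff)
  then show ?thesis using power2_le_imp_le[of "cmod \<gamma>" 1] by simp
qed

text \<open>The defect vanishes, so every class element acts on \<open>w\<close> as the same scalar
  and the quotients \<open>y \<otimes> inv z\<close> of class elements fix \<open>w\<close>. They
  generate a normal subgroup, nontrivial since \<open>x\<close> is not central, hence the whole
  group by simplicity.\<close>

lemma eigenfunction_const:
  assumes w: "\<And>g. g \<in> carrier G \<Longrightarrow> (\<Sum>y\<in>Cl. w (inv y \<otimes> g)) = of_nat (card Cl) * \<gamma> * w g"
    and \<gamma>: "cmod \<gamma> = 1"
    and simple: "\<And>N. N \<lhd> G \<Longrightarrow> N = {\<one>} \<or> N = carrier G"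
    and nc: "u \<in> carrier G" "x \<otimes> u \<noteq> u \<otimes> x"
    and g: "g \<in> carrier G"
  shows "w g = w \<one>" "\<gamma> * w g = w g"
proof -
  have defect: "(\<Sum>y\<in>Cl. \<Sum>g\<in>carrier G. (cmod (w (inv y \<otimes> g) - \<gamma> * w g))\<^sup>2)
       = card Cl * (1 - (cmod \<gamma>)\<^sup>2) * (\<Sum>g\<in>carrier G. (cmod (w g))\<^sup>2)"
    by (rule eigenfunction_defect[OF w])
  have 0: "(\<Sum>y\<in>Cl. \<Sum>g\<in>carrier G. (cmod (w (inv y \<otimes> g) - \<gamma> * w g))\<^sup>2) = 0"
    unfolding defect using \<gamma> by simp
  have "\<forall>y\<in>Cl. (\<Sum>g\<in>carrier G. (cmod (w (inv y \<otimes> g) - \<gamma> * w g))\<^sup>2) = 0"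
    using 0 fin_Cl by (subst (asm) sum_nonneg_eq_0_iff) (auto intro: sum_nonneg)
  then have "\<forall>y\<in>Cl. \<forall>g\<in>carrier G. (cmod (w (inv y \<otimes> g) - \<gamma> * w g))\<^sup>2 = 0"
    using fin by (subst (asm) sum_nonneg_eq_0_iff) auto
  then have tr: "w (inv y \<otimes> g) = \<gamma> * w g" if "y \<in> Cl" "g \<in> carrier G" for y g
    using that by simp
  define S where "S = {y \<otimes> inv z |y z. y \<in> Cl \<and> z \<in> Cl}"
  have S: "S \<subseteq> carrier G" using Cl_in by (auto simp: S_def)
  have "generate G S \<lhd> G"
  proof (rule normal_generateI[OF S])
    fix h g assume h: "h \<in> S" and g: "g \<in> carrier G"
    obtain y z where yz: "y \<in> Cl" "z \<in> Cl" "h = y \<otimes> inv z" using h by (auto simp: S_def)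
    have "g \<otimes> h \<otimes> inv g = (g \<otimes> y \<otimes> inv g) \<otimes> inv (g \<otimes> z \<otimes> inv g)"
      using yz(3) g Cl_in[OF yz(1)] Cl_in[OF yz(2)] by (simp add: inv_mult_group m_assoc inv_solve_left)
    then show "g \<otimes> h \<otimes> inv g \<in> S" using Cl_conj[OF yz(1) g] Cl_conj[OF yz(2) g] by (auto simp: S_def)
  qed
  moreover have "generate G S \<noteq> {\<one>}"
  proof
    assume "generate G S = {\<one>}"
    moreover have "(u \<otimes> x \<otimes> inv u) \<otimes> inv x \<in> S" using x_Cl Cl_conj[OF x_Cl nc(1)] by (auto simp: S_def)
    ultimately have "(u \<otimes> x \<otimes> inv u) \<otimes> inv x = \<one>" using generate.incl[of _ S G] by blast
    then have "u \<otimes> x \<otimes> inv u = x" using x nc(1) by (metis inv_closed inv_equality inv_inv m_closed)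
    then have "u \<otimes> x = x \<otimes> u" using x nc(1) by (metis inv_solve_right m_closed)
    then show False using nc by simp
  qed
  ultimately have gen: "generate G S = carrier G" using simple by blast
  have invS: "w (h \<otimes> g) = w g" if hS: "h \<in> S" and gG: "g \<in> carrier G" for h g
  proof -
    obtain y z where yz: "y \<in> Cl" "z \<in> Cl" "h = y \<otimes> inv z" using hS by (auto simp: S_def)
    have c: "y \<in> carrier G" "z \<in> carrier G" using yz Cl_in by auto
    have "w (inv y \<otimes> (h \<otimes> g)) = \<gamma> * w (h \<otimes> g)" using tr[OF yz(1)] c yz(3) gG by simp
    moreover have "inv y \<otimes> (h \<otimes> g) = inv z \<otimes> g" using c gG yz(3) by (simp flip: m_assoc)
    moreover have "w (inv z \<otimes> g) = \<gamma> * w g" using tr[OF yz(2) gG] .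
    moreover have "\<gamma> \<noteq> 0" using \<gamma> by auto
    ultimately show ?thesis by simp
  qed
  have inv: "\<forall>g\<in>carrier G. w (h \<otimes> g) = w g" if "h \<in> generate G S" for h
    using that
  proof (induction rule: generate.induct)
    case (inv h)
    then have h: "h \<in> carrier G" using S by blast
    show ?case
    proof
      fix g assume "g \<in> carrier G"
      then show "w (inv h \<otimes> g) = w g" using invS[OF inv, of "inv h \<otimes> g"] h by (simp flip: m_assoc)
    qed
  next
    case (eng h1 h2)
    have "h1 \<in> carrier G" "h2 \<in> carrier G" using eng gen by auto
    then show ?case using eng by (simp add: m_assoc)
  qed (use invS in auto)
  have const: "w h = w \<one>" if h: "h \<in> carrier G" for h
  proof -
    have "w (h \<otimes> \<one>) = w \<one>" using inv[of h] h unfolding gen by blast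
    then show ?thesis using h by simp
  qed
  show "w g = w \<one>" by (rule const[OF g])
  have "w (inv x \<otimes> g) = w g" using const[of "inv x \<otimes> g"] const[of g] x g by simp
  then show "\<gamma> * w g = w g" using tr[OF x_Cl g] by simp
qed

lemma Lm_pow: "Lm x ^\<^sub>m j = Lm (x [^] j)"
proof (induction j)
  case 0
  have "dim_row (Lm x) = n" using carriers(1) by blast
  then show ?case by (simp add: Lm_one)
qed (simp add: Lm_Lm x)

lemma Rm_Lm_pow: "(Rm x * Lm x) ^\<^sub>m j = Rm (x [^] j) * Lm (x [^] j)"
proof (induction j)
  case 0
  have "dim_row (Rm x) = n" using carriers(2) by blast
  then show ?case by (simp add: Rm_one Lm_one)
next
  case (Suc j)
  let ?y = "x [^] j"
  have y: "?y \<in> carrier G" using x by simp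
  have "(Rm x * Lm x) ^\<^sub>m Suc j = (Rm ?y * Lm ?y) * (Rm x * Lm x)" using Suc by simp
  also have "\<dots> = Rm ?y * (Lm ?y * (Rm x * Lm x))"
    by (rule assoc_mult_mat[of _ n n _ n _ n]) auto
  also have "Lm ?y * (Rm x * Lm x) = (Lm ?y * Rm x) * Lm x"
    by (rule assoc_mult_mat[of _ n n _ n _ n, symmetric]) auto
  also have "\<dots> = Rm x * (Lm ?y * Lm x)"
    unfolding Lm_Rm[OF y x] by (rule assoc_mult_mat[of _ n n _ n _ n]) auto
  also have "Rm ?y * \<dots> = (Rm ?y * Rm x) * (Lm ?y * Lm x)"
    by (rule assoc_mult_mat[of _ n n _ n _ n, symmetric]) auto
  also have "\<dots> = Rm (x [^] Suc j) * Lm (x [^] Suc j)"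
    using x y nat_pow_Suc2[OF x, of j] by (simp add: Rm_Rm Lm_Lm)
  finally show ?case .
qed

definition "column_fun Y j g = Y $$ (inv_into {..<n} f g, j)" for Y :: "complex mat"

lemma column_fun: "k < n \<Longrightarrow> column_fun Y j (f k) = Y $$ (k, j)"
  using bij by (simp add: column_fun_def bij_betw_def inv_into_f_f)

lemma column_fun_eigen:
  assumes Y: "Y \<in> carrier_mat n m" "j < m" and AY: "Am * Y = (of_nat (card Cl) * \<gamma>) \<cdot>\<^sub>m Y"
    and g: "g \<in> carrier G"
  shows "(\<Sum>y\<in>Cl. column_fun Y j (inv y \<otimes> g)) = of_nat (card Cl) * \<gamma> * column_fun Y j g"
proof -
  obtain i where i: "i < n" "f i = g" using f_surj[OF g] by blast
  have "(Am * Y) $$ (i,j) = (\<Sum>y\<in>Cl. column_fun Y j (inv y \<otimes> f i))"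
    by (rule Am_mult_entry[OF Y(1) i(1) Y(2)]) (simp add: column_fun)
  then show ?thesis using Y i column_fun[OF i(1), of Y j] unfolding AY by simp
qed

lemma card_Cl: "card Cl > 0" using x_Cl fin_Cl card_gt_0_iff by blast

text \<open>\<open>Am\<close> is applied to the all-one vector, which carries the trivial
  character.\<close>

lemma Am_row_sum:
  assumes "i < n" shows "(\<Sum>j<n. Am $$ (i,j)) = of_nat (card Cl)"
proof -
  let ?Y = "mat n 1 (\<lambda>_. 1) :: complex mat"
  have "(Am * ?Y) $$ (i,0) = (\<Sum>y\<in>Cl. (\<lambda>_. 1) (inv y \<otimes> f i))"
    by (rule Am_mult_entry) (use assms in auto)
  moreover have "(Am * ?Y) $$ (i,0) = (\<Sum>j<n. Am $$ (i,j))"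
    using assms by (simp add: scalar_prod_def lessThan_atLeast0 Am_def kmat_def)
  ultimately show ?thesis by simp
qed

definition Aint :: "int mat" where
  "Aint = mat n n (\<lambda>(i,j). of_bool (f i \<otimes> inv (f j) \<in> Cl))"

lemma Aint: "Aint \<in> carrier_mat n n" "map_mat of_int Aint = Am"
  by (auto simp: Aint_def Am_def kmat_def intro!: eq_matI)

text \<open>An eigenvector, placed in a one-column matrix, yields a nonzero eigenfunction to which
  \<open>eigenvalue_norm_le\<close> applies.\<close>

lemma char_poly_Am_root_norm:
  assumes "poly (char_poly Am) (of_nat (card Cl) * z) = 0"
  shows "cmod z \<le> 1"
proof -
  have "eigenvalue Am (of_nat (card Cl) * z)" using eigenvalue_root_char_poly[OF carriers(3)] assms by simp
  then obtain v where v: "v \<in> carrier_vec n" "v \<noteq> 0\<^sub>v n" "Am *\<^sub>v v = (of_nat (card Cl) * z) \<cdot>\<^sub>v v"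
    using carriers(3) by (auto simp: eigenvalue_def eigenvector_def)
  define Y where "Y = mat_of_cols n [v]"
  have Y: "Y \<in> carrier_mat n 1" using mat_of_cols_carrier(1)[of n "[v]"] by (simp add: Y_def)
  have cY: "col Y 0 = v" using v by (simp add: Y_def)
  have AY: "Am * Y = (of_nat (card Cl) * z) \<cdot>\<^sub>m Y"
  proof (rule eq_matI)
    fix i j assume "i < dim_row ((of_nat (card Cl) * z) \<cdot>\<^sub>m Y)" "j < dim_col ((of_nat (card Cl) * z) \<cdot>\<^sub>m Y)"
    then have ij: "i < n" "j = 0" using Y by auto
    have "(Am * Y) $$ (i,0) = row Am i \<bullet> col Y 0"
      using ij Y by (intro index_mult_mat(1)) (auto simp: Am_def kmat_def)
    also have "\<dots> = (Am *\<^sub>v v) $ i" unfolding cY using ij by (simp add: Am_def kmat_def)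
    also have "\<dots> = (of_nat (card Cl) * z) * v $ i" unfolding v(3) using ij v(1) by simp
    also have "v $ i = Y $$ (i,0)" using ij Y by (simp flip: cY)
    finally show "(Am * Y) $$ (i,j) = ((of_nat (card Cl) * z) \<cdot>\<^sub>m Y) $$ (i,j)" using ij Y by simp
  qed (use Y carrier_matD[OF carriers(3)] in auto)
  obtain i where i: "i < n" "v $ i \<noteq> 0"
    using nonzero_vec_index[OF v(1,2)] by blast
  have "Y $$ (i,0) = v $ i" using i Y by (simp flip: cY)
  then have nz: "column_fun Y 0 (f i) \<noteq> 0" using column_fun[OF i(1)] i by simp
  show ?thesis
    by (rule eigenvalue_norm_le[OF column_fun_eigen[OF Y _ AY] f_in[OF i(1)] nz]) simp_all
qed

text \<open>Every conjugate of \<open>z\<close> is again an eigenvalue divided by the class size,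
  hence lies in the unit disc. The rational polynomial \<open>q\<close> records this: it is the
  characteristic polynomial with its variable scaled by \<open>card Cl\<close>.\<close>

lemma algebraic_int_ratio_norm:
  assumes "algebraic_int z" "z \<noteq> 0" "poly (char_poly Am) (of_nat (card Cl) * z) = 0"
  shows "cmod z = 1"
proof -
  define q :: "rat poly" where "q = pcompose (map_poly of_int (char_poly Aint)) [:0, of_nat (card Cl):]"
  have "map_poly of_rat q = pcompose (map_poly of_rat (map_poly of_int (char_poly Aint))) [:0, of_nat (card Cl) :: complex:]"
    unfolding q_def of_rat_hom.map_poly_pcompose by (simp add: of_rat_hom.map_poly_pCons_hom)
  also have "map_poly of_rat (map_poly of_int (char_poly Aint) :: rat poly) = (map_poly of_int (char_poly Aint) :: complex poly)"
    by (intro poly_eqI) (simp add: coeff_map_poly)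
  also have "\<dots> = char_poly Am" using of_int_hom.char_poly_hom[OF Aint(1)] Aint(2) by metis
  finally have q: "poly (map_poly of_rat q) y = poly (char_poly Am) (of_nat (card Cl) * y)" for y
    by (simp add: poly_pcompose mult.commute)
  have "lead_coeff (char_poly Aint) = 1" using degree_monic_char_poly[OF Aint(1)] by auto
  then have "map_poly of_int (char_poly Aint) \<noteq> (0 :: rat poly)" by auto
  then have "q \<noteq> 0" unfolding q_def using card_Cl by (subst pcompose_eq_0_iff) auto
  then show ?thesis
    by (intro algebraic_int_norm_eq_1[OF assms(1,2), of q]) (use assms(3) char_poly_Am_root_norm in \<open>auto simp: q\<close>)
qed

text \<open>The trace of \<open>x\<close> on the whole regular representation is 0 and splits over
  the numbers in \<open>S\<close>. The class size itself contributes 1, and every other number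
  contributes an algebraic integer multiple of the square root of \<open>p\<close>.\<close>

theorem no_prime_power_class:
  assumes simple: "\<And>N. N \<lhd> G \<Longrightarrow> N = {\<one>} \<or> N = carrier G"
    and nc: "u \<in> carrier G" "x \<otimes> u \<noteq> u \<otimes> x"
    and p: "prime p" "card Cl = p ^ k"
  shows False
proof -
  let ?c = "of_nat (card Cl) :: complex"
  have c0: "?c \<noteq> 0" using card_Cl by simp
  have n0: "n > 0" using f_surj[OF x] by auto
  have xn: "x [^] n = \<one>" using pow_order_eq_1[OF x] order_n by simp
  obtain S E where S: "finite S"
    and bi: "\<And>l. l \<in> S \<Longrightarrow> in_bicommutant Am (E l)"
    and AE: "\<And>l. l \<in> S \<Longrightarrow> Am * E l = l \<cdot>\<^sub>m E l"
    and idem: "\<And>l. l \<in> S \<Longrightarrow> E l * E l = E l"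
    and sumE: "\<And>i j. i < n \<Longrightarrow> j < n \<Longrightarrow> (\<Sum>l\<in>S. E l $$ (i,j)) = (if i = j then 1 else 0)"
    using A.eigenprojections by blast
  have Ec: "E l \<in> carrier_mat n n" if "l \<in> S" for l using in_bicommutantD(1)[OF carriers(3) bi[OF that]] .
  have comm: "E l * W = W * E l" if "l \<in> S" "W \<in> carrier_mat n n" "Am * W = W * Am" for l W
    using in_bicommutantD(2)[OF carriers(3) bi[OF that(1)] that(2,3)] .
  note EL = comm[OF _ carriers(1) Am_Lm] and ER = comm[OF _ carriers(2) Am_Rm]
  \<comment> \<open>The scalar by which the average of the class acts on the eigenspace.\<close>
  define \<gamma> where "\<gamma> l = l / ?c" for l
  define \<tau> where "\<tau> l = mtrace (E l * Lm x)" for l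
  have l\<gamma>: "l = ?c * \<gamma> l" for l using c0 by (simp add: \<gamma>_def)
  have trEA: "mtrace (E l * Am) = l * mtrace (E l)" if "l \<in> S" for l
    using comm[OF that carriers(3)] AE[OF that] mtrace_smult[OF Ec[OF that]] by simp
  have \<tau>: "\<tau> l = \<gamma> l * mtrace (E l)" if "l \<in> S" for l
  proof -
    have "mtrace (E l * Am) = ?c * \<tau> l"
      unfolding \<tau>_def by (rule mtrace_mult_Am_L[OF Ec[OF that] EL[OF that]])
    then show ?thesis using trEA[OF that] c0 by (simp add: \<gamma>_def field_simps)
  qed
  have trR: "mtrace (E l * Rm x) = \<gamma> l * mtrace (E l)" if "l \<in> S" for l
  proof -
    have "mtrace (E l * Am) = ?c * mtrace (E l * Rm x)"
      by (rule mtrace_mult_Am_R[OF Ec[OF that] ER[OF that]])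
    then show ?thesis using trEA[OF that] c0 by (simp add: \<gamma>_def field_simps)
  qed
  \<comment> \<open>\<open>E l * Rm x\<close> still commutes with all left translations, so the left
    trace formula applies a second time and produces another factor
    \<open>\<gamma> l\<close>.\<close>
  have trRL: "mtrace (E l * (Rm x * Lm x)) = \<gamma> l * \<tau> l" if l: "l \<in> S" for l
  proof -
    have M: "E l * Rm x \<in> carrier_mat n n" using Ec[OF l] by (intro mult_carrier_mat[of _ n n]) auto
    have "E l * Rm x * Lm g = Lm g * (E l * Rm x)" if g: "g \<in> carrier G" for g
    proof -
      have "E l * Rm x * Lm g = E l * (Rm x * Lm g)" by (rule assoc_mult_mat[of _ n n _ n _ n]) (auto simp: Ec[OF l])
      also have "\<dots> = E l * Lm g * Rm x"
        unfolding Lm_Rm[OF g x, symmetric] by (rule assoc_mult_mat[of _ n n _ n _ n, symmetric]) (auto simp: Ec[OF l])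
      also have "\<dots> = Lm g * (E l * Rm x)"
        unfolding EL[OF l g] by (rule assoc_mult_mat[of _ n n _ n _ n]) (auto simp: Ec[OF l])
      finally show ?thesis .
    qed
    then have "mtrace (E l * Rm x * Am) = ?c * mtrace (E l * Rm x * Lm x)"
      by (rule mtrace_mult_Am_L[OF M])
    moreover have "E l * Rm x * Am = l \<cdot>\<^sub>m (E l * Rm x)"
    proof -
      have "E l * Rm x * Am = E l * (Rm x * Am)" by (rule assoc_mult_mat[of _ n n _ n _ n]) (auto simp: Ec[OF l])
      also have "\<dots> = E l * Am * Rm x"
        unfolding Am_Rm[OF x, symmetric] by (rule assoc_mult_mat[of _ n n _ n _ n, symmetric]) (auto simp: Ec[OF l])
      also have "\<dots> = (l \<cdot>\<^sub>m E l) * Rm x" using comm[OF l carriers(3)] AE[OF l] by simp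
      also have "\<dots> = l \<cdot>\<^sub>m (E l * Rm x)" by (rule mult_smult_assoc_mat[OF Ec[OF l] carriers(2)])
      finally show ?thesis .
    qed
    moreover have "E l * Rm x * Lm x = E l * (Rm x * Lm x)" by (rule assoc_mult_mat[of _ n n _ n _ n]) (auto simp: Ec[OF l])
    ultimately have "l * mtrace (E l * Rm x) = ?c * mtrace (E l * (Rm x * Lm x))"
      using mtrace_smult[OF M, of l] by simp
    then have "?c * (\<gamma> l * \<tau> l) = ?c * mtrace (E l * (Rm x * Lm x))"
      using trR[OF l] \<tau>[OF l] l\<gamma>[of l] by (metis mult.assoc)
    then show ?thesis using c0 by (metis mult_left_cancel)
  qed
  have ai\<tau>: "algebraic_int (\<tau> l)" if l: "l \<in> S" for l
  proof -
    have "(E l * Lm x) ^\<^sub>m Suc n = E l * Lm x"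
      by (rule pow_mat_idempotent_mult[OF Ec[OF l] idem[OF l] carriers(1) EL[OF l x]]) (simp add: Lm_pow xn Lm_one)
    then show ?thesis unfolding \<tau>_def
      by (intro algebraic_int_mtrace_periodic[OF _ _ n0]) (use mult_carrier_mat[OF Ec[OF l] carriers(1)] in auto)
  qed
  have ai2: "algebraic_int (\<gamma> l * \<tau> l)" if l: "l \<in> S" for l
  proof -
    have W: "Rm x * Lm x \<in> carrier_mat n n" by (intro mult_carrier_mat[of _ n n]) auto
    have "Am * (Rm x * Lm x) = Rm x * Lm x * Am"
    proof -
      have "Am * (Rm x * Lm x) = Am * Rm x * Lm x" by (rule assoc_mult_mat[of _ n n _ n _ n, symmetric]) auto
      also have "\<dots> = Rm x * (Am * Lm x)"
        unfolding Am_Rm[OF x] by (rule assoc_mult_mat[of _ n n _ n _ n]) auto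
      also have "\<dots> = Rm x * Lm x * Am"
        unfolding Am_Lm[OF x] by (rule assoc_mult_mat[of _ n n _ n _ n, symmetric]) auto
      finally show ?thesis .
    qed
    then have "E l * (Rm x * Lm x) = (Rm x * Lm x) * E l" by (rule comm[OF l W])
    then have "(E l * (Rm x * Lm x)) ^\<^sub>m Suc n = E l * (Rm x * Lm x)"
      by (rule pow_mat_idempotent_mult[OF Ec[OF l] idem[OF l] W]) (simp add: Rm_Lm_pow xn Lm_one Rm_one)
    then show ?thesis unfolding trRL[OF l, symmetric]
      by (intro algebraic_int_mtrace_periodic[OF _ _ n0]) (use mult_carrier_mat[OF Ec[OF l] W] in auto)
  qed
  have x1: "x \<noteq> \<one>" using nc by auto
  \<comment> \<open>This is the trace of left translation by \<open>x\<close>, which moves every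
    group element.\<close>
  have "(\<Sum>l\<in>S. \<tau> l) = 0"
  proof -
    have "(\<Sum>l\<in>S. \<tau> l) = (\<Sum>l\<in>S. \<Sum>i<n. \<Sum>j<n. E l $$ (i,j) * Lm x $$ (j,i))"
      unfolding \<tau>_def by (intro sum.cong refl mtrace_mult_sum[OF Ec carriers(1)])
    also have "\<dots> = (\<Sum>i<n. \<Sum>l\<in>S. \<Sum>j<n. E l $$ (i,j) * Lm x $$ (j,i))" by (rule sum.swap)
    also have "\<dots> = (\<Sum>i<n. \<Sum>j<n. \<Sum>l\<in>S. E l $$ (i,j) * Lm x $$ (j,i))" by (intro sum.cong refl sum.swap)
    also have "\<dots> = (\<Sum>i<n. \<Sum>j<n. (if i = j then 1 else 0) * Lm x $$ (j,i))"
      by (intro sum.cong refl) (simp add: sumE flip: sum_distrib_right)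
    also have "\<dots> = (\<Sum>i<n. \<Sum>j<n. if i = j then Lm x $$ (i,i) else 0)" by (intro sum.cong) auto
    also have "\<dots> = (\<Sum>i<n. Lm x $$ (i,i))" by simp
    also have "\<dots> = 0"
    proof (intro sum.neutral ballI)
      fix i assume "i \<in> {..<n}"
      moreover from this have "f i \<noteq> x \<otimes> f i" using f_in[of i] x x1 by (metis lessThan_iff r_cancel_one')
      ultimately show "Lm x $$ (i,i) = 0" by (simp add: Lm_def kmat_def)
    qed
    finally show ?thesis .
  qed
  \<comment> \<open>Row sums test \<open>E l\<close> against the all-one vector. They vanish unless
    \<open>l\<close> is the class size, so the class size belongs to \<open>S\<close> and its
    projection has sum 1 in row 0.\<close>
  define \<rho> where "\<rho> l i = (\<Sum>j<n. E l $$ (i,j))" for l i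
  have \<rho>0: "\<rho> l i = 0" if l: "l \<in> S" "l \<noteq> ?c" "i < n" for l i
  proof -
    have "l * \<rho> l i = (\<Sum>j<n. (l \<cdot>\<^sub>m E l) $$ (i,j))"
      unfolding \<rho>_def sum_distrib_left using Ec[OF l(1)] l(3) by (intro sum.cong) auto
    also have "l \<cdot>\<^sub>m E l = E l * Am" using comm[OF l(1) carriers(3)] AE[OF l(1)] by simp
    also have "(\<Sum>j<n. (E l * Am) $$ (i,j)) = (\<Sum>j<n. \<Sum>k<n. E l $$ (i,k) * Am $$ (k,j))"
      using Ec[OF l(1)] l(3) by (intro sum.cong refl) (simp add: scalar_prod_def lessThan_atLeast0 Am_def kmat_def)
    also have "\<dots> = (\<Sum>k<n. \<Sum>j<n. E l $$ (i,k) * Am $$ (k,j))" by (rule sum.swap)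
    also have "\<dots> = (\<Sum>k<n. E l $$ (i,k) * ?c)"
      by (intro sum.cong refl) (simp add: Am_row_sum flip: sum_distrib_left)
    also have "\<dots> = ?c * \<rho> l i" by (simp add: \<rho>_def sum_distrib_left mult.commute)
    finally show ?thesis using l(2) by simp
  qed
  have sum\<rho>: "(\<Sum>l\<in>S. \<rho> l 0) = 1"
  proof -
    have "(\<Sum>l\<in>S. \<rho> l 0) = (\<Sum>j<n. \<Sum>l\<in>S. E l $$ (0,j))" unfolding \<rho>_def by (rule sum.swap)
    also have "\<dots> = (\<Sum>j<n. if 0 = j then 1 else 0)" using n0 sumE by (intro sum.cong) auto
    finally show ?thesis using n0 by simp
  qed
  have cS: "?c \<in> S"
  proof (rule ccontr)
    assume "?c \<notin> S"
    then have "(\<Sum>l\<in>S. \<rho> l 0) = 0" using \<rho>0 n0 by (intro sum.neutral) auto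
    then show False using sum\<rho> by simp
  qed
  have "(\<Sum>l\<in>S - {?c}. \<rho> l 0) = 0" using \<rho>0 n0 by (intro sum.neutral) auto
  then have \<rho>c: "\<rho> ?c 0 = 1" using sum\<rho> by (simp add: sum.remove[OF S cS])
  have col: "(\<Sum>y\<in>Cl. column_fun (E l) j (inv y \<otimes> g)) = ?c * \<gamma> l * column_fun (E l) j g"
    if "l \<in> S" "j < n" "g \<in> carrier G" for l j g
    by (rule column_fun_eigen[OF Ec[OF that(1)] that(2) _ that(3)]) (simp add: AE[OF that(1)] flip: l\<gamma>)
  have const: "E l $$ (i,j) = E l $$ (0,j)" "\<gamma> l * E l $$ (i,j) = E l $$ (i,j)"
    if l: "l \<in> S" "cmod (\<gamma> l) = 1" and ij: "i < n" "j < n" for l i j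
  proof -
    have *: "column_fun (E l) j g = column_fun (E l) j \<one>" "\<gamma> l * column_fun (E l) j g = column_fun (E l) j g"
      if "g \<in> carrier G" for g
      using eigenfunction_const[of "column_fun (E l) j" "\<gamma> l", OF col[OF l(1) ij(2)] l(2) simple nc that] by auto
    show "E l $$ (i,j) = E l $$ (0,j)" "\<gamma> l * E l $$ (i,j) = E l $$ (i,j)"
      using *[OF f_in[OF ij(1)]] *[OF f_in[OF n0]] column_fun ij n0 by auto
  qed
  have \<gamma>c: "\<gamma> ?c = 1" using c0 by (simp add: \<gamma>_def)
  \<comment> \<open>The entries within each column of \<open>E ?c\<close> agree, so the diagonal can
    be read off in row 0, whose sum is 1.\<close>
  have "mtrace (E ?c) = (\<Sum>i<n. E ?c $$ (0,i))"
    unfolding mtrace_def using Ec[OF cS] \<gamma>c by (intro sum.cong const(1)[OF cS]) auto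
  then have \<tau>c: "\<tau> ?c = 1" using \<tau>[OF cS] \<gamma>c \<rho>c by (simp add: \<rho>_def)
  have p0: "p > 0" using p(1) prime_gt_0_nat by blast
  define r where "r = complex_of_real (sqrt (real p))"
  have r2: "r ^ 2 = of_nat p" by (simp add: r_def flip: of_real_power)
  have r0: "r \<noteq> 0" using r2 p0 by auto
  txt \<open>Let \<open>d\<close> be the trace of \<open>E l\<close>. If \<open>p\<close> divides \<open>d\<close>, then \<open>(\<tau> l)\<^sup>2 = d (\<gamma> l) (\<tau> l)\<close> is \<open>p\<close> times an algebraic
    integer. Otherwise \<open>\<gamma> l\<close> is an algebraic integer, hence 0 or of modulus 1.\<close>
  have key: "algebraic_int (\<tau> l / r)" if l: "l \<in> S" "l \<noteq> ?c" for l
  \<comment> \<open>Nothing forces \<open>E l\<close> to be nonzero for \<open>l\<close> in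
    \<open>S\<close>, so a zero projection is treated together with
    \<open>\<gamma> l = 0\<close>.\<close>
  proof (cases "\<gamma> l = 0 \<or> (\<forall>i<n. \<forall>j<n. E l $$ (i,j) = 0)")
    case True
    then have "\<tau> l = 0"
    proof
      assume "\<forall>i<n. \<forall>j<n. E l $$ (i,j) = 0"
      then have "mtrace (E l) = 0" unfolding mtrace_def using Ec[OF l(1)] by auto
      then show ?thesis using \<tau>[OF l(1)] by simp
    qed (use \<tau>[OF l(1)] in simp)
    then show ?thesis by simp
  next
    case False
    then obtain i0 j0 where ij: "i0 < n" "j0 < n" "E l $$ (i0,j0) \<noteq> 0" and \<gamma>0: "\<gamma> l \<noteq> 0" by blast
    \<comment> \<open>Modulus 1 would force \<open>\<gamma> l = 1\<close> at a nonzero entry, that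
      is, \<open>l = ?c\<close>.\<close>
    have n1: "cmod (\<gamma> l) \<noteq> 1"
    proof
      assume "cmod (\<gamma> l) = 1"
      then have "\<gamma> l * E l $$ (i0,j0) = E l $$ (i0,j0)" using const(2)[OF l(1)] ij by blast
      then have "\<gamma> l = 1" using ij by simp
      then show False using l(2) l\<gamma>[of l] by simp
    qed
    have colE: "Am *\<^sub>v col (E l) j0 = l \<cdot>\<^sub>v col (E l) j0"
    proof -
      have "Am *\<^sub>v col (E l) j0 = col (Am * E l) j0" using col_mult2[OF carriers(3) Ec[OF l(1)] ij(2)] by simp
      also have "\<dots> = l \<cdot>\<^sub>v col (E l) j0" unfolding AE[OF l(1)] using Ec[OF l(1)] ij by (intro eq_vecI) auto
      finally show ?thesis .
    qed
    have cv: "col (E l) j0 \<in> carrier_vec n" using Ec[OF l(1)] by auto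
    have cnz: "col (E l) j0 \<noteq> 0\<^sub>v n"
    proof
      assume "col (E l) j0 = 0\<^sub>v n"
      then have "col (E l) j0 $ i0 = 0" using ij by simp
      then show False using ij Ec[OF l(1)] by simp
    qed
    have ail: "algebraic_int l"
      by (rule algebraic_int_int_eigenvalue[OF Aint(1) cv cnz]) (simp add: Aint(2) colE)
    have "eigenvalue Am l" using colE cv cnz unfolding eigenvalue_def eigenvector_def by (metis carrier_matD(1) carriers(3))
    then have root: "poly (char_poly Am) (?c * \<gamma> l) = 0"
      using eigenvalue_root_char_poly[OF carriers(3)] l\<gamma>[of l] by simp
    obtain d where d: "mtrace (E l) = of_nat d" using mtrace_idempotent[OF Ec[OF l(1)] idem[OF l(1)]] by blast
    have "p dvd d"
    proof (rule ccontr)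
      assume "\<not> p dvd d"
      then have "coprime (int d) (int (p ^ k))"
        using p(1) prime_imp_coprime[of p d] by (simp add: coprime_commute)
      then obtain a b where ab: "a * int d + b * int (p ^ k) = 1"
        using bezout_int[of "int d" "int (p ^ k)"] by (auto simp: coprime_iff_gcd_eq_1)
      \<comment> \<open>\<open>d\<close> times \<open>\<gamma> l\<close> is \<open>\<tau> l\<close>,
        and \<open>p ^ k\<close> times \<open>\<gamma> l\<close> is \<open>l\<close>; both are
        algebraic integers.\<close>
      have "\<gamma> l = of_int (a * int d + b * int (p ^ k)) * \<gamma> l" unfolding ab by simp
      also have "\<dots> = of_int a * \<tau> l + of_int b * l"
        using \<tau>[OF l(1)] d l\<gamma>[of l] p(2) by (simp add: algebra_simps)
      finally have "\<gamma> l = of_int a * \<tau> l + of_int b * l" .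
      moreover have "algebraic_int (of_int a * \<tau> l + of_int b * l)"
        by (intro algebraic_int_add_mult algebraic_int_of_int ai\<tau> l ail)
      ultimately have "algebraic_int (\<gamma> l)" by simp
      then have "cmod (\<gamma> l) = 1" using algebraic_int_ratio_norm \<gamma>0 root by blast
      then show False using n1 by simp
    qed
    then obtain e where e: "d = p * e" by (auto elim: dvdE)
    have "(\<tau> l / r) ^ 2 = of_nat e * (\<gamma> l * \<tau> l)"
      using \<tau>[OF l(1)] d e r2 p0 by (simp add: power_divide) (simp add: power2_eq_square)
    then have "algebraic_int ((\<tau> l / r) ^ 2)"
      using algebraic_int_add_mult(2)[OF algebraic_int_of_nat ai2[OF l(1)], of e] by simp
    then show ?thesis by (rule algebraic_int_of_power) simp
  qed
  have "0 = (\<Sum>l\<in>S - {?c}. \<tau> l) + 1"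
    using \<open>(\<Sum>l\<in>S. \<tau> l) = 0\<close> \<tau>c by (simp add: sum.remove[OF S cS] add.commute)
  then have "(\<Sum>l\<in>S - {?c}. \<tau> l) = - 1" by (simp add: eq_neg_iff_add_eq_0)
  then have "- 1 / r = (\<Sum>l\<in>S - {?c}. \<tau> l / r)"
    by (simp flip: sum_divide_distrib)
  moreover have "algebraic_int (\<Sum>l\<in>S - {?c}. \<tau> l / r)" by (intro algebraic_int_sum key) auto
  \<comment> \<open>Squaring leads back to a rational number, where an algebraic integer is an
    integer.\<close>
  ultimately have "algebraic_int ((- 1 / r) ^ 2)" using algebraic_int_power by metis
  then have "algebraic_int (1 / of_nat p :: complex)" using r2 by (simp add: power_divide)
  then have "(1 / of_nat p :: complex) \<in> \<int>" by (intro rational_algebraic_int_is_int) auto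
  then obtain m where m: "(1 / of_nat p :: complex) = of_int m" by (auto elim: Ints_cases)
  then have "of_int (m * int p) = (of_int 1 :: complex)" using p0 by (simp add: field_simps)
  then have "m * int p = 1" by (simp only: of_int_eq_iff)
  then show False using p(1) by (metis dvd_triv_right int_dvd_int_iff of_nat_1 prime_nat_iff nat_dvd_1_iff_1 not_prime_1)
qed

end

theorem (in group) prime_power_class_normal_subgroup:
  assumes fin: "finite (carrier G)" and x: "x \<in> carrier G" and u: "u \<in> carrier G" "x \<otimes> u \<noteq> u \<otimes> x"
    and p: "prime p" "card (conj_class x) = p ^ k"
  obtains N where "N \<lhd> G" "N \<noteq> {\<one>}" "N \<noteq> carrier G"
proof -
  obtain f where f: "bij_betw f {..<card (carrier G)} (carrier G)"
    using ex_bij_betw_nat_finite[OF fin] by (auto simp: lessThan_atLeast0)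
  interpret conj_class_matrix G f "card (carrier G)" x by unfold_locales (use f x in auto)
  show ?thesis using no_prime_power_class[OF _ u p] that by blast
qed

subsection \<open>Actions of groups of prime power order\<close>

lemma prime_power_if_single_prime_factor:
  fixes n :: nat
  assumes n: "n \<noteq> 0" and single: "\<And>q. prime q \<Longrightarrow> q dvd n \<Longrightarrow> q = p"
  shows "\<exists>k. n = p ^ k"
proof -
  have "prime_factors n \<subseteq> {p}" using single by (auto simp: in_prime_factors_iff)
  then consider "prime_factors n = {}" | "prime_factors n = {p}" by blast
  then show ?thesis
  proof cases
    case 1
    then have "n = p ^ 0" using prod_prime_factors[OF n] by simp
    then show ?thesis by blast
  next
    case 2
    then have "n = p ^ multiplicity p n" using prod_prime_factors[OF n] by simp
    then show ?thesis by blast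
  qed
qed

text \<open>The laws of an action make each map a bijection, inverted by the action of
  \<open>inv g\<close>. The restriction is there because the elements of \<open>Bij E\<close> are
  extensional functions.\<close>

lemma group_actionI:
  assumes G: "group G"
    and closed: "\<And>g e. g \<in> carrier G \<Longrightarrow> e \<in> E \<Longrightarrow> a g e \<in> E"
    and one: "\<And>e. e \<in> E \<Longrightarrow> a \<one>\<^bsub>G\<^esub> e = e"
    and mult: "\<And>g h e. g \<in> carrier G \<Longrightarrow> h \<in> carrier G \<Longrightarrow> e \<in> E \<Longrightarrow> a (g \<otimes>\<^bsub>G\<^esub> h) e = a g (a h e)"
  shows "group_action G E (\<lambda>g. restrict (a g) E)"
proof -
  interpret G: group G by fact
  have bij: "restrict (a g) E \<in> Bij E" if g: "g \<in> carrier G" for g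
  proof -
    have "bij_betw (a g) E E"
      using g by (intro bij_betw_byWitness[where f' = "a (inv\<^bsub>G\<^esub> g)"])
        (auto simp: closed one simp flip: mult)
    then show ?thesis by (auto simp: Bij_def bij_betw_def inj_on_def)
  qed
  have "(\<lambda>g. restrict (a g) E) \<in> hom G (BijGroup E)"
  proof (rule homI)
    fix g h assume g: "g \<in> carrier G" and h: "h \<in> carrier G"
    have "restrict (a (g \<otimes>\<^bsub>G\<^esub> h)) E = compose E (restrict (a g) E) (restrict (a h) E)"
      using g h by (auto simp: compose_def fun_eq_iff mult closed)
    then show "restrict (a (g \<otimes>\<^bsub>G\<^esub> h)) E = restrict (a g) E \<otimes>\<^bsub>BijGroup E\<^esub> restrict (a h) E"
      using bij g h by (simp add: BijGroup_def)
  qed (use bij in \<open>simp add: BijGroup_def\<close>)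
  then show ?thesis
    by (simp add: group_action_def group_hom_def group_hom_axioms_def G group_BijGroup)
qed

text \<open>Orbit sizes divide \<open>p ^ k\<close>, so without a fixed point all of them, and hence
  \<open>card E\<close>, would be divisible by \<open>p\<close>.\<close>

lemma (in group_action) prime_power_fixed_point:
  assumes p: "prime (p::nat)" and ord: "order G = p ^ k"
    and fin: "finite E" and ndvd: "\<not> p dvd card E"
  obtains e where "e \<in> E" "\<And>g. g \<in> carrier G \<Longrightarrow> \<phi> g e = e"
proof (rule ccontr)
  assume "\<not> thesis"
  then have nofix: "\<exists>g\<in>carrier G. \<phi> g e \<noteq> e" if "e \<in> E" for e using that \<open>\<And>e. \<lbrakk>e \<in> E; \<And>g. g \<in> carrier G \<Longrightarrow> \<phi> g e = e\<rbrakk> \<Longrightarrow> thesis\<close> by blast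
  have dvd: "p dvd card orb" if orb: "orb \<in> orbits G E \<phi>" for orb
  proof -
    obtain e where e: "e \<in> E" "orb = orbit G \<phi> e" using orb by (auto simp: orbits_def)
    have "card orb * card (stabilizer G \<phi> e) = p ^ k" using orbit_stabilizer_theorem[OF e(1)] e(2) ord by simp
    then have "card orb dvd p ^ k" by (metis dvd_triv_left)
    then obtain j where j: "card orb = p ^ j" using p divides_primepow_nat by blast
    have "j \<noteq> 0"
    proof
      assume "j = 0"
      then have "card orb = 1" using j by simp
      then obtain y where y: "orb = {y}" using card_1_singletonE by blast
      have "e \<in> orb" using orbit_refl[OF e(1)] e(2) by simp
      moreover obtain g where "g \<in> carrier G" "\<phi> g e \<noteq> e" using nofix[OF e(1)] by blast
      moreover from this have "\<phi> g e \<in> orb" using e(2) by (auto simp: orbit_def)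
      ultimately show False using y by simp
    qed
    then show ?thesis using j by simp
  qed
  have "card E = (\<Sum>orb\<in>orbits G E \<phi>. card orb)"
    using disjoint_sum[OF fin, of "\<lambda>_. 1 :: nat"] unfolding card_eq_sum by (rule sym)
  moreover have "p dvd (\<Sum>orb\<in>orbits G E \<phi>. card orb)" by (intro dvd_sum dvd)
  ultimately have "p dvd card E" by simp
  then show False using ndvd by simp
qed

section \<open>Centers, cosets and coprime indices in finite groups\<close>

context group
begin

lemma subgroup_order_dvd:
  assumes "subgroup H G" shows "card H dvd order G"
  using lagrange[OF assms] by (metis dvd_triv_right)

lemma subgroup_inter_order_dvd:
  assumes H: "subgroup H G" and K: "subgroup K G"
  shows "card (H \<inter> K) dvd card K"
proof -
  interpret K: group "G\<lparr>carrier := K\<rparr>" by (rule subgroup_imp_group[OF K])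
  have "subgroup (H \<inter> K) (G\<lparr>carrier := K\<rparr>)"
    using subgroup_incl[OF subgroups_Inter_pair[OF H K] K] by simp
  then show ?thesis using K.subgroup_order_dvd by (simp add: Coset.order_def)
qed

lemma card_subgroup_pos:
  assumes fin: "finite (carrier G)" and H: "subgroup H G"
  shows "card H \<noteq> 0"
proof -
  have "finite H" by (rule finite_subset[OF subgroup.subset[OF H] fin])
  moreover have "H \<noteq> {}" using subgroup.one_closed[OF H] by blast
  ultimately show ?thesis by simp
qed

text \<open>Conjugation permutes the \<open>p ^ k - 1\<close> nonidentity elements, and this number
  is prime to \<open>p\<close>.\<close>

lemma prime_power_order_center:
  assumes p: "prime (p::nat)" and ord: "order G = p ^ k" and k: "k > 0"
  obtains z where "z \<in> carrier G" "z \<noteq> \<one>" "\<And>g. g \<in> carrier G \<Longrightarrow> g \<otimes> z = z \<otimes> g"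
proof -
  have p1: "p > 1" using p prime_gt_1_nat by blast
  have fin: "finite (carrier G)" using ord p1 by (metis card.infinite Coset.order_def power_eq_0_iff not_one_less_zero)
  let ?a = "\<lambda>g h. g \<otimes> h \<otimes> inv g"
  have act: "group_action G (carrier G - {\<one>}) (\<lambda>g. restrict (?a g) (carrier G - {\<one>}))"
  proof (rule group_actionI)
    fix g e assume "g \<in> carrier G" "e \<in> carrier G - {\<one>}"
    then show "g \<otimes> e \<otimes> inv g \<in> carrier G - {\<one>}"
      by auto (metis conjugation_is_inj one_closed r_inv r_one)
  qed (auto simp: m_assoc inv_mult_group)
  have "card (carrier G - {\<one>}) = p ^ k - 1" using ord fin by (simp add: Coset.order_def)
  moreover have "\<not> p dvd p ^ k - 1"
  proof
    assume "p dvd p ^ k - 1"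
    moreover have "p dvd p ^ k" using k by simp
    ultimately have "p dvd p ^ k - (p ^ k - 1)" by (rule dvd_diff_nat[rotated])
    moreover have "p ^ k \<ge> 1" using p1 by simp
    ultimately show False using p1 by simp
  qed
  ultimately obtain e where e: "e \<in> carrier G - {\<one>}"
    "\<And>g. g \<in> carrier G \<Longrightarrow> restrict (?a g) (carrier G - {\<one>}) e = e"
    using group_action.prime_power_fixed_point[OF act p ord] fin by (metis finite_Diff)
  have "g \<otimes> e = e \<otimes> g" if g: "g \<in> carrier G" for g
  proof -
    have "g \<otimes> e \<otimes> inv g = e" using e(2)[OF g] e(1) by simp
    then show ?thesis using g e(1) by (metis DiffD1 inv_solve_right m_closed)
  qed
  then show ?thesis using that e(1) by blast
qed

lemma card_conj_class:
  assumes x: "x \<in> carrier G"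
  shows "card (conj_class x) * card {g \<in> carrier G. g \<otimes> x \<otimes> inv g = x} = order G"
proof -
  interpret act: group_action G "carrier G" "\<lambda>g. (\<lambda>h \<in> carrier G. g \<otimes> h \<otimes> inv g)" by (rule action_by_conjugation)
  have "orbit G (\<lambda>g. (\<lambda>h \<in> carrier G. g \<otimes> h \<otimes> inv g)) x = conj_class x"
    using x by (auto simp: orbit_def conj_class_def)
  moreover have "stabilizer G (\<lambda>g. (\<lambda>h \<in> carrier G. g \<otimes> h \<otimes> inv g)) x = {g \<in> carrier G. g \<otimes> x \<otimes> inv g = x}"
    using x by (auto simp: stabilizer_def)
  ultimately show ?thesis using act.orbit_stabilizer_theorem[OF x] by simp
qed

lemma centralizer_subgroup:
  assumes x: "x \<in> carrier G"
  shows "subgroup {g \<in> carrier G. g \<otimes> x \<otimes> inv g = x} G"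
proof -
  interpret act: group_action G "carrier G" "\<lambda>g. (\<lambda>h \<in> carrier G. g \<otimes> h \<otimes> inv g)" by (rule action_by_conjugation)
  have "stabilizer G (\<lambda>g. (\<lambda>h \<in> carrier G. g \<otimes> h \<otimes> inv g)) x = {g \<in> carrier G. g \<otimes> x \<otimes> inv g = x}"
    using x by (auto simp: stabilizer_def)
  then show ?thesis using act.stabilizer_subgroup[OF x] by simp
qed

lemma cauchy_prime_order:
  assumes fin: "finite (carrier G)" and p: "prime (p::nat)" "p dvd order G"
  obtains x where "x \<in> carrier G" "x \<noteq> \<one>" "x [^] p = \<one>"
proof -
  \<comment> \<open>\<open>sylow_thm\<close> lets \<open>p\<close> divide the cofactor
    \<open>m\<close>, so exponent 1 yields a subgroup of order exactly \<open>p\<close>.\<close>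
  obtain m where "order G = p ^ 1 * m" using p(2) by (auto elim: dvdE)
  then obtain H where H: "subgroup H G" "card H = p"
    using sylow_thm[OF p(1) is_group _ fin, of 1 m] by auto
  have p1: "p > 1" using p(1) prime_gt_1_nat by blast
  have "\<not> H \<subseteq> {\<one>}"
  proof
    assume "H \<subseteq> {\<one>}"
    then have "card H \<le> 1" using card_mono[of "{\<one>}" H] by simp
    then show False using H(2) p1 by simp
  qed
  then obtain x where x: "x \<in> H" "x \<noteq> \<one>" by blast
  interpret H: group "G\<lparr>carrier := H\<rparr>" by (rule subgroup_imp_group[OF H(1)])
  have "x [^]\<^bsub>G\<lparr>carrier := H\<rparr>\<^esub> p = \<one>" using H.pow_order_eq_1[of x] x H(2) by (simp add: Coset.order_def)
  then have "x [^] p = \<one>" using nat_pow_consistent by metis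
  then show ?thesis using that x subgroup.mem_carrier[OF H(1)] by blast
qed

lemma prime_exponent_imp_prime_power_order:
  assumes fin: "finite (carrier G)" and p: "prime (p::nat)"
    and exp: "\<And>x. x \<in> carrier G \<Longrightarrow> x [^] p = \<one>"
  shows "\<exists>k. order G = p ^ k"
proof -
  have qp: "q = p" if q: "prime q" "q dvd order G" for q
  proof (rule ccontr)
    assume "q \<noteq> p"
    obtain x where x: "x \<in> carrier G" "x \<noteq> \<one>" "x [^] q = \<one>" using cauchy_prime_order[OF fin q] .
    have "ord x dvd q" "ord x dvd p" using x exp[OF x(1)] pow_eq_id by auto
    moreover have "coprime q p" using q(1) p \<open>q \<noteq> p\<close> by (simp add: primes_coprime)
    ultimately have "ord x = 1" using coprime_common_divisor[of q p "ord x"] by simp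
    then show False using x ord_eq_1 by simp
  qed
  have pos: "order G \<noteq> 0" using fin order_gt_0_iff_finite by simp
  show ?thesis using prime_power_if_single_prime_factor[OF pos qp] by blast
qed

text \<open>The inverse turns the natural right action on right cosets into a left action.\<close>

lemma rcosets_action:
  assumes M: "subgroup M G" and K: "subgroup K G"
  shows "group_action (G\<lparr>carrier := M\<rparr>) (rcosets K) (\<lambda>m. \<lambda>C\<in>rcosets K. C #> inv m)"
proof (rule group_actionI)
  have Mc: "m \<in> carrier G" if "m \<in> M" for m using that subgroup.mem_carrier[OF M] by blast
  have Kc: "K \<subseteq> carrier G" by (rule subgroup.subset[OF K])
  show "group (G\<lparr>carrier := M\<rparr>)" by (rule subgroup_imp_group[OF M])
  fix e assume e: "e \<in> rcosets K"
  then show "e #> inv \<one>\<^bsub>G\<lparr>carrier := M\<rparr>\<^esub> = e"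
    using Kc by (auto simp: RCOSETS_def coset_mult_assoc)
  fix g assume g: "g \<in> carrier (G\<lparr>carrier := M\<rparr>)"
  then show "e #> inv g \<in> rcosets K"
    using e Kc Mc by (auto simp: RCOSETS_def coset_mult_assoc intro!: bexI)
  fix h assume "h \<in> carrier (G\<lparr>carrier := M\<rparr>)"
  then show "e #> inv (g \<otimes>\<^bsub>G\<lparr>carrier := M\<rparr>\<^esub> h) = e #> inv h #> inv g"
    using e g Kc Mc by (auto simp: RCOSETS_def coset_mult_assoc inv_mult_group m_assoc)
qed

text \<open>The number of cosets is prime to \<open>p\<close>, so \<open>M\<close> fixes a coset of
  \<open>K\<close>, and a representative of that coset conjugates \<open>M\<close> into
  \<open>K\<close>.\<close>

lemma prime_power_subgroup_conj:
  assumes fin: "finite (carrier G)" and M: "subgroup M G" "card M = p ^ j" and p: "prime (p::nat)"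
    and K: "subgroup K G" "\<not> p dvd card (rcosets K)"
  obtains a where "a \<in> carrier G" "\<And>m. m \<in> M \<Longrightarrow> a \<otimes> m \<otimes> inv a \<in> K"
proof -
  interpret M: group "G\<lparr>carrier := M\<rparr>" by (rule subgroup_imp_group[OF M(1)])
  have Mc: "m \<in> carrier G" if "m \<in> M" for m using that subgroup.mem_carrier[OF M(1)] by blast
  have Kc: "K \<subseteq> carrier G" by (rule subgroup.subset[OF K(1)])
  let ?a = "\<lambda>m C. C #> inv m"
  have act: "group_action (G\<lparr>carrier := M\<rparr>) (rcosets K) (\<lambda>m. restrict (?a m) (rcosets K))"
    by (rule rcosets_action[OF M(1) K(1)])
  have "finite (rcosets K)" using fin rcosets_part_G[OF K(1)] by (metis finite_UnionD)
  then obtain C where C: "C \<in> rcosets K" "\<And>m. m \<in> M \<Longrightarrow> restrict (?a m) (rcosets K) C = C"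
    using group_action.prime_power_fixed_point[OF act p _ _ K(2), of j] M(2) by (auto simp: Coset.order_def)
  obtain a where a: "a \<in> carrier G" "C = K #> a" using C(1) by (auto simp: RCOSETS_def)
  have "a \<otimes> m \<otimes> inv a \<in> K" if m: "m \<in> M" for m
  proof -
    have mi: "inv m \<in> M" using subgroup.m_inv_closed[OF M(1) m] .
    have "C #> inv (inv m) = C" using C(2)[OF mi] C(1) by simp
    then have "K #> (a \<otimes> m) = K #> a" using a Mc[OF m] Kc by (simp add: coset_mult_assoc)
    then have "a \<otimes> m \<in> K #> a" using rcos_self[OF _ K(1), of "a \<otimes> m"] a Mc[OF m] by simp
    then show ?thesis using subgroup.rcos_module[OF K(1) is_group a(1), of "a \<otimes> m"] a Mc[OF m] by simp
  qed
  then show ?thesis using that a(1) by blast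
qed

text \<open>The orbit of the coset \<open>K\<close> under \<open>H\<close> has size
  \<open>card H div card (H \<inter> K)\<close>. Writing the group order in two ways shows that the
  index of \<open>K\<close> divides the index of \<open>H\<close> times this size, so by coprimality
  the orbit contains all cosets.\<close>

lemma coprime_index_product:
  assumes fin: "finite (carrier G)" and H: "subgroup H G" and K: "subgroup K G"
    and cop: "coprime (card (rcosets H)) (card (rcosets K))" and g: "g \<in> carrier G"
  obtains k h where "k \<in> K" "h \<in> H" "g = k \<otimes> h"
proof -
  interpret M: group "G\<lparr>carrier := H\<rparr>" by (rule subgroup_imp_group[OF H])
  have Hc: "m \<in> carrier G" if "m \<in> H" for m using that subgroup.mem_carrier[OF H] by blast
  have Kc: "K \<subseteq> carrier G" by (rule subgroup.subset[OF K])
  let ?a = "\<lambda>m. \<lambda>C\<in>rcosets K. C #> inv m"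
  have act: "group_action (G\<lparr>carrier := H\<rparr>) (rcosets K) ?a"
    by (rule rcosets_action[OF H K])
  have finR: "finite (rcosets K)" using fin rcosets_part_G[OF K] by (metis finite_UnionD)
  have Kin: "K \<in> rcosets K" using subgroup.subgroup_in_rcosets[OF K is_group] .
  let ?orb = "orbit (G\<lparr>carrier := H\<rparr>) ?a K"
  have orb: "?orb = {K #> inv m |m. m \<in> H}" using Kin by (auto simp: orbit_def)
  have stab: "stabilizer (G\<lparr>carrier := H\<rparr>) ?a K = H \<inter> K"
  proof -
    have "K #> inv m = K \<longleftrightarrow> m \<in> K" if m: "m \<in> H" for m
    proof
      assume "K #> inv m = K"
      then have "inv m \<in> K" using rcos_self[OF _ K, of "inv m"] Hc[OF m] by simp
      then show "m \<in> K" using subgroup.m_inv_closed[OF K] Hc[OF m] by (metis inv_inv)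
    next
      assume "m \<in> K"
      then have "inv m \<in> K" using subgroup.m_inv_closed[OF K] by blast
      then show "K #> inv m = K" using coset_join2[OF _ K] Hc[OF m] by simp
    qed
    then show ?thesis using Kin by (auto simp: stabilizer_def)
  qed
  have os: "card ?orb * card (H \<inter> K) = card H"
    using group_action.orbit_stabilizer_theorem[OF act Kin] stab by (simp add: Coset.order_def)
  have HK: "subgroup (H \<inter> K) G" using subgroups_Inter_pair[OF H K] .
  have "card (H \<inter> K) dvd card K" by (rule subgroup_inter_order_dvd[OF H K])
  then obtain t where t: "card K = card (H \<inter> K) * t" by (auto elim: dvdE)
  have s0: "card (H \<inter> K) \<noteq> 0" by (rule card_subgroup_pos[OF fin HK])
  have "card (rcosets H) * (card ?orb * card (H \<inter> K)) = card (rcosets K) * (card (H \<inter> K) * t)"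
    using lagrange[OF H] lagrange[OF K] os t by simp
  then have "card (rcosets H) * card ?orb = card (rcosets K) * t" using s0 by simp
  then have "card (rcosets K) dvd card (rcosets H) * card ?orb" by simp
  then have dvd: "card (rcosets K) dvd card ?orb"
    using cop by (simp add: coprime_commute coprime_dvd_mult_right_iff)
  have sub: "?orb \<subseteq> rcosets K"
  proof
    fix C assume "C \<in> ?orb"
    then obtain m where "m \<in> H" "C = K #> inv m" unfolding orb by blast
    then show "C \<in> rcosets K" using rcosetsI[OF Kc] Hc by simp
  qed
  have "?orb \<noteq> {}" unfolding orb using subgroup.one_closed[OF H] by blast
  then have "card ?orb > 0" using finite_subset[OF sub finR] card_gt_0_iff by blast
  then have "card (rcosets K) \<le> card ?orb" using dvd dvd_imp_le by blast
  then have "?orb = rcosets K" using sub finR card_seteq by blast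
  moreover have "K #> g \<in> rcosets K" by (rule rcosetsI[OF Kc g])
  ultimately obtain m where m: "m \<in> H" "K #> g = K #> inv m" unfolding orb by blast
  have "g \<in> K #> inv m" using rcos_self[OF g K] m(2) by simp
  then obtain k where k: "k \<in> K" "g = k \<otimes> inv m" by (auto simp: r_coset_def)
  then show ?thesis using that k subgroup.m_inv_closed[OF H m(1)] by blast
qed

section \<open>Solvability: extensions, normal subgroups and quotients\<close>

lemma solvable_extension:
  assumes h: "group_hom G K h" and N: "solvable_seq G N" "kernel G K h \<subseteq> N"
    and im: "solvable_seq K (h ` carrier G)"
  shows "solvable G"
proof -
  have id: "group_hom G G id" by (simp add: group_hom_def group_hom_axioms_def is_group hom_def)
  show ?thesis unfolding solvable_def
    by (rule solvable_seq_condition[OF id h _ _ subgroup_self N(1) im])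
      (use N(2) subgroup.subset[OF solvable_imp_subgroup[OF N(1)]] in auto)
qed

lemma solvable_seq_iff_solvable:
  assumes H: "subgroup H G"
  shows "solvable_seq G H \<longleftrightarrow> solvable (G\<lparr>carrier := H\<rparr>)"
proof -
  interpret H: group "G\<lparr>carrier := H\<rparr>" by (rule subgroup_imp_group[OF H])
  have hom: "group_hom (G\<lparr>carrier := H\<rparr>) G id"
    using subgroup.subset[OF H] by (auto simp: group_hom_def group_hom_axioms_def is_group H.is_group hom_def)
  show ?thesis
  proof
    assume "solvable_seq G H"
    then show "solvable (G\<lparr>carrier := H\<rparr>)" unfolding solvable_def
      using group_hom.solvable_img_imp_solvable[OF hom H.subgroup_self] by simp
  next
    assume "solvable (G\<lparr>carrier := H\<rparr>)"
    then show "solvable_seq G H" unfolding solvable_def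
      using group_hom.solvable_imp_solvable_img[OF hom] by fastforce
  qed
qed

lemma comm_imp_solvable:
  assumes "\<And>x y. x \<in> carrier G \<Longrightarrow> y \<in> carrier G \<Longrightarrow> x \<otimes> y = y \<otimes> x"
  shows "solvable G"
proof -
  interpret comm_group G by (rule group_comm_groupI) (use assms in auto)
  have "(derived G ^^ 1) (carrier G) = {\<one>}" using derived_eq_singleton by simp
  then show ?thesis unfolding solvable_def using trivial_derived_seq_imp_solvable[OF subgroup_self] by blast
qed

text \<open>The last nontrivial term \<open>A\<close> of the derived series is abelian and normal.
  For a prime \<open>p\<close> dividing its order, the solutions of \<open>a [^] p = \<one>\<close>
  in \<open>A\<close> form a subgroup that is stable under conjugation and nontrivial by
  Cauchy.\<close>

lemma solvable_normal_prime_power_subgroup: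
  assumes fin: "finite (carrier G)" and solv: "solvable G" and nt: "carrier G \<noteq> {\<one>}"
  obtains M p k where "prime (p::nat)" "M \<lhd> G" "card M = p ^ k" "M \<noteq> {\<one>}"
proof -
  obtain n0 where n0: "(derived G ^^ n0) (carrier G) = {\<one>}"
    using solvable_imp_trivial_derived_seq solv unfolding solvable_def by blast
  define n where "n = (LEAST n. (derived G ^^ n) (carrier G) = {\<one>})"
  have n: "(derived G ^^ n) (carrier G) = {\<one>}" unfolding n_def by (rule LeastI[of _ n0]) (rule n0)
  have "n \<noteq> 0" using n nt by (cases n) auto
  then obtain m where m: "n = Suc m" by (cases n) auto
  define A where "A = (derived G ^^ m) (carrier G)"
  have A1: "A \<noteq> {\<one>}" using not_less_Least[of m "\<lambda>n. (derived G ^^ n) (carrier G) = {\<one>}"] m by (auto simp: A_def n_def)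
  have dA: "derived G A = {\<one>}" using n m by (simp add: A_def)
  have "(derived G ^^ i) (carrier G) \<lhd> G" for i by (induction i) (auto intro: derived_is_normal normal_self)
  then have AN: "A \<lhd> G" by (simp add: A_def)
  have AS: "subgroup A G" using AN normal_imp_subgroup by blast
  have Ac: "a \<in> carrier G" if "a \<in> A" for a using that subgroup.mem_carrier[OF AS] by blast
  have comm: "a \<otimes> b = b \<otimes> a" if ab: "a \<in> A" "b \<in> A" for a b
  proof -
    have "a \<otimes> b \<otimes> inv a \<otimes> inv b \<in> derived G A" unfolding derived_def using ab by (intro generate.incl) auto
    then have "a \<otimes> b \<otimes> inv a \<otimes> inv b = \<one>" using dA by simp
    then show ?thesis using Ac ab by (metis inv_closed inv_equality inv_inv inv_mult_group m_assoc m_closed)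
  qed
  interpret A: group "G\<lparr>carrier := A\<rparr>" by (rule subgroup_imp_group[OF AS])
  have finA: "finite A" using fin subgroup.subset[OF AS] finite_subset by blast
  have "card A \<noteq> 1" using A1 subgroup.one_closed[OF AS] by (metis card_1_singletonE singletonD)
  then obtain p where p: "prime p" "p dvd card A" using prime_factor_nat by blast
  define M where "M = {a \<in> A. a [^] p = \<one>}"
  have pow: "(a \<otimes> b) [^] i = a [^] i \<otimes> b [^] i" if "a \<in> A" "b \<in> A" for a b and i :: nat
    using that comm Ac by (intro pow_mult_distrib) auto
  have MS: "subgroup M G"
  proof (rule subgroupI)
    show "M \<subseteq> carrier G" using Ac by (auto simp: M_def)
    show "M \<noteq> {}" using subgroup.one_closed[OF AS] by (auto simp: M_def)
    show "inv a \<in> M" if "a \<in> M" for a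
      using that Ac subgroup.m_inv_closed[OF AS] by (auto simp: M_def nat_pow_inv)
    show "a \<otimes> b \<in> M" if "a \<in> M" "b \<in> M" for a b
      using that subgroup.m_closed[OF AS] pow by (auto simp: M_def)
  qed
  have MN: "M \<lhd> G"
  proof (rule normal_invI[OF MS])
    fix x h assume x: "x \<in> carrier G" and h: "h \<in> M"
    have "x \<otimes> h \<otimes> inv x \<in> A" using normal_invE(2)[OF AN x] h by (auto simp: M_def)
    moreover have "(x \<otimes> h \<otimes> inv x) [^] i = x \<otimes> h [^] i \<otimes> inv x" for i :: nat
    proof (induction i)
      case (Suc i)
      have hc: "h \<in> carrier G" using h Ac by (auto simp: M_def)
      have "(x \<otimes> h \<otimes> inv x) [^] Suc i = (x \<otimes> h [^] i \<otimes> inv x) \<otimes> (x \<otimes> h \<otimes> inv x)" using Suc by simp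
      also have "\<dots> = x \<otimes> h [^] i \<otimes> (inv x \<otimes> x) \<otimes> h \<otimes> inv x" using x hc by (simp only: m_assoc m_closed inv_closed nat_pow_closed)
      also have "\<dots> = x \<otimes> h [^] Suc i \<otimes> inv x" using x hc by (simp add: m_assoc)
      finally show ?case .
    qed (use x in simp)
    ultimately show "x \<otimes> h \<otimes> inv x \<in> M" using h x by (auto simp: M_def)
  qed
  obtain x where x: "x \<in> A" "x \<noteq> \<one>" "x [^]\<^bsub>G\<lparr>carrier := A\<rparr>\<^esub> p = \<one>"
    using A.cauchy_prime_order[of p] finA p by (auto simp: Coset.order_def)
  then have "x \<in> M" using nat_pow_consistent[of x p A] by (auto simp: M_def)
  then have M1: "M \<noteq> {\<one>}" using x(2) by blast
  interpret M: group "G\<lparr>carrier := M\<rparr>" by (rule subgroup_imp_group[OF MS])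
  have "\<exists>k. order (G\<lparr>carrier := M\<rparr>) = p ^ k"
  proof (rule M.prime_exponent_imp_prime_power_order[OF _ p(1)])
    show "finite (carrier (G\<lparr>carrier := M\<rparr>))" using finA by (auto simp: M_def)
    fix y assume "y \<in> carrier (G\<lparr>carrier := M\<rparr>)"
    then show "y [^]\<^bsub>G\<lparr>carrier := M\<rparr>\<^esub> p = \<one>\<^bsub>G\<lparr>carrier := M\<rparr>\<^esub>"
      using nat_pow_consistent[of y p M] by (auto simp: M_def)
  qed
  then show ?thesis using that[OF p(1) MN _ M1] by (auto simp: Coset.order_def)
qed

text \<open>A quotient lives on another type; copying it to \<^typ>\<open>nat\<close> lets an induction on the order of a
  group run over a single type.\<close>
lemma quotient_on_nat:
  assumes fin: "finite (carrier G)" and N: "N \<lhd> G"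
  obtains Q :: "nat monoid" and h where "group_hom G Q h" "h ` carrier G = carrier Q" "kernel G Q h = N"
proof -
  interpret N: normal N G by fact
  let ?F = "G Mod N"
  interpret F: group ?F by (rule N.factorgroup_is_group)
  have "finite (carrier ?F)" using fin rcosets_part_G[OF N.subgroup_axioms] by (metis FactGroup_def finite_UnionD partial_object.select_convs(1))
  then obtain f where f: "bij_betw f (carrier ?F) {..<card (carrier ?F)}"
    using ex_bij_betw_finite_nat[of "carrier ?F"] by (auto simp: lessThan_atLeast0)
  define b where "b = inv_into (carrier ?F) f"
  define Q :: "nat monoid" where
    "Q = \<lparr>carrier = {..<card (carrier ?F)}, monoid.mult = \<lambda>x y. f (b x \<otimes>\<^bsub>?F\<^esub> b y), one = f \<one>\<^bsub>?F\<^esub>\<rparr>"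
  have bf: "b (f x) = x" if "x \<in> carrier ?F" for x using f that by (simp add: b_def bij_betw_def)
  have fQ: "f ` carrier ?F = carrier Q" using f by (simp add: Q_def bij_betw_def)
  have fhom: "f \<in> hom ?F Q" using fQ bf by (auto simp: hom_def Q_def)
  have fiso: "f \<in> iso ?F Q" using fhom f by (auto simp: iso_def Q_def)
  have "group (Q\<lparr>one := f \<one>\<^bsub>?F\<^esub>\<rparr>)" by (rule F.iso_imp_img_group[OF fiso])
  then have "group Q" by (simp add: Q_def)
  then interpret Q: group Q .
  have rhom: "(\<lambda>a. N #> a) \<in> hom G ?F" by (rule N.r_coset_hom_Mod)
  have hom: "(\<lambda>a. f (N #> a)) \<in> hom G Q" using rhom fhom by (auto simp: hom_def Pi_iff)
  have h: "group_hom G Q (\<lambda>a. f (N #> a))" by (simp add: group_hom_def group_hom_axioms_def is_group Q.is_group hom)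
  have im: "(\<lambda>a. N #> a) ` carrier G = carrier ?F" by (auto simp: FactGroup_def RCOSETS_def)
  then have "(\<lambda>a. f (N #> a)) ` carrier G = carrier Q" using fQ by (metis image_image)
  moreover have "kernel G Q (\<lambda>a. f (N #> a)) = N"
  proof -
    have "f (N #> a) = \<one>\<^bsub>Q\<^esub> \<longleftrightarrow> N #> a = N" if "a \<in> carrier G" for a
    proof -
      have "N #> a \<in> carrier ?F" "N \<in> carrier ?F" using im that F.one_closed by (auto simp: FactGroup_def)
      moreover have "\<one>\<^bsub>Q\<^esub> = f N" by (simp add: Q_def FactGroup_def)
      ultimately show ?thesis using f by (auto simp: bij_betw_def inj_on_def)
    qed
    moreover have "N #> a = N \<longleftrightarrow> a \<in> N" if "a \<in> carrier G" for a
      using coset_join1[OF _ that N.subgroup_axioms] coset_join2[OF that N.subgroup_axioms] by blast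
    ultimately show ?thesis using N.subset by (auto simp: kernel_def)
  qed
  ultimately show ?thesis using that[OF h] by blast
qed

end

text \<open>Every fibre of \<open>h\<close> on \<open>K\<close> is a translate of the part of the
  kernel inside \<open>K\<close>.\<close>

lemma (in group_hom) card_image_kernel:
  assumes fin: "finite (carrier G)" and K: "subgroup K G"
  shows "card (h ` K) * card (K \<inter> kernel G H h) = card K"
proof -
  have Kc: "K \<subseteq> carrier G" by (rule subgroup.subset[OF K])
  interpret K: group "G\<lparr>carrier := K\<rparr>" by (rule G.subgroup_imp_group[OF K])
  have fK: "finite K" using fin Kc finite_subset by blast
  have "card {k \<in> K. h k = y} = card (K \<inter> kernel G H h)" if y: "y \<in> h ` K" for y
  proof -
    obtain k0 where k0: "k0 \<in> K" "h k0 = y" using y by auto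
    have "bij_betw (\<lambda>k. k0 \<otimes>\<^bsub>G\<^esub> k) (K \<inter> kernel G H h) {k \<in> K. h k = y}"
    proof (rule bij_betw_byWitness[where f' = "\<lambda>k. inv\<^bsub>G\<^esub> k0 \<otimes>\<^bsub>G\<^esub> k"])
      show "\<forall>a\<in>K \<inter> kernel G H h. inv k0 \<otimes> (k0 \<otimes> a) = a" using k0 Kc by (auto simp: subset_iff simp flip: G.m_assoc)
      show "\<forall>a'\<in>{k \<in> K. h k = y}. k0 \<otimes> (inv k0 \<otimes> a') = a'" using k0 Kc by (auto simp: subset_iff simp flip: G.m_assoc)
      show "(\<otimes>) k0 ` (K \<inter> kernel G H h) \<subseteq> {k \<in> K. h k = y}"
        using k0 Kc subgroup.m_closed[OF K] by (auto simp: kernel_def subset_iff)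
      show "(\<otimes>) (inv k0) ` {k \<in> K. h k = y} \<subseteq> K \<inter> kernel G H h"
        using k0 Kc subgroup.m_closed[OF K] subgroup.m_inv_closed[OF K] by (auto simp: kernel_def subset_iff)
    qed
    then show ?thesis by (simp add: bij_betw_same_card)
  qed
  then have "(\<Sum>y\<in>h ` K. card {k \<in> K. h k = y}) = card (h ` K) * card (K \<inter> kernel G H h)" by simp
  moreover have "(\<Sum>y\<in>h ` K. card {k \<in> K. h k = y}) = card K"
    unfolding card_eq_sum by (rule sum.image_gen[OF fK, symmetric])
  ultimately show ?thesis by simp
qed

subsection \<open>Solvability criteria of Burnside and Wielandt\<close>

lemma (in group_hom) order_image_kernel:
  assumes "finite (carrier G)" "h ` carrier G = carrier H"
  shows "order H * card (kernel G H h) = order G"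
proof -
  have "carrier G \<inter> kernel G H h = kernel G H h" by (auto simp: kernel_def)
  then show ?thesis using card_image_kernel[OF assms(1) G.subgroup_self] assms(2) by (simp add: Coset.order_def)
qed

text \<open>The order of \<open>K \<inter> ?N\<close> divides that of the kernel, which Lagrange on
  both sides turns into divisibility of indices. Coprime indices therefore stay coprime in
  quotients.\<close>

lemma (in group_hom) index_image_dvd:
  assumes fin: "finite (carrier G)" and surj: "h ` carrier G = carrier H" and K: "subgroup K G"
  shows "card (rcosets\<^bsub>H\<^esub> (h ` K)) dvd card (rcosets\<^bsub>G\<^esub> K)"
proof -
  let ?N = "kernel G H h"
  have hK: "subgroup (h ` K) H" by (rule subgroup_img_is_subgroup[OF K])
  obtain t where t: "card ?N = card (K \<inter> ?N) * t"
    using G.subgroup_inter_order_dvd[OF K subgroup_kernel] by (auto elim: dvdE)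
  have "card (rcosets\<^bsub>G\<^esub> K) * card K = order G" by (rule G.lagrange[OF K])
  also have "\<dots> = card (rcosets\<^bsub>H\<^esub> (h ` K)) * card (h ` K) * card ?N"
    using H.lagrange[OF hK] order_image_kernel[OF fin surj] by simp
  finally have "card (rcosets\<^bsub>G\<^esub> K) * card K = card (rcosets\<^bsub>H\<^esub> (h ` K)) * t * card K"
    using card_image_kernel[OF fin K] t by (metis mult.assoc mult.commute)
  moreover have "card K \<noteq> 0" by (rule G.card_subgroup_pos[OF fin K])
  ultimately show ?thesis by simp
qed

lemma (in group) solvable_seq_mono:
  assumes H: "solvable_seq G H" and N: "subgroup N G" "N \<subseteq> H"
  shows "solvable_seq G N"
proof -
  obtain n where n: "(derived G ^^ n) H = {\<one>}" using solvable_imp_trivial_derived_seq[OF H] by blast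
  have "(derived G ^^ n) N \<subseteq> {\<one>}" using mono_exp_of_derived[OF N(2), of n] n by simp
  moreover have "\<one> \<in> (derived G ^^ n) N" using subgroup.one_closed[OF exp_of_derived_is_subgroup[OF N(1)]] .
  ultimately have "(derived G ^^ n) N = {\<one>}" by blast
  then show ?thesis by (rule trivial_derived_seq_imp_solvable[OF N(1)])
qed

lemma (in group) center_normal: "{z \<in> carrier G. \<forall>g\<in>carrier G. g \<otimes> z = z \<otimes> g} \<lhd> G" (is "?Z \<lhd> G")
proof (rule normal_invI)
  show "subgroup ?Z G"
  proof (rule subgroupI)
    fix a b assume "a \<in> ?Z" "b \<in> ?Z"
    then have a: "a \<in> carrier G" "\<And>g. g \<in> carrier G \<Longrightarrow> g \<otimes> a = a \<otimes> g"
      and b: "b \<in> carrier G" "\<And>g. g \<in> carrier G \<Longrightarrow> g \<otimes> b = b \<otimes> g" by blast+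
    have "g \<otimes> (a \<otimes> b) = a \<otimes> b \<otimes> g" if g: "g \<in> carrier G" for g
    proof -
      have "g \<otimes> (a \<otimes> b) = (g \<otimes> a) \<otimes> b" using a(1) b(1) g by (simp add: m_assoc)
      also have "\<dots> = a \<otimes> (g \<otimes> b)" unfolding a(2)[OF g] using a(1) b(1) g by (simp add: m_assoc)
      also have "\<dots> = a \<otimes> b \<otimes> g" unfolding b(2)[OF g] using a(1) b(1) g by (simp add: m_assoc)
      finally show ?thesis .
    qed
    then show "a \<otimes> b \<in> ?Z" using a(1) b(1) by blast
  next
    fix a assume "a \<in> ?Z"
    then have a: "a \<in> carrier G" "\<And>g. g \<in> carrier G \<Longrightarrow> g \<otimes> a = a \<otimes> g" by blast+
    have "g \<otimes> inv a = inv a \<otimes> g" if g: "g \<in> carrier G" for g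
    proof -
      have "inv (inv g \<otimes> a) = inv (a \<otimes> inv g)" using a(2)[of "inv g"] g by (metis inv_closed)
      then show ?thesis using a(1) g by (simp add: inv_mult_group)
    qed
    then show "inv a \<in> ?Z" using a(1) by blast
  qed auto
next
  fix x h assume x: "x \<in> carrier G" and "h \<in> ?Z"
  then have h: "h \<in> carrier G" "x \<otimes> h = h \<otimes> x" "h \<in> ?Z" by blast+
  have "x \<otimes> h \<otimes> inv x = h" unfolding h(2) using x h(1) by (simp add: m_assoc)
  then show "x \<otimes> h \<otimes> inv x \<in> ?Z" using h(3) by metis
qed

text \<open>\<open>H\<close> lies in the centralizer of \<open>x\<close>, so the class size divides
  the index \<open>s ^ d\<close> of \<open>H\<close>.\<close>

lemma (in group) card_conj_class_prime_power:
  assumes fin: "finite (carrier G)" and x: "x \<in> carrier G"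
    and H: "subgroup H G" "\<And>h. h \<in> H \<Longrightarrow> h \<otimes> x = x \<otimes> h"
    and ord: "order G = card H * s ^ d" and s: "prime (s::nat)"
  obtains k where "card (conj_class x) = s ^ k"
proof -
  let ?C = "{g \<in> carrier G. g \<otimes> x \<otimes> inv g = x}"
  have "H \<subseteq> ?C"
  proof
    fix h assume h: "h \<in> H"
    then have hc: "h \<in> carrier G" using subgroup.mem_carrier[OF H(1)] by blast
    have "h \<otimes> x \<otimes> inv h = x \<otimes> h \<otimes> inv h" using H(2)[OF h] by simp
    also have "\<dots> = x" using hc x by (simp add: m_assoc)
    finally show "h \<in> ?C" using hc by simp
  qed
  then have "H \<inter> ?C = H" by blast
  then obtain t where t: "card ?C = card H * t"
    using subgroup_inter_order_dvd[OF H(1) centralizer_subgroup[OF x]] by (auto elim: dvdE)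
  have "card (conj_class x) * (card H * t) = card H * s ^ d" using card_conj_class[OF x] ord t by simp
  then have "card H * (card (conj_class x) * t) = card H * s ^ d" by (simp add: ac_simps)
  moreover have "card H \<noteq> 0" by (rule card_subgroup_pos[OF fin H(1)])
  ultimately have "card (conj_class x) * t = s ^ d" by simp
  then have "card (conj_class x) dvd s ^ d" by (metis dvd_triv_left)
  then show ?thesis using that divides_primepow_nat[OF s] by blast
qed

text \<open>A nontrivial central element \<open>z\<close> of a subgroup of order
  \<open>r ^ c\<close> has a class of \<open>s\<close>-power size. If \<open>z\<close> is central in
  the whole group, the center is nontrivial; otherwise
  \<open>prime_power_class_normal_subgroup\<close> applies.\<close>

lemma (in group) normal_subgroup_or_abelian:
  assumes fin: "finite (carrier G)" and nt: "order G \<noteq> 1"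
    and r: "prime (r::nat)" and s: "prime (s::nat)"
    and ord: "order G = r ^ c * s ^ d" and c: "c > 0"
  shows "(\<forall>x\<in>carrier G. \<forall>y\<in>carrier G. x \<otimes> y = y \<otimes> x) \<or> (\<exists>N. N \<lhd> G \<and> N \<noteq> {\<one>} \<and> N \<noteq> carrier G)"
proof -
  obtain H where H: "subgroup H G" "card H = r ^ c" using sylow_thm[OF r is_group ord fin] by blast
  interpret H: group "G\<lparr>carrier := H\<rparr>" by (rule subgroup_imp_group[OF H(1)])
  obtain z where z: "z \<in> H" "z \<noteq> \<one>" "\<And>h. h \<in> H \<Longrightarrow> h \<otimes> z = z \<otimes> h"
    using H.prime_power_order_center[OF r _ c] H(2) by (auto simp: Coset.order_def)
  have zc: "z \<in> carrier G" using z(1) subgroup.mem_carrier[OF H(1)] by blast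
  obtain k where k: "card (conj_class z) = s ^ k"
    using card_conj_class_prime_power[OF fin zc H(1) z(3) _ s, of d] ord H(2) by auto
  show ?thesis
  proof (cases "\<forall>u\<in>carrier G. u \<otimes> z = z \<otimes> u")
    case True
    let ?Z = "{z \<in> carrier G. \<forall>g\<in>carrier G. g \<otimes> z = z \<otimes> g}"
    have "?Z \<noteq> {\<one>}" using True zc z(2) by blast
    then show ?thesis
    proof (cases "?Z = carrier G")
      case True
      then have "\<forall>x\<in>carrier G. \<forall>y\<in>carrier G. x \<otimes> y = y \<otimes> x" by blast
      then show ?thesis by blast
    next
      case False
      then show ?thesis using center_normal \<open>?Z \<noteq> {\<one>}\<close> by blast
    qed
  next
    case False
    then obtain u where u: "u \<in> carrier G" "z \<otimes> u \<noteq> u \<otimes> z" by metis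
    then show ?thesis using prime_power_class_normal_subgroup[OF fin zc u s k] by metis
  qed
qed

lemma dvd_prime_powers_nat:
  assumes "prime (p::nat)" "prime (q::nat)" "d dvd p ^ a * q ^ b"
  obtains i j where "d = p ^ i * q ^ j"
proof -
  obtain x y where xy: "d = x * y" "x dvd p ^ a" "y dvd q ^ b" using division_decomp[OF assms(3)] by blast
  obtain i where "x = p ^ i" using xy(2) assms(1) divides_primepow_nat by blast
  moreover obtain j where "y = q ^ j" using xy(3) assms(2) divides_primepow_nat by blast
  ultimately show ?thesis using that xy(1) by blast
qed

text \<open>Zero exponents are allowed, so subgroups and quotients keep the shape of the order and
  both fall under the induction hypothesis.\<close>

lemma burnside_two_primes_nat:
  fixes G :: "nat monoid"
  assumes "group G" "finite (carrier G)" "order G = p ^ a * q ^ b"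
    and p: "prime (p::nat)" and q: "prime (q::nat)"
  shows "solvable G"
  using assms(1-3)
proof (induction "order G" arbitrary: G a b rule: less_induct)
  case less
  interpret group G by fact
  note fin = less.prems(2)
  show ?case
  proof (cases "\<exists>N. N \<lhd> G \<and> N \<noteq> {\<one>\<^bsub>G\<^esub>} \<and> N \<noteq> carrier G")
    case True
    then obtain N where N: "N \<lhd> G" "N \<noteq> {\<one>\<^bsub>G\<^esub>}" "N \<noteq> carrier G" by blast
    have NS: "subgroup N G" using N(1) normal_imp_subgroup by blast
    have Nc: "N \<subseteq> carrier G" by (rule subgroup.subset[OF NS])
    obtain Q :: "nat monoid" and h where h: "group_hom G Q h" "h ` carrier G = carrier Q" "kernel G Q h = N"
      using quotient_on_nat[OF fin N(1)] .
    interpret h: group_hom G Q h by fact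
    have ordQ: "order Q * card N = order G" using h.order_image_kernel[OF fin h(2)] h(3) by simp
    have N1: "card N > 1"
    proof -
      have "{\<one>\<^bsub>G\<^esub>} \<subset> N" using N(2) subgroup.one_closed[OF NS] by blast
      then have "card {\<one>\<^bsub>G\<^esub>} < card N" using finite_subset[OF Nc fin] psubset_card_mono by blast
      then show ?thesis by simp
    qed
    have N2: "card N < order G" using N(3) Nc fin by (simp add: Coset.order_def psubset_card_mono psubset_eq)
    have "order Q > 0" using ordQ N2 by (metis gr0I less_nat_zero_code mult_zero_left)
    then have Q2: "order Q < order G" using ordQ N1 by (metis mult.right_neutral mult_less_cancel1)
    have "card N dvd p ^ a * q ^ b" "order Q dvd p ^ a * q ^ b" using ordQ less.prems(3) by (metis dvd_triv_left dvd_triv_right)+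
    then obtain i j i' j' where ij: "card N = p ^ i * q ^ j" "order Q = p ^ i' * q ^ j'"
      using dvd_prime_powers_nat[OF p q] by metis
    have "solvable (G\<lparr>carrier := N\<rparr>)"
      using less.hyps[of "G\<lparr>carrier := N\<rparr>" i j] N2 ij(1) subgroup_imp_group[OF NS] finite_subset[OF Nc fin]
      by (simp add: Coset.order_def)
    then have "solvable_seq G N" using solvable_seq_iff_solvable[OF NS] by simp
    moreover have "finite (carrier Q)" using fin h(2) by (metis finite_imageI)
    then have "solvable Q" using less.hyps[of Q i' j'] Q2 ij(2) h.H.is_group by simp
    ultimately show ?thesis using solvable_extension[OF h(1), of N] h(2,3) by (simp add: solvable_def)
  next
    case False
    have "\<forall>x\<in>carrier G. \<forall>y\<in>carrier G. x \<otimes>\<^bsub>G\<^esub> y = y \<otimes>\<^bsub>G\<^esub> x"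
    proof (cases "order G = 1")
      case True
      then obtain e where "carrier G = {e}" by (metis Coset.order_def card_1_singletonE)
      then show ?thesis by simp
    next
      case nt: False
      \<comment> \<open>The prime that supplies the central element needs a positive exponent; the
        two primes are exchanged if necessary.\<close>
      then consider "a > 0" | "b > 0" using less.prems(3) by (cases a; cases b) auto
      then show ?thesis
      proof cases
        case 1
        then show ?thesis using normal_subgroup_or_abelian[OF fin nt p q less.prems(3)] False by blast
      next
        case 2
        then show ?thesis using normal_subgroup_or_abelian[OF fin nt q p, of b a] less.prems(3) False
          by (simp add: mult.commute)
      qed
    qed
    then show ?thesis using comm_imp_solvable by blast
  qed
qed

text \<open>A normal \<open>p\<close>-subgroup \<open>M\<close> of \<open>H\<close> lies in every subgroup \<open>K\<close> whose index is prime to \<open>p\<close> and to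
  the index of \<open>H\<close>; since then \<open>G = KH\<close>, so does the normal closure of \<open>M\<close>.\<close>
lemma (in group) normal_closure_in_coprime_index:
  assumes fin: "finite (carrier G)" and H: "subgroup H G" and K: "subgroup K G"
    and cop: "coprime (card (rcosets H)) (card (rcosets K))"
    and M: "M \<lhd> G\<lparr>carrier := H\<rparr>" "card M = p ^ j" "M \<noteq> {\<one>}" and p: "prime (p::nat)"
    and ndvd: "\<not> p dvd card (rcosets K)"
  obtains N where "N \<lhd> G" "N \<noteq> {\<one>}" "N \<subseteq> K"
proof -
  interpret HG: group "G\<lparr>carrier := H\<rparr>" by (rule subgroup_imp_group[OF H])
  have MH: "subgroup M (G\<lparr>carrier := H\<rparr>)" using M(1) normal_imp_subgroup by blast
  have MS: "subgroup M G" by (rule incl_subgroup[OF H MH])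
  have Hc: "h \<in> carrier G" if "h \<in> H" for h using that subgroup.mem_carrier[OF H] by blast
  have Kc: "k \<in> carrier G" if "k \<in> K" for k using that subgroup.mem_carrier[OF K] by blast
  have Mc: "m \<in> carrier G" if "m \<in> M" for m using that subgroup.mem_carrier[OF MS] by blast
  have Mconj: "h \<otimes> m \<otimes> inv h \<in> M" if "h \<in> H" "m \<in> M" for h m
    using HG.normal_invE(2)[OF M(1), of h m] that m_inv_consistent[OF H that(1)] by simp
  obtain a where a: "a \<in> carrier G" "\<And>m. m \<in> M \<Longrightarrow> a \<otimes> m \<otimes> inv a \<in> K"
    using prime_power_subgroup_conj[OF fin MS M(2) p K ndvd] by blast
  obtain k0 h0 where kh: "k0 \<in> K" "h0 \<in> H" "a = k0 \<otimes> h0"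
    using coprime_index_product[OF fin H K cop a(1)] .
  have conj_prod: "(k \<otimes> h) \<otimes> m \<otimes> inv (k \<otimes> h) = k \<otimes> (h \<otimes> m \<otimes> inv h) \<otimes> inv k"
    if "k \<in> K" "h \<in> H" "m \<in> carrier G" for k h m
    using that Hc Kc by (simp add: m_assoc inv_mult_group)
  have MK: "m \<in> K" if m: "m \<in> M" for m
  proof -
    define m' where "m' = inv h0 \<otimes> m \<otimes> h0"
    have m': "m' \<in> M" using Mconj[OF subgroup.m_inv_closed[OF H kh(2)] m] Hc[OF kh(2)] by (simp add: m'_def)
    have "h0 \<otimes> m' \<otimes> inv h0 = m" using Hc[OF kh(2)] Mc[OF m] by (simp add: m'_def conjugation_is_surj)
    then have "a \<otimes> m' \<otimes> inv a = k0 \<otimes> m \<otimes> inv k0" using conj_prod[OF kh(1,2) Mc[OF m']] kh(3) by simp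
    then have "k0 \<otimes> m \<otimes> inv k0 \<in> K" using a(2)[OF m'] by simp
    then have "inv k0 \<otimes> (k0 \<otimes> m \<otimes> inv k0) \<otimes> k0 \<in> K"
      using kh(1) subgroup.m_closed[OF K] subgroup.m_inv_closed[OF K] by blast
    moreover have "inv k0 \<otimes> (k0 \<otimes> m \<otimes> inv k0) \<otimes> k0 = m"
      using conjugation_is_surj[of "inv k0" m] Kc[OF kh(1)] Mc[OF m] by simp
    ultimately show ?thesis by simp
  qed
  define S where "S = {g \<otimes> m \<otimes> inv g |g m. g \<in> carrier G \<and> m \<in> M}"
  have Sc: "S \<subseteq> carrier G" using Mc by (auto simp: S_def)
  have SK: "S \<subseteq> K"
  proof
    fix y assume "y \<in> S"
    then obtain g m where gm: "g \<in> carrier G" "m \<in> M" "y = g \<otimes> m \<otimes> inv g" by (auto simp: S_def)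
    obtain k h where kh: "k \<in> K" "h \<in> H" "g = k \<otimes> h" using coprime_index_product[OF fin H K cop gm(1)] .
    have "y = k \<otimes> (h \<otimes> m \<otimes> inv h) \<otimes> inv k" using conj_prod[OF kh(1,2) Mc[OF gm(2)]] kh(3) gm(3) by simp
    moreover have "h \<otimes> m \<otimes> inv h \<in> K" using MK[OF Mconj[OF kh(2) gm(2)]] .
    ultimately show "y \<in> K" using kh(1) subgroup.m_closed[OF K] subgroup.m_inv_closed[OF K] by simp
  qed
  have "generate G S \<lhd> G"
  proof (rule normal_generateI[OF Sc])
    fix h g assume h: "h \<in> S" and g: "g \<in> carrier G"
    obtain u m where um: "u \<in> carrier G" "m \<in> M" "h = u \<otimes> m \<otimes> inv u" using h by (auto simp: S_def)
    have "g \<otimes> h \<otimes> inv g = (g \<otimes> u) \<otimes> m \<otimes> inv (g \<otimes> u)"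
      using um g Mc[OF um(2)] by (simp add: m_assoc inv_mult_group)
    then show "g \<otimes> h \<otimes> inv g \<in> S" using um g unfolding S_def by blast
  qed
  moreover have "generate G S \<subseteq> K" by (rule generate_subgroup_incl[OF SK K])
  moreover have "M \<subseteq> generate G S"
  proof
    fix m assume m: "m \<in> M"
    have "m = \<one> \<otimes> m \<otimes> inv \<one>" using Mc[OF m] by simp
    then have "m \<in> S" using m unfolding S_def by blast
    then show "m \<in> generate G S" by (rule generate.incl)
  qed
  moreover have "\<one> \<in> M" by (rule subgroup.one_closed[OF MS])
  ultimately show ?thesis using that M(3) by (metis singletonD subsetI subset_singletonD empty_iff)
qed

text \<open>\<open>H\<close> has a nontrivial normal \<open>p\<close>-subgroup for some prime
  \<open>p\<close>, and \<open>p\<close> divides at most one of the coprime indices of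
  \<open>K\<close> and \<open>L\<close>. The other of these two subgroups then contains a normal
  subgroup of the whole group, which is solvable, and the quotient inherits the hypotheses.\<close>

lemma wielandt_coprime_indices_nat:
  fixes G :: "nat monoid"
  assumes "group G" "finite (carrier G)"
    and "solvable_seq G H" "solvable_seq G K" "solvable_seq G L"
    and "coprime (card (rcosets\<^bsub>G\<^esub> H)) (card (rcosets\<^bsub>G\<^esub> K))"
    and "coprime (card (rcosets\<^bsub>G\<^esub> H)) (card (rcosets\<^bsub>G\<^esub> L))"
    and "coprime (card (rcosets\<^bsub>G\<^esub> K)) (card (rcosets\<^bsub>G\<^esub> L))"
  shows "solvable G"
  using assms
proof (induction "order G" arbitrary: G H K L rule: less_induct)
  case less
  interpret group G by fact
  note fin = less.prems(2)
  have H: "subgroup H G" and K: "subgroup K G" and L: "subgroup L G"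
    using less.prems(3-5) solvable_imp_subgroup by auto
  show ?case
  proof (cases "H = {\<one>\<^bsub>G\<^esub>}")
    \<comment> \<open>The index of a trivial \<open>H\<close> is the group order, which the index of
      \<open>K\<close> divides; coprimality forces \<open>K\<close> to be everything.\<close>
    case True
    have "card (rcosets\<^bsub>G\<^esub> H) = order G" using lagrange[OF H] True by simp
    moreover have "card (rcosets\<^bsub>G\<^esub> K) dvd order G" using lagrange[OF K] by (metis dvd_triv_left)
    ultimately have "card (rcosets\<^bsub>G\<^esub> K) = 1"
      using less.prems(6) by (metis coprime_common_divisor dvd_refl nat_dvd_1_iff_1)
    then have "card K = card (carrier G)" using lagrange[OF K] by (simp add: Coset.order_def)
    then have "K = carrier G" using subgroup.subset[OF K] fin card_subset_eq by blast
    then show ?thesis using less.prems(4) by (simp add: solvable_def)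
  next
    case False
    interpret HG: group "G\<lparr>carrier := H\<rparr>" by (rule subgroup_imp_group[OF H])
    have solvH: "solvable (G\<lparr>carrier := H\<rparr>)" using solvable_seq_iff_solvable[OF H] less.prems(3) by simp
    have finH: "finite (carrier (G\<lparr>carrier := H\<rparr>))" using fin subgroup.subset[OF H] finite_subset by auto
    have "carrier (G\<lparr>carrier := H\<rparr>) \<noteq> {\<one>\<^bsub>G\<lparr>carrier := H\<rparr>\<^esub>}" using False by simp
    from HG.solvable_normal_prime_power_subgroup[OF finH solvH this]
    obtain M p k where M: "prime (p::nat)" "M \<lhd> G\<lparr>carrier := H\<rparr>" "card M = p ^ k" "M \<noteq> {\<one>\<^bsub>G\<^esub>}"
      by (simp, metis)
    have "\<not> (p dvd card (rcosets\<^bsub>G\<^esub> K) \<and> p dvd card (rcosets\<^bsub>G\<^esub> L))"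
      using less.prems(8) M(1) coprime_common_divisor not_prime_unit by blast
    then obtain N where N: "N \<lhd> G" "N \<noteq> {\<one>\<^bsub>G\<^esub>}" "N \<subseteq> K \<or> N \<subseteq> L"
      using normal_closure_in_coprime_index[OF fin H K less.prems(6) M(2-4) M(1)]
        normal_closure_in_coprime_index[OF fin H L less.prems(7) M(2-4) M(1)] by metis
    have NS: "subgroup N G" using N(1) normal_imp_subgroup by blast
    have solvN: "solvable_seq G N" using N(3) solvable_seq_mono[OF _ NS] less.prems(4,5) by blast
    obtain Q :: "nat monoid" and h where h: "group_hom G Q h" "h ` carrier G = carrier Q" "kernel G Q h = N"
      using quotient_on_nat[OF fin N(1)] .
    interpret h: group_hom G Q h by fact
    have ordQ: "order Q * card N = order G" using h.order_image_kernel[OF fin h(2)] h(3) by simp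
    have "{\<one>\<^bsub>G\<^esub>} \<subset> N" using N(2) subgroup.one_closed[OF NS] by blast
    then have "card {\<one>\<^bsub>G\<^esub>} < card N" using finite_subset[OF subgroup.subset[OF NS] fin] psubset_card_mono by blast
    then have N1: "card N > 1" by simp
    have finQ: "finite (carrier Q)" using fin h(2) by (metis finite_imageI)
    then have "order Q > 0" using h.H.order_gt_0_iff_finite by blast
    then have Q2: "order Q < order G" using ordQ N1 by (metis mult.right_neutral mult_less_cancel1)
    note dv = h.index_image_dvd[OF fin h(2)]
    have "solvable Q"
    proof (rule less.hyps[OF Q2 h.H.is_group finQ])
      show "solvable_seq Q (h ` H)" "solvable_seq Q (h ` K)" "solvable_seq Q (h ` L)"
        using h.solvable_imp_solvable_img less.prems(3-5) by auto
    qed (use less.prems(6-8) dv[OF H] dv[OF K] dv[OF L] in \<open>auto intro: coprime_divisors\<close>)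
    then show ?thesis using solvable_extension[OF h(1) solvN] h(2,3) by (simp add: solvable_def)
  qed
qed

text \<open>The quotient by the trivial subgroup is a copy of the group over \<open>nat\<close>,
  where the induction took place.\<close>

theorem (in group) wielandt_coprime_indices:
  assumes fin: "finite (carrier G)"
    and solv: "solvable_seq G H" "solvable_seq G K" "solvable_seq G L"
    and cop: "coprime (card (rcosets H)) (card (rcosets K))"
      "coprime (card (rcosets H)) (card (rcosets L))"
      "coprime (card (rcosets K)) (card (rcosets L))"
  shows "solvable G"
proof -
  obtain Q :: "nat monoid" and h where h: "group_hom G Q h" "h ` carrier G = carrier Q" "kernel G Q h = {\<one>}"
    using quotient_on_nat[OF fin one_is_normal] .
  interpret h: group_hom G Q h by fact
  note dv = h.index_image_dvd[OF fin h(2) solvable_imp_subgroup]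
  have "solvable Q"
  proof (rule wielandt_coprime_indices_nat[OF h.H.is_group])
    show "finite (carrier Q)" using fin h(2) by (metis finite_imageI)
    show "solvable_seq Q (h ` H)" "solvable_seq Q (h ` K)" "solvable_seq Q (h ` L)"
      using h.solvable_imp_solvable_img solv by auto
  qed (use cop dv[OF solv(1)] dv[OF solv(2)] dv[OF solv(3)] in \<open>auto intro: coprime_divisors\<close>)
  then show ?thesis using solvable_extension[OF h(1) solvable_seq.unity] h(2,3) by (simp add: solvable_def)
qed

theorem (in group) burnside_two_primes:
  assumes fin: "finite (carrier G)" and ord: "order G = p ^ a * q ^ b"
    and pq: "prime (p::nat)" "prime (q::nat)"
  shows "solvable G"
proof -
  obtain Q :: "nat monoid" and h where h: "group_hom G Q h" "h ` carrier G = carrier Q" "kernel G Q h = {\<one>}"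
    using quotient_on_nat[OF fin one_is_normal] .
  interpret h: group_hom G Q h by fact
  have "order Q = p ^ a * q ^ b" using h.order_image_kernel[OF fin h(2)] h(3) ord by simp
  moreover have "finite (carrier Q)" using fin h(2) by (metis finite_imageI)
  ultimately have "solvable Q" using burnside_two_primes_nat[OF h.H.is_group _ _ pq] by blast
  then show ?thesis using solvable_extension[OF h(1) solvable_seq.unity] h(2,3) by (simp add: solvable_def)
qed

subsection \<open>Skew braces\<close>

lemma nat_two_or_three_prime_factors:
  fixes n :: nat
  assumes n: "n \<noteq> 0"
  obtains (three) p q r where "prime p" "prime q" "prime r"
      "p dvd n" "q dvd n" "r dvd n" "p \<noteq> q" "p \<noteq> r" "q \<noteq> r"
  | (two) p q a b where "prime p" "prime q" "n = p ^ a * q ^ b"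
proof (cases "\<exists>p q. prime p \<and> prime q \<and> p \<noteq> q \<and> prime_factors n \<subseteq> {p, q}")
  case True
  then obtain p q where pq: "prime p" "prime q" "p \<noteq> q" "prime_factors n \<subseteq> {p, q}" by blast
  have "n = (\<Prod>x\<in>prime_factors n. x ^ multiplicity x n)" using prod_prime_factors[OF n] by simp
  also have "\<dots> = (\<Prod>x\<in>{p, q}. x ^ multiplicity x n)"
  proof (rule prod.mono_neutral_left)
    show "\<forall>i\<in>{p, q} - prime_factors n. i ^ multiplicity i n = 1"
      using pq(1,2) n by (auto simp: in_prime_factors_iff not_dvd_imp_multiplicity_0)
  qed (use pq(4) in auto)
  also have "\<dots> = p ^ multiplicity p n * q ^ multiplicity q n" using pq(3) by simp
  finally show ?thesis using two[OF pq(1,2)] by blast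
next
  case False
  have p2: "prime (2::nat)" and p3: "prime (3::nat)" by simp_all
  \<comment> \<open>The negated assumption speaks about pairs of distinct primes, so the search
    starts from 2 and 3; choosing \<open>p\<close> different from 2 makes \<open>p\<close> and 2 the
    next admissible pair.\<close>
  have "\<not> prime_factors n \<subseteq> {2, 3}" using False p2 p3 by (metis numeral_eq_iff semiring_norm(89))
  then obtain p where p: "p \<in> prime_factors n" "p \<noteq> 2" by blast
  have pp: "prime p" using p by auto
  have "\<not> prime_factors n \<subseteq> {p, 2}" using False pp p2 p(2) by metis
  then obtain q where q: "q \<in> prime_factors n" "q \<noteq> p" by blast
  have qp: "prime q" using q by auto
  have "\<not> prime_factors n \<subseteq> {p, q}" using False pp qp q(2) by metis
  then obtain r where r: "r \<in> prime_factors n" "r \<noteq> p" "r \<noteq> q" by blast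
  show ?thesis by (rule three[of p q r]) (use p q r in auto)
qed

section \<open>Groups of class at most two and their elements of order prime to
  \<open>p\<close>\<close>

context group
begin

text \<open>A central commutator \<open>c\<close> satisfies
  \<open>y \<otimes> x = x \<otimes> y \<otimes> c\<close>, so collecting factors only produces
  powers of \<open>c\<close>. The exponent \<open>j\<close> comes out as the sum of the numbers
  below \<open>n\<close>, but existence is enough.\<close>

lemma class_two_mult_pow:
  assumes central: "\<And>x y z. x \<in> carrier G \<Longrightarrow> y \<in> carrier G \<Longrightarrow> z \<in> carrier G \<Longrightarrow>
      z \<otimes> (x \<otimes> y \<otimes> inv x \<otimes> inv y) = (x \<otimes> y \<otimes> inv x \<otimes> inv y) \<otimes> z"
    and x: "x \<in> carrier G" and y: "y \<in> carrier G"
  obtains c where "c \<in> carrier G" "\<And>n::nat. y [^] n \<otimes> x = x \<otimes> y [^] n \<otimes> c [^] n"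
    "\<And>n::nat. \<exists>j::nat. (x \<otimes> y) [^] n = x [^] n \<otimes> y [^] n \<otimes> c [^] j"
proof -
  define c where "c = inv y \<otimes> inv x \<otimes> y \<otimes> x"
  have c: "c \<in> carrier G" using x y by (simp add: c_def)
  have cz: "z \<otimes> c = c \<otimes> z" if "z \<in> carrier G" for z
    using central[of "inv y" "inv x" z] x y that by (simp add: c_def)
  have cnz: "c [^] i \<otimes> z = z \<otimes> c [^] i" if z: "z \<in> carrier G" for z and i :: nat
  proof (induction i)
    case (Suc i)
    have "c [^] Suc i \<otimes> z = c [^] i \<otimes> (c \<otimes> z)" using c z by (simp add: m_assoc)
    also have "\<dots> = c [^] i \<otimes> z \<otimes> c" unfolding cz[OF z, symmetric] using c z by (simp add: m_assoc)
    also have "\<dots> = z \<otimes> c [^] Suc i" unfolding Suc using c z by (simp add: m_assoc)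
    finally show ?case .
  qed (use z in simp)
  have yx: "y \<otimes> x = x \<otimes> y \<otimes> c"
  proof -
    have "x \<otimes> y \<otimes> c = x \<otimes> (y \<otimes> inv y) \<otimes> inv x \<otimes> y \<otimes> x" unfolding c_def using x y by (simp only: m_assoc m_closed inv_closed)
    also have "\<dots> = y \<otimes> x" using x y by simp
    finally show ?thesis by simp
  qed
  have 1: "y [^] n \<otimes> x = x \<otimes> y [^] n \<otimes> c [^] n" for n :: nat
  proof (induction n)
    case (Suc n)
    have "y [^] Suc n \<otimes> x = y [^] n \<otimes> (y \<otimes> x)" using x y by (simp add: m_assoc)
    also have "\<dots> = (y [^] n \<otimes> x) \<otimes> y \<otimes> c" unfolding yx using x y c by (simp add: m_assoc)
    also have "\<dots> = x \<otimes> y [^] n \<otimes> (c [^] n \<otimes> y) \<otimes> c" unfolding Suc using x y c by (simp add: m_assoc)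
    also have "\<dots> = x \<otimes> y [^] Suc n \<otimes> c [^] Suc n" unfolding cnz[OF y] using x y c by (simp add: m_assoc)
    finally show ?case .
  qed (use x in simp)
  have 2: "\<exists>j::nat. (x \<otimes> y) [^] n = x [^] n \<otimes> y [^] n \<otimes> c [^] j" for n :: nat
  proof (induction n)
    case 0
    show ?case by (rule exI[of _ 0]) simp
  next
    case (Suc n)
    then obtain j :: nat where j: "(x \<otimes> y) [^] n = x [^] n \<otimes> y [^] n \<otimes> c [^] j" by blast
    have "(x \<otimes> y) [^] Suc n = x [^] n \<otimes> y [^] n \<otimes> (c [^] j \<otimes> (x \<otimes> y))" using j x y c by (simp add: m_assoc)
    also have "\<dots> = x [^] n \<otimes> (y [^] n \<otimes> x) \<otimes> y \<otimes> c [^] j"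
      unfolding cnz[OF m_closed[OF x y]] using x y c by (simp add: m_assoc)
    also have "\<dots> = x [^] Suc n \<otimes> y [^] n \<otimes> (c [^] n \<otimes> y) \<otimes> c [^] j" unfolding 1 using x y c by (simp add: m_assoc)
    also have "\<dots> = x [^] Suc n \<otimes> y [^] Suc n \<otimes> c [^] (n + j)"
      unfolding cnz[OF y] nat_pow_mult[OF c, symmetric] using x y c by (simp add: m_assoc)
    finally show ?case by blast
  qed
  show ?thesis by (rule that[OF c 1 2])
qed

definition prime_to_part :: "nat \<Rightarrow> 'a set" where
  "prime_to_part p = {x \<in> carrier G. \<exists>k::nat. \<not> p dvd k \<and> x [^] k = \<one>}"

text \<open>If \<open>y [^] l = \<one>\<close>, moving \<open>x\<close> past \<open>y [^] l\<close>
  shows \<open>c [^] l = \<one>\<close>. The power \<open>k * l\<close> of the product is then a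
  power of \<open>c\<close>, which one more exponent \<open>l\<close> kills, and
  \<open>k * l * l\<close> is prime to \<open>p\<close>.\<close>

lemma prime_to_part_subgroup:
  assumes central: "\<And>x y z. x \<in> carrier G \<Longrightarrow> y \<in> carrier G \<Longrightarrow> z \<in> carrier G \<Longrightarrow>
      z \<otimes> (x \<otimes> y \<otimes> inv x \<otimes> inv y) = (x \<otimes> y \<otimes> inv x \<otimes> inv y) \<otimes> z"
    and p: "prime p"
  shows "subgroup (prime_to_part p) G"
proof (rule subgroupI)
  show "prime_to_part p \<subseteq> carrier G" by (auto simp: prime_to_part_def)
  have "\<not> p dvd 1" using p not_prime_unit by blast
  then have "\<one> \<in> prime_to_part p" unfolding prime_to_part_def by (intro CollectI conjI exI[of _ 1]) auto
  then show "prime_to_part p \<noteq> {}" by blast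
  show "inv a \<in> prime_to_part p" if "a \<in> prime_to_part p" for a
    using that by (auto simp: prime_to_part_def nat_pow_inv)
  fix x y assume "x \<in> prime_to_part p" "y \<in> prime_to_part p"
  then obtain k l where x: "x \<in> carrier G" "\<not> p dvd k" "x [^] (k::nat) = \<one>"
    and y: "y \<in> carrier G" "\<not> p dvd l" "y [^] (l::nat) = \<one>" by (auto simp: prime_to_part_def)
  obtain c where c: "c \<in> carrier G" "\<And>n::nat. y [^] n \<otimes> x = x \<otimes> y [^] n \<otimes> c [^] n"
    "\<And>n::nat. \<exists>j::nat. (x \<otimes> y) [^] n = x [^] n \<otimes> y [^] n \<otimes> c [^] j"
    by (rule class_two_mult_pow[OF central x(1) y(1)]) blast+
  have "x = x \<otimes> c [^] l" using c(2)[of l] x(1) y c(1) by simp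
  then have cl: "c [^] l = \<one>" using x(1) c(1) by (metis l_cancel_one' nat_pow_closed)
  obtain j :: nat where j: "(x \<otimes> y) [^] (k * l) = x [^] (k * l) \<otimes> y [^] (k * l) \<otimes> c [^] j" using c(3) by blast
  have "x [^] (k * l) = \<one>" using nat_pow_pow[OF x(1), of k l] x(3) by simp
  moreover have "y [^] (k * l) = \<one>" using nat_pow_pow[OF y(1), of l k] y(3) by (simp add: mult.commute)
  ultimately have "(x \<otimes> y) [^] (k * l) = c [^] j" using j c(1) by simp
  then have "(x \<otimes> y) [^] (k * l * l) = (c [^] j) [^] l" using nat_pow_pow[of "x \<otimes> y" "k * l" l] x(1) y(1) by simp
  also have "\<dots> = (c [^] l) [^] j" using nat_pow_pow[OF c(1)] by (simp add: mult.commute)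
  also have "\<dots> = \<one>" using cl by simp
  finally have "(x \<otimes> y) [^] (k * l * l) = \<one>" .
  moreover have "\<not> p dvd k * l * l" using x(2) y(2) p by (simp add: prime_dvd_mult_iff)
  ultimately show "x \<otimes> y \<in> prime_to_part p" using x(1) y(1) by (auto simp: prime_to_part_def)
qed

text \<open>A Sylow subgroup for another prime \<open>q\<close> lies inside, so the full power of
  \<open>q\<close> is absorbed by the order of the part. The index is an abstract cofactor
  \<open>i\<close> because it will be counted in the multiplicative group, while the part is taken
  in the additive one.\<close>

lemma prime_to_part_index:
  assumes fin: "finite (carrier G)" and p: "prime p" and T: "subgroup (prime_to_part p) G"
    and i: "i * card (prime_to_part p) = order G"
  shows "\<exists>k. i = p ^ k"
proof -
  have pos: "order G \<noteq> 0" using fin order_gt_0_iff_finite by simp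
  have i0: "i \<noteq> 0" using i pos by (metis mult_0)
  have qp: "q = p" if q: "prime q" "q dvd i" for q
  proof (rule ccontr)
    assume "q \<noteq> p"
    define b where "b = multiplicity q (order G)"
    obtain m where m: "order G = q ^ b * m" using multiplicity_dvd[of q "order G"] by (auto simp: b_def elim: dvdE)
    obtain H where H: "subgroup H G" "card H = q ^ b" using sylow_thm[OF q(1) is_group m fin] by blast
    interpret HG: group "G\<lparr>carrier := H\<rparr>" by (rule subgroup_imp_group[OF H(1)])
    have "H \<subseteq> prime_to_part p"
    proof
      fix x assume x: "x \<in> H"
      have "x [^]\<^bsub>G\<lparr>carrier := H\<rparr>\<^esub> (q ^ b) = \<one>"
        using HG.pow_order_eq_1[of x] x H(2) by (simp add: Coset.order_def)
      then have "x [^] (q ^ b) = \<one>" using nat_pow_consistent by metis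
      moreover have "\<not> p dvd q ^ b"
        using p q(1) \<open>q \<noteq> p\<close> prime_dvd_power primes_dvd_imp_eq by blast
      ultimately show "x \<in> prime_to_part p" using x subgroup.mem_carrier[OF H(1)] by (auto simp: prime_to_part_def)
    qed
    then have "H \<inter> prime_to_part p = H" by blast
    then obtain u where "card (prime_to_part p) = q ^ b * u"
      using subgroup_inter_order_dvd[OF H(1) T] H(2) by (auto elim: dvdE)
    moreover obtain v where "i = q * v" using q(2) by (auto elim: dvdE)
    ultimately have "order G = (q * v) * (q ^ b * u)" using i by simp
    then have "order G = q ^ Suc b * (v * u)" by (simp add: ac_simps)
    then have "q ^ Suc b dvd order G" by simp
    then have "Suc b \<le> b" unfolding b_def using multiplicity_geI[of "order G" q] pos q(1) not_prime_unit by blast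
    then show False by simp
  qed
  show ?thesis using prime_power_if_single_prime_factor[OF i0 qp] by blast
qed

text \<open>An element of order \<open>p\<close>, supplied by Cauchy, is missing; this makes the
  later induction descend.\<close>

lemma prime_to_part_proper:
  assumes fin: "finite (carrier G)" and p: "prime p" "p dvd order G"
  shows "prime_to_part p \<subset> carrier G"
proof -
  obtain x where x: "x \<in> carrier G" "x \<noteq> \<one>" "x [^] p = \<one>" using cauchy_prime_order[OF fin p] .
  have "x \<notin> prime_to_part p"
  proof
    assume "x \<in> prime_to_part p"
    then obtain k where k: "\<not> p dvd k" "x [^] (k::nat) = \<one>" by (auto simp: prime_to_part_def)
    have "ord x dvd p" "ord x dvd k" using x k pow_eq_id by auto
    moreover have "coprime p k" using p(1) k(1) by (rule prime_imp_coprime)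
    ultimately have "ord x = 1" using coprime_common_divisor[of p k "ord x"] by simp
    then show False using x ord_eq_1 by simp
  qed
  then show ?thesis using x(1) by (auto simp: prime_to_part_def)
qed

end

section \<open>Skew braces, the lambda action and left ideals\<close>

locale skew_brace_pair = A: group Add + M: group Mul
  for Add :: "('a, 'b) monoid_scheme" and Mul :: "('a, 'c) monoid_scheme" +
  assumes brace: "skew_brace Add Mul"
begin

abbreviation add (infixl "\<boxplus>" 65) where "x \<boxplus> y \<equiv> x \<otimes>\<^bsub>Add\<^esub> y"
abbreviation mul (infixl "\<boxdot>" 70) where "x \<boxdot> y \<equiv> x \<otimes>\<^bsub>Mul\<^esub> y"
abbreviation neg ("\<boxminus> _" [81] 80) where "\<boxminus> x \<equiv> inv\<^bsub>Add\<^esub> x"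

lemma carrier_Mul: "carrier Mul = carrier Add" using brace by (simp add: skew_brace_def)

lemma mul_closed [simp]: "a \<in> carrier Add \<Longrightarrow> b \<in> carrier Add \<Longrightarrow> a \<boxdot> b \<in> carrier Add"
  using M.m_closed[of a b] by (simp add: carrier_Mul)

lemma inv_Mul_closed [simp]: "a \<in> carrier Add \<Longrightarrow> inv\<^bsub>Mul\<^esub> a \<in> carrier Add"
  using M.inv_closed[of a] by (simp add: carrier_Mul)

lemma distrib:
  "a \<in> carrier Add \<Longrightarrow> b \<in> carrier Add \<Longrightarrow> c \<in> carrier Add \<Longrightarrow> a \<boxdot> (b \<boxplus> c) = (a \<boxdot> b) \<boxplus> \<boxminus> a \<boxplus> (a \<boxdot> c)"
  using brace by (simp add: skew_brace_def)

definition lam :: "'a \<Rightarrow> 'a \<Rightarrow> 'a" where "lam a b = \<boxminus> a \<boxplus> (a \<boxdot> b)"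

lemma lam_closed [simp]: "a \<in> carrier Add \<Longrightarrow> b \<in> carrier Add \<Longrightarrow> lam a b \<in> carrier Add"
  by (simp add: lam_def)

lemma mul_eq_add_lam: "a \<in> carrier Add \<Longrightarrow> b \<in> carrier Add \<Longrightarrow> a \<boxdot> b = a \<boxplus> lam a b"
  by (simp add: lam_def flip: A.m_assoc)

lemma one_Mul: "\<one>\<^bsub>Mul\<^esub> = \<one>\<^bsub>Add\<^esub>"
proof -
  let ?e = "\<one>\<^bsub>Mul\<^esub>"
  have e: "?e \<in> carrier Add" using M.one_closed by (simp add: carrier_Mul)
  have l: "?e \<boxdot> a = a" if "a \<in> carrier Add" for a using M.l_one[of a] that by (simp add: carrier_Mul)
  \<comment> \<open>The brace law at the multiplicative identity, applied to two additive zeros,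
    leaves only the additive inverse of that identity.\<close>
  have "?e \<boxdot> (\<one>\<^bsub>Add\<^esub> \<boxplus> \<one>\<^bsub>Add\<^esub>) = (?e \<boxdot> \<one>\<^bsub>Add\<^esub>) \<boxplus> \<boxminus> ?e \<boxplus> (?e \<boxdot> \<one>\<^bsub>Add\<^esub>)" using e by (intro distrib) auto
  then have "\<one>\<^bsub>Add\<^esub> = \<boxminus> ?e" using e by (simp add: l)
  then show ?thesis using e by (metis A.inv_inv A.inv_one)
qed

lemma lam_add: "a \<in> carrier Add \<Longrightarrow> b \<in> carrier Add \<Longrightarrow> c \<in> carrier Add \<Longrightarrow> lam a (b \<boxplus> c) = lam a b \<boxplus> lam a c"
  by (simp add: lam_def distrib A.m_assoc)

lemma lam_hom: "a \<in> carrier Add \<Longrightarrow> group_hom Add Add (lam a)"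
  by (simp add: group_hom_def group_hom_axioms_def A.is_group hom_def lam_add)

text \<open>Associativity of the multiplication, read through the additivity of
  \<open>lam a\<close>: the multiplicative group acts on the additive one by automorphisms.\<close>

lemma lam_mul:
  assumes a: "a \<in> carrier Add" and b: "b \<in> carrier Add" and c: "c \<in> carrier Add"
  shows "lam (a \<boxdot> b) c = lam a (lam b c)"
proof -
  interpret h: group_hom Add Add "lam a" by (rule lam_hom[OF a])
  have "lam a (lam b c) = \<boxminus> lam a b \<boxplus> lam a (b \<boxdot> c)"
    unfolding lam_def[of b c] using a b c by (simp add: h.hom_mult h.hom_inv)
  also have "\<dots> = \<boxminus> (a \<boxdot> b) \<boxplus> (a \<boxplus> \<boxminus> a) \<boxplus> (a \<boxdot> (b \<boxdot> c))"
    unfolding lam_def using a b c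
    by (simp only: A.inv_mult_group A.inv_inv A.m_assoc A.m_closed A.inv_closed mul_closed)
  also have "\<dots> = lam (a \<boxdot> b) c"
    unfolding lam_def using a b c M.m_assoc[of a b c] by (simp add: carrier_Mul)
  finally show ?thesis by simp
qed

lemma lam_one: "b \<in> carrier Add \<Longrightarrow> lam \<one>\<^bsub>Add\<^esub> b = b"
  using M.l_one[of b] by (simp add: lam_def carrier_Mul one_Mul)

lemma lam_inv:
  assumes a: "a \<in> carrier Add" and b: "b \<in> carrier Add"
  shows "lam a (lam (inv\<^bsub>Mul\<^esub> a) b) = b" "lam (inv\<^bsub>Mul\<^esub> a) (lam a b) = b"
proof -
  have 1: "a \<boxdot> inv\<^bsub>Mul\<^esub> a = \<one>\<^bsub>Add\<^esub>" using M.r_inv[of a] a by (simp add: carrier_Mul one_Mul)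
  show "lam a (lam (inv\<^bsub>Mul\<^esub> a) b) = b"
    using lam_mul[of a "inv\<^bsub>Mul\<^esub> a" b] a b by (simp add: 1 lam_one)
  have 2: "inv\<^bsub>Mul\<^esub> a \<boxdot> a = \<one>\<^bsub>Add\<^esub>" using M.l_inv[of a] a by (simp add: carrier_Mul one_Mul)
  show "lam (inv\<^bsub>Mul\<^esub> a) (lam a b) = b"
    using lam_mul[of "inv\<^bsub>Mul\<^esub> a" a b] a b by (simp add: 2 lam_one)
qed

lemma lam_surj:
  assumes a: "a \<in> carrier Add" shows "lam a ` carrier Add = carrier Add"
proof
  show "carrier Add \<subseteq> lam a ` carrier Add"
  proof
    fix b assume b: "b \<in> carrier Add"
    show "b \<in> lam a ` carrier Add"
      by (rule image_eqI[of _ _ "lam (inv\<^bsub>Mul\<^esub> a) b"]) (use a b lam_inv(1) in auto)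
  qed
qed (use a in auto)

text \<open>A product is \<open>a \<boxplus> lam a b\<close>, and the multiplicative inverse of
  \<open>a\<close> is the image of \<open>\<boxminus> a\<close> under its own \<open>lam\<close>, so
  invariance under all \<open>lam a\<close> carries closure over from the additive group.\<close>

lemma left_ideal_subgroup:
  assumes H: "subgroup H Add" and inv: "\<And>a h. a \<in> carrier Add \<Longrightarrow> h \<in> H \<Longrightarrow> lam a h \<in> H"
  shows "subgroup H Mul"
proof (rule M.subgroupI)
  have Hc: "h \<in> carrier Add" if "h \<in> H" for h using that subgroup.mem_carrier[OF H] by blast
  show "H \<subseteq> carrier Mul" using Hc by (auto simp: carrier_Mul)
  show "H \<noteq> {}" using subgroup.one_closed[OF H] by blast
  show "a \<boxdot> b \<in> H" if "a \<in> H" "b \<in> H" for a b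
    using that Hc inv subgroup.m_closed[OF H] by (simp add: mul_eq_add_lam)
  show "inv\<^bsub>Mul\<^esub> a \<in> H" if a: "a \<in> H" for a
  proof -
    have ac: "a \<in> carrier Add" by (rule Hc[OF a])
    have "a \<boxdot> inv\<^bsub>Mul\<^esub> a = \<one>\<^bsub>Add\<^esub>" using M.r_inv[of a] ac by (simp add: carrier_Mul one_Mul)
    then have "lam a (inv\<^bsub>Mul\<^esub> a) = \<boxminus> a" using ac by (simp add: lam_def)
    then have "inv\<^bsub>Mul\<^esub> a = lam (inv\<^bsub>Mul\<^esub> a) (\<boxminus> a)" using lam_inv(2)[OF ac, of "inv\<^bsub>Mul\<^esub> a"] ac by simp
    then show ?thesis using inv[of "inv\<^bsub>Mul\<^esub> a" "\<boxminus> a"] ac subgroup.m_inv_closed[OF H a] by simp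
  qed
qed

lemma left_ideal_skew_brace:
  assumes H: "subgroup H Add" and inv: "\<And>a h. a \<in> carrier Add \<Longrightarrow> h \<in> H \<Longrightarrow> lam a h \<in> H"
  shows "skew_brace_pair (Add\<lparr>carrier := H\<rparr>) (Mul\<lparr>carrier := H\<rparr>)"
proof -
  have HM: "subgroup H Mul" by (rule left_ideal_subgroup[OF assms])
  have gr: "group (Add\<lparr>carrier := H\<rparr>)" "group (Mul\<lparr>carrier := H\<rparr>)"
    using A.subgroup_imp_group[OF H] M.subgroup_imp_group[OF HM] by auto
  have "skew_brace (Add\<lparr>carrier := H\<rparr>) (Mul\<lparr>carrier := H\<rparr>)"
    unfolding skew_brace_def
  proof (intro conjI ballI gr)
    fix a b c assume "a \<in> carrier (Add\<lparr>carrier := H\<rparr>)" "b \<in> carrier (Add\<lparr>carrier := H\<rparr>)" "c \<in> carrier (Add\<lparr>carrier := H\<rparr>)"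
    then have abc: "a \<in> H" "b \<in> H" "c \<in> H" by auto
    then have "a \<boxdot> (b \<boxplus> c) = (a \<boxdot> b) \<boxplus> \<boxminus> a \<boxplus> (a \<boxdot> c)" using distrib subgroup.mem_carrier[OF H] by simp
    then show "a \<otimes>\<^bsub>Mul\<lparr>carrier := H\<rparr>\<^esub> (b \<otimes>\<^bsub>Add\<lparr>carrier := H\<rparr>\<^esub> c) =
      a \<otimes>\<^bsub>Mul\<lparr>carrier := H\<rparr>\<^esub> b \<otimes>\<^bsub>Add\<lparr>carrier := H\<rparr>\<^esub> inv\<^bsub>Add\<lparr>carrier := H\<rparr>\<^esub> a \<otimes>\<^bsub>Add\<lparr>carrier := H\<rparr>\<^esub> (a \<otimes>\<^bsub>Mul\<lparr>carrier := H\<rparr>\<^esub> c)"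
      using A.m_inv_consistent[OF H abc(1)] by simp
  qed simp
  then show ?thesis using gr by (simp add: skew_brace_pair_def skew_brace_pair_axioms_def)
qed

lemma lam_prime_to_part:
  assumes "a \<in> carrier Add" "h \<in> A.prime_to_part p"
  shows "lam a h \<in> A.prime_to_part p"
proof -
  interpret h: group_hom Add Add "lam a" by (rule lam_hom[OF assms(1)])
  obtain k where k: "h \<in> carrier Add" "\<not> p dvd k" "h [^]\<^bsub>Add\<^esub> (k::nat) = \<one>\<^bsub>Add\<^esub>"
    using assms(2) by (auto simp: A.prime_to_part_def)
  have "lam a h [^]\<^bsub>Add\<^esub> k = \<one>\<^bsub>Add\<^esub>" using h.hom_nat_pow[OF k(1), of k] k(3) by simp
  then show ?thesis using k assms(1) by (auto simp: A.prime_to_part_def)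
qed

end

text \<open>Restricting carriers keeps the record types, so the induction on cardinality stays
  within one type. The indices may be computed additively since both groups share their
  carrier.\<close>

lemma class_two_skew_brace_solvable:
  fixes Add :: "('a, 'b) monoid_scheme" and Mul :: "('a, 'c) monoid_scheme"
  assumes "skew_brace_pair Add Mul" "finite (carrier Add)"
    and "\<And>x y z. x \<in> carrier Add \<Longrightarrow> y \<in> carrier Add \<Longrightarrow> z \<in> carrier Add \<Longrightarrow>
      z \<otimes>\<^bsub>Add\<^esub> (x \<otimes>\<^bsub>Add\<^esub> y \<otimes>\<^bsub>Add\<^esub> inv\<^bsub>Add\<^esub> x \<otimes>\<^bsub>Add\<^esub> inv\<^bsub>Add\<^esub> y)
        = (x \<otimes>\<^bsub>Add\<^esub> y \<otimes>\<^bsub>Add\<^esub> inv\<^bsub>Add\<^esub> x \<otimes>\<^bsub>Add\<^esub> inv\<^bsub>Add\<^esub> y) \<otimes>\<^bsub>Add\<^esub> z"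
  shows "solvable Mul"
  using assms
proof (induction "card (carrier Add)" arbitrary: Add Mul rule: less_induct)
  case less
  interpret skew_brace_pair Add Mul by fact
  note fin = less.prems(2) and central = less.prems(3)
  have finM: "finite (carrier Mul)" using fin by (simp add: carrier_Mul)
  have ordM: "order Mul = order Add" by (simp add: Coset.order_def carrier_Mul)
  have pos: "order Add \<noteq> 0" using fin A.order_gt_0_iff_finite by simp
  have hall: "solvable_seq Mul (A.prime_to_part p) \<and> (\<exists>k. card (rcosets\<^bsub>Mul\<^esub> (A.prime_to_part p)) = p ^ k)"
    if p: "prime p" "p dvd order Add" for p
  proof -
    let ?T = "A.prime_to_part p"
    have T: "subgroup ?T Add" by (rule A.prime_to_part_subgroup[OF central p(1)])
    have TM: "subgroup ?T Mul" by (rule left_ideal_subgroup[OF T lam_prime_to_part])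
    have Tc: "t \<in> carrier Add" if "t \<in> ?T" for t using that subgroup.mem_carrier[OF T] by blast
    have "solvable (Mul\<lparr>carrier := ?T\<rparr>)"
    proof (rule less.hyps[of "Add\<lparr>carrier := ?T\<rparr>"])
      show "card (carrier (Add\<lparr>carrier := ?T\<rparr>)) < card (carrier Add)"
        using A.prime_to_part_proper[OF fin p] fin psubset_card_mono by simp
      show "skew_brace_pair (Add\<lparr>carrier := ?T\<rparr>) (Mul\<lparr>carrier := ?T\<rparr>)"
        by (rule left_ideal_skew_brace[OF T lam_prime_to_part])
      show "finite (carrier (Add\<lparr>carrier := ?T\<rparr>))" using fin subgroup.subset[OF T] finite_subset by auto
      fix x y z assume "x \<in> carrier (Add\<lparr>carrier := ?T\<rparr>)" "y \<in> carrier (Add\<lparr>carrier := ?T\<rparr>)" "z \<in> carrier (Add\<lparr>carrier := ?T\<rparr>)"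
      then show "z \<otimes>\<^bsub>Add\<lparr>carrier := ?T\<rparr>\<^esub> (x \<otimes>\<^bsub>Add\<lparr>carrier := ?T\<rparr>\<^esub> y \<otimes>\<^bsub>Add\<lparr>carrier := ?T\<rparr>\<^esub> inv\<^bsub>Add\<lparr>carrier := ?T\<rparr>\<^esub> x \<otimes>\<^bsub>Add\<lparr>carrier := ?T\<rparr>\<^esub> inv\<^bsub>Add\<lparr>carrier := ?T\<rparr>\<^esub> y)
        = (x \<otimes>\<^bsub>Add\<lparr>carrier := ?T\<rparr>\<^esub> y \<otimes>\<^bsub>Add\<lparr>carrier := ?T\<rparr>\<^esub> inv\<^bsub>Add\<lparr>carrier := ?T\<rparr>\<^esub> x \<otimes>\<^bsub>Add\<lparr>carrier := ?T\<rparr>\<^esub> inv\<^bsub>Add\<lparr>carrier := ?T\<rparr>\<^esub> y) \<otimes>\<^bsub>Add\<lparr>carrier := ?T\<rparr>\<^esub> z"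
        using central[OF Tc Tc Tc] A.m_inv_consistent[OF T] by simp
    qed
    then have "solvable_seq Mul ?T" using M.solvable_seq_iff_solvable[OF TM] by simp
    moreover have "card (rcosets\<^bsub>Mul\<^esub> ?T) * card ?T = order Add" using M.lagrange[OF TM] ordM by simp
    then have "\<exists>k. card (rcosets\<^bsub>Mul\<^esub> ?T) = p ^ k" by (rule A.prime_to_part_index[OF fin p(1) T])
    ultimately show ?thesis by blast
  qed
  show ?case
  proof (cases rule: nat_two_or_three_prime_factors[OF pos])
    case (1 p q r)
    obtain i j k where ijk: "card (rcosets\<^bsub>Mul\<^esub> (A.prime_to_part p)) = p ^ i"
      "card (rcosets\<^bsub>Mul\<^esub> (A.prime_to_part q)) = q ^ j" "card (rcosets\<^bsub>Mul\<^esub> (A.prime_to_part r)) = r ^ k"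
      using hall 1(1-6) by metis
    have cop: "coprime (x ^ m) (y ^ l)" if "prime x" "prime y" "x \<noteq> y" for x y m l :: nat
      using primes_coprime[OF that] by simp
    have "solvable_seq Mul (A.prime_to_part p)" "solvable_seq Mul (A.prime_to_part q)" "solvable_seq Mul (A.prime_to_part r)"
      using hall 1(1-6) by auto
    from M.wielandt_coprime_indices[OF finM this] show ?thesis
      unfolding ijk using cop[OF 1(1,2,7)] cop[OF 1(1,3,8)] cop[OF 1(2,3,9)] by blast
  next
    case (2 p q a b)
    then show ?thesis using M.burnside_two_primes[OF finM] ordM by metis
  qed
qed

section \<open>From a cyclic derived subgroup to class two\<close>

context skew_brace_pair
begin

text \<open>All endomorphisms of a cyclic group are power maps, so they commute. Hence conjugation by
  \<open>lam g h\<close> and by \<open>h\<close> agree on the cyclic left ideal \<open>C\<close>, and \<open>g \<mapsto> (conjugation by g on C)\<close> is a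
  homomorphism with abelian image also for the multiplication.\<close>

lemma mul_commutator_centralizes_cyclic:
  assumes C: "C \<lhd> Add" and cyc: "c0 \<in> carrier Add" "C = range (\<lambda>n::int. c0 [^]\<^bsub>Add\<^esub> n)"
    and lamC: "\<And>a. a \<in> carrier Add \<Longrightarrow> lam a ` C = C"
    and g: "g \<in> carrier Add" and h: "h \<in> carrier Add" and c: "c \<in> C"
  shows "(g \<boxdot> h \<boxdot> inv\<^bsub>Mul\<^esub> g \<boxdot> inv\<^bsub>Mul\<^esub> h) \<boxplus> c = c \<boxplus> (g \<boxdot> h \<boxdot> inv\<^bsub>Mul\<^esub> g \<boxdot> inv\<^bsub>Mul\<^esub> h)"
proof -
  define cj where "cj x y = x \<boxplus> y \<boxplus> \<boxminus> x" for x y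
  have CS: "subgroup C Add" using C normal_imp_subgroup by blast
  have Cc: "y \<in> carrier Add" if "y \<in> C" for y using that subgroup.mem_carrier[OF CS] by blast
  have cj_closed: "cj x y \<in> C" if "x \<in> carrier Add" "y \<in> C" for x y
    using A.normal_invE(2)[OF C] that by (simp add: cj_def)
  have cj_hom: "group_hom Add Add (cj x)" if x: "x \<in> carrier Add" for x
  proof -
    have "cj x \<in> hom Add Add"
    proof (rule homI)
      fix a b assume a: "a \<in> carrier Add" and b: "b \<in> carrier Add"
      have "cj x a \<boxplus> cj x b = x \<boxplus> a \<boxplus> (\<boxminus> x \<boxplus> x) \<boxplus> b \<boxplus> \<boxminus> x"
        unfolding cj_def using x a b by (simp only: A.m_assoc A.m_closed A.inv_closed)
      then show "cj x (a \<boxplus> b) = cj x a \<boxplus> cj x b" unfolding cj_def using x a b by (simp add: A.m_assoc)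
    qed (use x in \<open>simp add: cj_def\<close>)
    then show ?thesis by (simp add: group_hom_def group_hom_axioms_def A.is_group)
  qed
  have power: "\<exists>m::int. \<forall>y\<in>C. \<phi> y = y [^]\<^bsub>Add\<^esub> m" if \<phi>: "group_hom Add Add \<phi>" "\<And>y. y \<in> C \<Longrightarrow> \<phi> y \<in> C" for \<phi>
  proof -
    interpret f: group_hom Add Add \<phi> by (rule \<phi>(1))
    have "c0 \<in> C" using cyc by (auto intro: range_eqI[of _ _ 1])
    then obtain m :: int where m: "\<phi> c0 = c0 [^]\<^bsub>Add\<^esub> m" using \<phi>(2) cyc(2) by blast
    have "\<phi> y = y [^]\<^bsub>Add\<^esub> m" if y: "y \<in> C" for y
    proof -
      obtain n :: int where n: "y = c0 [^]\<^bsub>Add\<^esub> n" using y cyc(2) by blast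
      have "\<phi> y = (c0 [^]\<^bsub>Add\<^esub> m) [^]\<^bsub>Add\<^esub> n" using f.hom_int_pow[OF cyc(1), of n] n m by simp
      also have "\<dots> = y [^]\<^bsub>Add\<^esub> m" unfolding n using cyc(1) by (simp add: A.int_pow_pow mult.commute)
      finally show ?thesis .
    qed
    then show ?thesis by blast
  qed
  have comm: "\<phi> (\<psi> y) = \<psi> (\<phi> y)"
    if \<phi>: "group_hom Add Add \<phi>" "\<And>y. y \<in> C \<Longrightarrow> \<phi> y \<in> C" and \<psi>: "group_hom Add Add \<psi>" "\<And>y. y \<in> C \<Longrightarrow> \<psi> y \<in> C" and y: "y \<in> C" for \<phi> \<psi> y
  proof -
    obtain m :: int where m: "\<And>y. y \<in> C \<Longrightarrow> \<phi> y = y [^]\<^bsub>Add\<^esub> m" using power[OF \<phi>] by blast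
    obtain l :: int where l: "\<And>y. y \<in> C \<Longrightarrow> \<psi> y = y [^]\<^bsub>Add\<^esub> l" using power[OF \<psi>] by blast
    have "\<phi> (\<psi> y) = (y [^]\<^bsub>Add\<^esub> l) [^]\<^bsub>Add\<^esub> m" using m[OF \<psi>(2)[OF y]] l[OF y] by simp
    also have "\<dots> = (y [^]\<^bsub>Add\<^esub> m) [^]\<^bsub>Add\<^esub> l" using Cc[OF y] by (simp add: A.int_pow_pow mult.commute)
    also have "\<dots> = \<psi> (\<phi> y)" using l[OF \<phi>(2)[OF y]] m[OF y] by simp
    finally show ?thesis .
  qed
  have lam_in: "lam a y \<in> C" if "a \<in> carrier Add" "y \<in> C" for a y using lamC[OF that(1)] that(2) by blast
  \<comment> \<open>\<open>lam a\<close> carries conjugation by \<open>b\<close> to conjugation by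
    \<open>lam a b\<close>. On \<open>C\<close> it commutes with conjugation by \<open>b\<close>, so
    the two conjugations coincide there.\<close>
  have cj_lam: "cj (lam a b) y = cj b y" if a: "a \<in> carrier Add" and b: "b \<in> carrier Add" and y: "y \<in> C" for a b y
  proof -
    interpret l: group_hom Add Add "lam a" by (rule lam_hom[OF a])
    obtain z where z: "z \<in> C" "y = lam a z" using lamC[OF a] y by blast
    have "cj (lam a b) y = lam a (cj b z)" unfolding cj_def z(2) using a b Cc[OF z(1)] by simp
    also have "\<dots> = cj b (lam a z)"
      by (rule comm[OF lam_hom[OF a] lam_in[OF a] cj_hom[OF b] cj_closed[OF b] z(1)])
    finally show ?thesis using z(2) by simp
  qed
  have cj_add: "cj (a \<boxplus> b) y = cj a (cj b y)" if "a \<in> carrier Add" "b \<in> carrier Add" "y \<in> carrier Add" for a b y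
    using that by (simp add: cj_def A.m_assoc A.inv_mult_group)
  have cj_mul: "cj (a \<boxdot> b) y = cj a (cj b y)" if ab: "a \<in> carrier Add" "b \<in> carrier Add" and y: "y \<in> C" for a b y
    using cj_add[OF ab(1) lam_closed[OF ab] Cc[OF y]] cj_lam[OF ab y] mul_eq_add_lam[OF ab] by simp
  define w where "w = g \<boxdot> h \<boxdot> inv\<^bsub>Mul\<^esub> g \<boxdot> inv\<^bsub>Mul\<^esub> h"
  have w: "w \<in> carrier Add" using g h by (simp add: w_def)
  have whg: "w \<boxdot> (h \<boxdot> g) = g \<boxdot> h"
    unfolding w_def using g h by (simp add: M.m_assoc carrier_Mul) (simp add: carrier_Mul flip: M.m_assoc)
  have hg: "h \<boxdot> g \<in> carrier Add" using g h by simp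
  \<comment> \<open>Writing \<open>c\<close> as the conjugate of \<open>d\<close> by
    \<open>h \<boxdot> g\<close> lets \<open>cj_mul\<close> be applied to the products
    \<open>w \<boxdot> (h \<boxdot> g)\<close>, \<open>g \<boxdot> h\<close> and
    \<open>h \<boxdot> g\<close>, with no multiplicative inverse to unfold.\<close>
  define d where "d = cj (\<boxminus> (h \<boxdot> g)) c"
  have d: "d \<in> C" using cj_closed hg c by (simp add: d_def)
  have dc: "cj (h \<boxdot> g) d = c" using cj_add[of "h \<boxdot> g" "\<boxminus> (h \<boxdot> g)" c] hg Cc[OF c] by (simp add: d_def) (simp add: cj_def)
  have "cj w c = cj w (cj (h \<boxdot> g) d)" using dc by simp
  also have "\<dots> = cj (g \<boxdot> h) d" using cj_mul[OF w hg d] whg by simp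
  also have "\<dots> = cj g (cj h d)" by (rule cj_mul[OF g h d])
  also have "\<dots> = cj h (cj g d)" by (rule comm[OF cj_hom[OF g] cj_closed[OF g] cj_hom[OF h] cj_closed[OF h] d])
  also have "\<dots> = c" using cj_mul[OF h g d] dc by simp
  finally have "w \<boxplus> c \<boxplus> \<boxminus> w = c" by (simp add: cj_def)
  then show ?thesis using w Cc[OF c] unfolding w_def[symmetric] by (metis A.inv_solve_right A.m_closed)
qed

theorem cyclic_derived_solvable:
  assumes fin: "finite (carrier Add)"
    and cyc: "cyclic_group (subgroup_generated Add (derived Add (carrier Add)))"
  shows "solvable Mul"
proof -
  define C where "C = derived Add (carrier Add)"
  have CN: "C \<lhd> Add" unfolding C_def by (rule A.derived_self_is_normal)
  have CS: "subgroup C Add" using CN normal_imp_subgroup by blast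
  have Cc: "c \<in> carrier Add" if "c \<in> C" for c using that subgroup.mem_carrier[OF CS] by blast
  have car: "carrier (subgroup_generated Add C) = C" by (rule subgroup.carrier_subgroup_generated_subgroup[OF CS])
  obtain c0 where c0: "c0 \<in> C" "C = range (\<lambda>n::int. c0 [^]\<^bsub>Add\<^esub> n)"
  proof -
    have "\<exists>x\<in>carrier (subgroup_generated Add C). carrier (subgroup_generated Add C) = range (\<lambda>n::int. x [^]\<^bsub>subgroup_generated Add C\<^esub> n)"
      using group.cyclic_group[OF A.group_subgroup_generated, of C] cyc by (simp add: C_def)
    then obtain x where x: "x \<in> C" "C = range (\<lambda>n::int. x [^]\<^bsub>subgroup_generated Add C\<^esub> n)" unfolding car by blast
    have "x [^]\<^bsub>subgroup_generated Add C\<^esub> n = x [^]\<^bsub>Add\<^esub> n" for n :: int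
      using A.int_pow_subgroup_generated[of x C n] x(1) car by simp
    then show ?thesis using that x by auto
  qed
  \<comment> \<open>A surjective endomorphism maps the derived subgroup onto itself.\<close>
  have lamC: "lam a ` C = C" if a: "a \<in> carrier Add" for a
  proof -
    interpret l: group_hom Add Add "lam a" by (rule lam_hom[OF a])
    show ?thesis unfolding C_def using l.derived_img[of "carrier Add"] lam_surj[OF a] by simp
  qed
  define K where "K = {k \<in> carrier Add. \<forall>c\<in>C. k \<boxplus> c = c \<boxplus> k}"
  have KS: "subgroup K Add"
  proof (rule A.subgroupI)
    show "K \<subseteq> carrier Add" by (auto simp: K_def)
    have "\<one>\<^bsub>Add\<^esub> \<in> K" using Cc by (simp add: K_def)
    then show "K \<noteq> {}" by blast
    show "\<boxminus> a \<in> K" if "a \<in> K" for a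
    proof -
      have a: "a \<in> carrier Add" "\<And>c. c \<in> C \<Longrightarrow> a \<boxplus> c = c \<boxplus> a" using that by (auto simp: K_def)
      have "\<boxminus> a \<boxplus> c = c \<boxplus> \<boxminus> a" if c: "c \<in> C" for c
      proof -
        have "\<boxminus> c \<in> C" using subgroup.m_inv_closed[OF CS c] .
        then have "\<boxminus> (a \<boxplus> \<boxminus> c) = \<boxminus> (\<boxminus> c \<boxplus> a)" using a(2) by simp
        then show ?thesis using a(1) Cc[OF c] by (simp add: A.inv_mult_group)
      qed
      then show ?thesis using a(1) by (simp add: K_def)
    qed
    show "a \<boxplus> b \<in> K" if "a \<in> K" "b \<in> K" for a b
    proof -
      have a: "a \<in> carrier Add" "\<And>c. c \<in> C \<Longrightarrow> a \<boxplus> c = c \<boxplus> a"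
        and b: "b \<in> carrier Add" "\<And>c. c \<in> C \<Longrightarrow> b \<boxplus> c = c \<boxplus> b" using that by (auto simp: K_def)
      have "a \<boxplus> b \<boxplus> c = c \<boxplus> (a \<boxplus> b)" if c: "c \<in> C" for c
      proof -
        have "a \<boxplus> b \<boxplus> c = a \<boxplus> (b \<boxplus> c)" using a(1) b(1) Cc[OF c] by (simp add: A.m_assoc)
        also have "\<dots> = (a \<boxplus> c) \<boxplus> b" unfolding b(2)[OF c] using a(1) b(1) Cc[OF c] by (simp add: A.m_assoc)
        also have "\<dots> = c \<boxplus> (a \<boxplus> b)" unfolding a(2)[OF c] using a(1) b(1) Cc[OF c] by (simp add: A.m_assoc)
        finally show ?thesis .
      qed
      then show ?thesis using a(1) b(1) by (simp add: K_def)
    qed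
  qed
  have Kc: "k \<in> carrier Add" "\<And>c. c \<in> C \<Longrightarrow> k \<boxplus> c = c \<boxplus> k" if "k \<in> K" for k using that by (auto simp: K_def)
  \<comment> \<open>\<open>lam a\<close> maps \<open>C\<close> onto itself, hence respects the
    property of commuting with all of \<open>C\<close>.\<close>
  have lamK: "lam a k \<in> K" if a: "a \<in> carrier Add" and k: "k \<in> K" for a k
  proof -
    have "lam a k \<boxplus> c = c \<boxplus> lam a k" if c: "c \<in> C" for c
    proof -
      obtain z where z: "z \<in> C" "c = lam a z" using lamC[OF a] c by blast
      show ?thesis unfolding z(2) using lam_add[OF a Kc(1)[OF k] Cc[OF z(1)]] lam_add[OF a Cc[OF z(1)] Kc(1)[OF k]] Kc(2)[OF k z(1)] by simp
    qed
    then show ?thesis using a Kc(1)[OF k] by (simp add: K_def)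
  qed
  have KM: "subgroup K Mul" by (rule left_ideal_subgroup[OF KS lamK])
  have inC: "x \<boxplus> y \<boxplus> \<boxminus> x \<boxplus> \<boxminus> y \<in> C" if "x \<in> carrier Add" "y \<in> carrier Add" for x y
    unfolding C_def derived_def using that by (intro generate.incl) auto
  have "solvable (Mul\<lparr>carrier := K\<rparr>)"
  proof (rule class_two_skew_brace_solvable[OF left_ideal_skew_brace[OF KS lamK]])
    show "finite (carrier (Add\<lparr>carrier := K\<rparr>))" using fin by (simp add: K_def)
    \<comment> \<open>Class at most two: additive commutators lie in \<open>C\<close>, and every
      element of \<open>K\<close> centralizes \<open>C\<close>.\<close>
    fix x y z assume "x \<in> carrier (Add\<lparr>carrier := K\<rparr>)" "y \<in> carrier (Add\<lparr>carrier := K\<rparr>)" "z \<in> carrier (Add\<lparr>carrier := K\<rparr>)"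
    then show "z \<otimes>\<^bsub>Add\<lparr>carrier := K\<rparr>\<^esub> (x \<otimes>\<^bsub>Add\<lparr>carrier := K\<rparr>\<^esub> y \<otimes>\<^bsub>Add\<lparr>carrier := K\<rparr>\<^esub> inv\<^bsub>Add\<lparr>carrier := K\<rparr>\<^esub> x \<otimes>\<^bsub>Add\<lparr>carrier := K\<rparr>\<^esub> inv\<^bsub>Add\<lparr>carrier := K\<rparr>\<^esub> y)
        = (x \<otimes>\<^bsub>Add\<lparr>carrier := K\<rparr>\<^esub> y \<otimes>\<^bsub>Add\<lparr>carrier := K\<rparr>\<^esub> inv\<^bsub>Add\<lparr>carrier := K\<rparr>\<^esub> x \<otimes>\<^bsub>Add\<lparr>carrier := K\<rparr>\<^esub> inv\<^bsub>Add\<lparr>carrier := K\<rparr>\<^esub> y) \<otimes>\<^bsub>Add\<lparr>carrier := K\<rparr>\<^esub> z"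
      using Kc(2)[of z, OF _ inC[of x y]] Kc(1) A.m_inv_consistent[OF KS] by simp
  qed
  then have solvK: "solvable_seq Mul K" using M.solvable_seq_iff_solvable[OF KM] by simp
  have "derived Mul (carrier Mul) \<subseteq> K" unfolding derived_def
  proof (rule M.generate_subgroup_incl[OF _ KM], rule subsetI)
    fix w assume "w \<in> derived_set Mul (carrier Mul)"
    then obtain g h where gh: "g \<in> carrier Add" "h \<in> carrier Add" "w = g \<boxdot> h \<boxdot> inv\<^bsub>Mul\<^esub> g \<boxdot> inv\<^bsub>Mul\<^esub> h"
      by (auto simp: carrier_Mul)
    then show "w \<in> K"
      using mul_commutator_centralizes_cyclic[OF CN Cc[OF c0(1)] c0(2) lamC gh(1,2)] by (simp add: K_def)
  qed
  then have "solvable_seq Mul (derived Mul (carrier Mul))"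
    by (intro M.solvable_seq_mono[OF solvK] M.derived_is_subgroup) auto
  \<comment> \<open>The derived subgroup is solvable inside \<open>K\<close>, and the abelian
    quotient adds one step.\<close>
  then show ?thesis unfolding solvable_def by (rule M.augment_solvable_seq[OF M.subgroup_self])
qed

end

theorem theorem5p2:
  fixes Add :: "('a, 'b) monoid_scheme" and Mul :: "('a, 'c) monoid_scheme"
  assumes "skew_brace Add Mul"
    and "finite (carrier Add)"
    and "cyclic_group (subgroup_generated Add (derived Add (carrier Add)))"
  shows "solvable Mul"
proof -
  interpret skew_brace_pair Add Mul
    using assms(1) by (simp add: skew_brace_pair_def skew_brace_pair_axioms_def skew_brace_def)
  show ?thesis by (rule cyclic_derived_solvable[OF assms(2,3)])
qed

end
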